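(* Suppose $\alpha>-(n+1)$, $0<p\le1$, and $\mu$ is a positive Borel measure on $\mathbb B_n$. Then the following two conditions are equivalent. (a) There exists a constant $C>0$ such that $$\int_{\mathbb B_n}|f(w)|^p\,d\mu(w)\le C\|f\|_{p,\alpha}^p$$ for all $f\in A^p_\alpha$. (b) There exists a constant $C>0$ such that $$\mu(Q_r(\zeta))\le Cr^{n+1+\alpha}$$ for all $\zeta\in\mathbb S_n$ and all $r\in(0,1)$.
   Context: Fix a positive integer $n$. $\mathbb B_n$ is the open unit ball of $\mathbb C^n$, $\mathbb S_n$ its boundary (unit sphere), $\langle z,w\rangle=\sum_j z_j\overline{w_j}$, $dv$ is volume measure, and $dv_\alpha(z)=(1-|z|^2)^\alpha dv(z)$ for real $\alpha$ (normalized to be a probability measure when $\alpha>-1$). For $\zeta\in\mathbb S_n$ and $r>0$, $Q_r(\zeta)=\{z\in\mathbb B_n:|1-\langle z,\zeta\rangle|<r\}$. The radial derivative is $Rf(z)=\sum_{k=1}^n z_k\frac{\partial f}{\partial z_k}(z)$, $R^k$ is its $k$-fold iterate, $R^0f=f$. For $p>0$ and real $\alpha$, $A^p_\alpha$ is the space of holomorphic $f$ in $\mathbb B_n$ such that, for a nonnegative integer $k$ with $pk+\alpha>-1$, $(1-|z|^2)^kR^kf(z)\in L^p(\mathbb B_n,dv_\alpha)$ (independent of the choice of such $k$). With $N$ the smallest nonnegative integer such that $pN+\alpha>-1$, $$\|f\|_{p,\alpha}=|f(0)|+\left[\int_{\mathbb B_n}(1-|z|^2)^{pN}|R^Nf(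z)|^p\,dv_\alpha(z)\right]^{1/p}.$$
   Formalization: The positive Borel measure μ is additionally assumed finite on compact subsets of the ball; without this, an infinite point mass at the origin satisfies (b) (the origin lies in no Q_r(ζ) with r<1) but violates (a) for f=1. *)

theory Defs
  imports "HOL-Analysis.Analysis"
begin

text \<open>
  Complex \<open>n\<close>-space is \<^typ>\<open>complex ^ 'n\<close> with \<open>n = CARD('n)\<close>; its norm is the Euclidean one, so
  \<open>ball 0 1\<close> and \<open>sphere 0 1\<close> are the unit ball and the unit sphere.
\<close>

definition hermitian_inner :: "complex ^ 'n \<Rightarrow> complex ^ 'n \<Rightarrow> complex" where
  "hermitian_inner z w = (\<Sum>j\<in>UNIV. z $ j * cnj (w $ j))"

definition carleson_tube :: "real \<Rightarrow> complex ^ 'n \<Rightarrow> (complex ^ 'n) set" where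
  "carleson_tube r \<zeta> = {z \<in> ball 0 1. cmod (1 - hermitian_inner z \<zeta>) < r}"

text \<open>
  Holomorphy in several variables on an open set: the real Frechet derivative exists and is
  complex linear at every point.
\<close>

definition holomorphic_vec_on :: "(complex ^ 'n \<Rightarrow> complex) \<Rightarrow> (complex ^ 'n) set \<Rightarrow> bool" where
  "holomorphic_vec_on f U \<longleftrightarrow>
     (\<forall>z\<in>U. \<exists>D. (f has_derivative D) (at z) \<and> (\<forall>c v. D (c *s v) = c * D v))"

definition complex_partial :: "'n \<Rightarrow> (complex ^ 'n \<Rightarrow> complex) \<Rightarrow> complex ^ 'n \<Rightarrow> complex" where
  "complex_partial k f z = deriv (\<lambda>t. f (z + axis k t)) 0"

definition radial_deriv :: "(complex ^ 'n \<Rightarrow> complex) \<Rightarrow> complex ^ 'n \<Rightarrow> complex" where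
  "radial_deriv f z = (\<Sum>k\<in>UNIV. z $ k * complex_partial k f z)"

text \<open>
  The measure \<open>dv\<^sub>\<alpha>\<close>: the unnormalized weighted volume, rescaled to total mass 1 exactly when
  \<open>\<alpha> > -1\<close> (for \<open>\<alpha> \<le> -1\<close> its total mass is infinite).
\<close>

definition weighted_volume :: "real \<Rightarrow> (complex ^ 'n) measure" where
  "weighted_volume \<alpha> =
     density (restrict_space lborel (ball 0 1)) (\<lambda>z. ennreal ((1 - (norm z)\<^sup>2) powr \<alpha>))"

definition dv_measure :: "real \<Rightarrow> (complex ^ 'n) measure" where
  "dv_measure \<alpha> =
     (let M = (weighted_volume \<alpha> :: (complex ^ 'n) measure) in
        if \<alpha> > -1 then scale_measure (inverse (emeasure M (space M))) M else M)"

definition in_Lp :: "real \<Rightarrow> 'a measure \<Rightarrow> ('a \<Rightarrow> complex) \<Rightarrow> bool" where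
  "in_Lp p M g \<longleftrightarrow>
     g \<in> borel_measurable M \<and> (\<integral>\<^sup>+ z. ennreal (cmod (g z) powr p) \<partial>M) < \<infinity>"

definition bergman_space :: "real \<Rightarrow> real \<Rightarrow> (complex ^ 'n \<Rightarrow> complex) set" where
  "bergman_space p \<alpha> =
     {f. holomorphic_vec_on f (ball 0 1) \<and>
         (\<exists>k::nat. p * real k + \<alpha> > -1 \<and>
            in_Lp p (dv_measure \<alpha>)
              (\<lambda>z. complex_of_real ((1 - (norm z)\<^sup>2) ^ k) * (radial_deriv ^^ k) f z))}"

definition bergman_order :: "real \<Rightarrow> real \<Rightarrow> nat" where
  "bergman_order p \<alpha> = (LEAST k::nat. p * real k + \<alpha> > -1)"

text \<open>Powers of extended nonnegative reals; only used with a positive exponent.\<close>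

definition ennreal_powr :: "ennreal \<Rightarrow> real \<Rightarrow> ennreal" where
  "ennreal_powr x a = (if x = \<infinity> then \<infinity> else ennreal (enn2real x powr a))"

text \<open>
  The norm takes values in \<open>[0, \<infinity>]\<close>, so that a divergent integral is never mistaken for 0.
\<close>

definition bergman_norm :: "real \<Rightarrow> real \<Rightarrow> (complex ^ 'n \<Rightarrow> complex) \<Rightarrow> ennreal" where
  "bergman_norm p \<alpha> f =
     (let N = bergman_order p \<alpha> in
        ennreal (cmod (f 0)) +
        ennreal_powr
          (\<integral>\<^sup>+ z. ennreal ((1 - (norm z)\<^sup>2) powr (p * real N)
                        * cmod ((radial_deriv ^^ N) f z) powr p) \<partial>dv_measure \<alpha>)
          (1 / p))"

text \<open>
  A positive Borel measure on the ball is, as usual, finite on compact subsets. Without this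
  convention the point mass of infinite weight at the origin would be admitted; the origin lies
  in no tube of radius less than 1.
\<close>

definition borel_measure_on_ball :: "(complex ^ 'n) measure \<Rightarrow> bool" where
  "borel_measure_on_ball \<mu> \<longleftrightarrow>
     sets \<mu> = sets (restrict_space borel (ball 0 1)) \<and>
     (\<forall>K. compact K \<and> K \<subseteq> ball 0 1 \<longrightarrow> emeasure \<mu> K < \<infinity>)"

end

theory Submission
  imports Defs "HOL-Complex_Analysis.Complex_Analysis"
begin

text \<open>
  Write \<open>n = CARD('n)\<close>, \<open>\<langle>z, w\<rangle> = hermitian_inner z w\<close>, \<open>R\<close> for the radial derivative and
  \<open>N\<close> for the order of derivation in the norm.

  Sufficiency of the tube condition rests on a bound at a single point
  (\<open>pointwise_area_estimate\<close>): for holomorphic \<open>f\<close>, the number \<open>|f(z)|^p\<close> is at most a constant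
  times
  \<open>|f(0)|^p + \<integral> (1 - |w|^2)^(pN - (n+1)) |R^N f(w)|^p dv(w)\<close>,
  where \<open>w\<close> runs over the region \<open>|1 - \<langle>z, w\<rangle>| \<le> 8 (1 - |w|^2)\<close>. Integrate this against \<open>\<mu>\<close> and
  exchange the integrals. The points \<open>z\<close> whose region contains a given \<open>w\<close> lie in one tube of radius
  comparable to \<open>1 - |w|^2\<close>, so they have \<open>\<mu>\<close>-measure \<open>O((1 - |w|^2)^(n+1+\<alpha>))\<close>, and the weight
  that remains is \<open>(1 - |w|^2)^(pN + \<alpha>)\<close>, the one in the norm.

  The bound at a point has two sources. The first is one-dimensional (\<open>euler_chain.radial_growth\<close>):
  along the ray \<open>t \<mapsto> t z\<close> the functions \<open>\<phi>_k(t) = R^k f(t z)\<close> satisfy \<open>t \<phi>_k' = \<phi>_(k+1)\<close>. Over the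
  block \<open>1 - t \<approx> 2^(-j)\<close> the function \<open>\<phi>_k\<close> changes by at most \<open>2^(-j)\<close> times the maximum of
  \<open>\<phi>_(k+1)\<close> on that block. Since \<open>p \<le> 1\<close>, the \<open>p\<close>-th power of a sum is at most the sum of the
  \<open>p\<close>-th powers, and \<open>N\<close> iterations bound \<open>|f(z)|^p\<close> by the sum over \<open>j\<close> of \<open>2^(-jNp)\<close> times the
  \<open>p\<close>-th powers of the block maxima of \<open>R^N f\<close>, together with \<open>|f(0)|^p\<close> and the size of \<open>R^N f\<close> near the
  origin. The second source (\<open>nonisotropic_ball_submean\<close>) turns each
  maximum into an area integral: for \<open>p \<le> 1\<close> the function \<open>|g|^p\<close> has the sub-mean value property,
  up to a constant, on balls of size \<open>\<delta>\<close> in the complex direction of the centre and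
  \<open>sqrt \<delta>\<close> in the other directions, where \<open>\<delta>\<close> is comparable to the distance of the centre from the sphere.
  Such a ball has volume comparable to \<open>\<delta>^(n+1)\<close>.

  Necessity follows by testing with \<open>f(z) = (1 - \<langle>z, a\<rangle>)^(-s)\<close>, where \<open>a = (1 - r) \<zeta>\<close> and \<open>s\<close> is a large
  integer. On the tube of radius \<open>r\<close> at \<open>\<zeta>\<close> the modulus of \<open>f\<close> is at least \<open>(2 r)^(-s)\<close>. The \<open>N\<close>-th
  radial derivative is a polynomial of degree at most \<open>s + N\<close> in \<open>1 / (1 - \<langle>z, a\<rangle>)\<close>, so the norm is
  controlled by the integral estimated in \<open>forelli_rudin_upper\<close>. That estimate sums over
  the tubes of radius \<open>2^k r\<close>, whose weighted volume is found by averaging over dilations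
  (\<open>weighted_tube_volume_small\<close>).
\<close>

section \<open>Lebesgue measure and orthonormal boxes\<close>

lemma nn_integral_lborel_shift:
  fixes f :: "'a::euclidean_space \<Rightarrow> ennreal"
  assumes [measurable]: "f \<in> borel_measurable borel"
  shows "(\<integral>\<^sup>+ y. f (c + y) \<partial>lborel) = (\<integral>\<^sup>+ y. f y \<partial>lborel)"
  by (subst (2) lborel_distr_plus[symmetric, of c], subst nn_integral_distr) auto

text \<open>
  Two translation invariant measures are proportional, by integrating
  \<open>1_A(T x) 1_B(T x + y)\<close> in both orders. Here \<open>B\<close> is the unit ball, which \<open>T\<close> preserves, so the
  factor of proportionality between Lebesgue measure and its image under \<open>T\<close> is 1.
\<close>

lemma lborel_orthogonal_image_emeasure:
  fixes T :: "'a::euclidean_space \<Rightarrow> 'a"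
  assumes T: "orthogonal_transformation T" and A: "A \<in> sets borel"
  shows "emeasure lborel (T -` A) = emeasure lborel A"
proof -
  obtain S where S: "\<And>x. S (T x) = x" "\<And>x. T (S x) = x"
    using orthogonal_transformation_bij[OF T] by (metis bij_inv_eq_iff)
  have lin: "linear T" using T by (rule orthogonal_transformation_linear)
  have [measurable]: "T \<in> borel_measurable borel"
    using lin by (intro borel_measurable_continuous_onI linear_continuous_on linear_conv_bounded_linear[THEN iffD1])
  define B :: "'a set" where "B = ball 0 1"
  have [measurable]: "B \<in> sets borel" "A \<in> sets borel" using A by (auto simp: B_def)
  have refl: "(\<integral>\<^sup>+ y. f (c - y) \<partial>lborel) = (\<integral>\<^sup>+ y. f y \<partial>lborel)"
    if [measurable]: "f \<in> borel_measurable borel" for f :: "'a \<Rightarrow> ennreal" and c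
  proof -
    have "lborel = distr lborel borel (\<lambda>x::'a. c + (-1) *\<^sub>R x)"
      using lborel_affine[of "-1" c] by (simp add: density_1)
    hence "(\<integral>\<^sup>+ y. f y \<partial>lborel) = (\<integral>\<^sup>+ y. f y \<partial>distr lborel borel (\<lambda>x::'a. c + (-1) *\<^sub>R x))" by simp
    also have "\<dots> = (\<integral>\<^sup>+ y. f (c - y) \<partial>lborel)" by (subst nn_integral_distr) auto
    finally show ?thesis by simp
  qed
  have "emeasure lborel (T -` A) * emeasure lborel B
      = (\<integral>\<^sup>+ x. indicator A (T x) * (\<integral>\<^sup>+ y. indicator B (T x + y) \<partial>lborel) \<partial>lborel)"
  proof -
    have "(\<integral>\<^sup>+ y. indicator B (T x + y) \<partial>lborel) = emeasure lborel B" for x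
      by (subst nn_integral_lborel_shift) auto
    moreover have "(\<integral>\<^sup>+ x. indicator A (T x) \<partial>lborel) = emeasure lborel (T -` A)"
    proof -
      have "T -` A \<in> sets lborel" using measurable_sets[of T borel borel A] by simp
      moreover have "(indicator A (T x) :: ennreal) = indicator (T -` A) x" for x by (simp add: indicator_def)
      ultimately show ?thesis by simp
    qed
    ultimately show ?thesis by (simp add: nn_integral_multc)
  qed
  also have "\<dots> = (\<integral>\<^sup>+ x. (\<integral>\<^sup>+ y. indicator A (T x) * indicator B (T x + y) \<partial>lborel) \<partial>lborel)"
    by (subst nn_integral_cmult) auto
  also have "\<dots> = (\<integral>\<^sup>+ y. (\<integral>\<^sup>+ x. indicator A (T x) * indicator B (T x + y) \<partial>lborel) \<partial>lborel)"
    by (rule lborel_pair.Fubini') measurable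
  also have "\<dots> = (\<integral>\<^sup>+ y. (\<integral>\<^sup>+ x. indicator A (T x - y) * indicator B (T x) \<partial>lborel) \<partial>lborel)"
  proof (rule nn_integral_cong)
    fix y
    have "T (- S y + x) = T x - y" for x
      using lin S by (simp add: linear_add linear_neg linear_diff)
    thus "(\<integral>\<^sup>+ x. indicator A (T x) * indicator B (T x + y) \<partial>lborel)
       = (\<integral>\<^sup>+ x. indicator A (T x - y) * indicator B (T x) \<partial>lborel)"
      by (subst nn_integral_lborel_shift[of _ "- S y", symmetric]) auto
  qed
  also have "\<dots> = (\<integral>\<^sup>+ x. (\<integral>\<^sup>+ y. indicator A (T x - y) * indicator B (T x) \<partial>lborel) \<partial>lborel)"
    by (rule lborel_pair.Fubini'[symmetric]) measurable
  also have "\<dots> = (\<integral>\<^sup>+ x. emeasure lborel A * indicator B (T x) \<partial>lborel)"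
  proof (rule nn_integral_cong)
    fix x
    have "(\<integral>\<^sup>+ y. indicator A (T x - y) \<partial>lborel) = emeasure lborel A" by (subst refl) auto
    thus "(\<integral>\<^sup>+ y. indicator A (T x - y) * indicator B (T x) \<partial>lborel) = emeasure lborel A * indicator B (T x)"
      by (subst nn_integral_multc) auto
  qed
  also have "\<dots> = emeasure lborel A * emeasure lborel B"
  proof -
    have "(indicator B (T x) :: ennreal) = indicator B x" for x
      using orthogonal_transformation_norm[OF T] by (auto simp: B_def indicator_def)
    thus ?thesis by (simp add: nn_integral_cmult)
  qed
  finally have *: "emeasure lborel (T -` A) * emeasure lborel B = emeasure lborel A * emeasure lborel B" .
  have "emeasure lborel B \<noteq> 0" using content_ball_pos[of 1 "0::'a"] by (auto simp: B_def measure_def)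
  moreover have "emeasure lborel B \<noteq> top"
    using emeasure_lborel_ball_finite[of "0::'a" 1] by (auto simp: B_def)
  ultimately show ?thesis
    using * ennreal_mult_cancel_left[of "emeasure lborel B"] by (simp add: mult.commute[of _ "emeasure lborel B"])
qed

lemma nn_integral_lborel_orthogonal:
  fixes T :: "'a::euclidean_space \<Rightarrow> 'a"
  assumes T: "orthogonal_transformation T" and [measurable]: "f \<in> borel_measurable borel"
  shows "(\<integral>\<^sup>+ x. f (T x) \<partial>lborel) = (\<integral>\<^sup>+ x. f x \<partial>lborel)"
proof -
  have [measurable]: "T \<in> borel_measurable borel"
    using orthogonal_transformation_linear[OF T]
    by (intro borel_measurable_continuous_onI linear_continuous_on linear_conv_bounded_linear[THEN iffD1])
  have "distr lborel borel T = lborel"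
  proof (rule measure_eqI)
    fix A assume "A \<in> sets (distr lborel borel T)"
    hence A: "A \<in> sets borel" by simp
    thus "emeasure (distr lborel borel T) A = emeasure lborel A"
      by (subst emeasure_distr) (auto simp: lborel_orthogonal_image_emeasure[OF T A])
  qed simp
  thus ?thesis using nn_integral_distr[of T lborel borel f] by simp
qed

definition orthonormal_basis :: "'a::euclidean_space set \<Rightarrow> bool" where
  "orthonormal_basis B \<longleftrightarrow> pairwise orthogonal B \<and> (\<forall>b\<in>B. norm b = 1) \<and> finite B \<and> card B = DIM('a)"

lemma orthonormal_basis_inner:
  assumes "orthonormal_basis B" "b \<in> B" "c \<in> B"
  shows "b \<bullet> c = (if b = c then 1 else 0)"
  using assms unfolding orthonormal_basis_def pairwise_def orthogonal_def
  by (auto simp: norm_eq_1)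

text \<open>
  The orthogonal map that carries the standard basis to \<open>B\<close> carries a coordinate box to this set.
\<close>

lemma emeasure_orthonormal_box:
  fixes B :: "'a::euclidean_space set"
  assumes B: "orthonormal_basis B" and le: "\<And>b. b \<in> B \<Longrightarrow> lo b \<le> hi b"
  shows "emeasure lborel {x. \<forall>b\<in>B. lo b \<le> x \<bullet> b \<and> x \<bullet> b \<le> hi b} = ennreal (\<Prod>b\<in>B. hi b - lo b)"
proof -
  have fin: "finite B" and card: "card B = DIM('a)" using B by (auto simp: orthonormal_basis_def)
  obtain h where h: "bij_betw h (Basis :: 'a set) B"
    using finite_same_card_bij[of Basis B] fin card by auto
  define T where "T = (\<lambda>x::'a. \<Sum>i\<in>Basis. (x \<bullet> i) *\<^sub>R h i)"
  have hB: "h i \<in> B" if "i \<in> Basis" for i using h that by (auto simp: bij_betw_def)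
  have hh: "h i \<bullet> h j = (if i = j then 1 else 0)" if "i \<in> Basis" "j \<in> Basis" for i j
    using orthonormal_basis_inner[OF B hB[OF that(1)] hB[OF that(2)]] that h
    by (auto simp: bij_betw_def inj_on_def)
  have Th: "T x \<bullet> h j = x \<bullet> j" if "j \<in> Basis" for x j
  proof -
    have "T x \<bullet> h j = (\<Sum>i\<in>Basis. (x \<bullet> i) * (h i \<bullet> h j))" by (simp add: T_def inner_sum_left)
    also have "\<dots> = (\<Sum>i\<in>Basis. if i = j then x \<bullet> j else 0)" using that by (intro sum.cong) (auto simp: hh)
    finally show ?thesis using that by simp
  qed
  have "T x \<bullet> T y = x \<bullet> y" for x y
  proof -
    have "T x \<bullet> T y = (\<Sum>i\<in>Basis. (y \<bullet> i) * (T x \<bullet> h i))"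
      by (subst (2) T_def) (simp add: inner_sum_right)
    also have "\<dots> = x \<bullet> y" by (subst (3) euclidean_inner) (simp add: Th mult.commute)
    finally show ?thesis .
  qed
  moreover have "linear T"
    unfolding T_def by (intro linearI) (simp_all add: inner_add_left sum.distrib scaleR_left_distrib scaleR_sum_right)
  ultimately have T: "orthogonal_transformation T" by (simp add: orthogonal_transformation_def)
  let ?S = "{x. \<forall>b\<in>B. lo b \<le> x \<bullet> b \<and> x \<bullet> b \<le> hi b}"
  define l u where "l = (\<Sum>i\<in>Basis. lo (h i) *\<^sub>R i :: 'a)" and "u = (\<Sum>i\<in>Basis. hi (h i) *\<^sub>R i :: 'a)"
  have li: "l \<bullet> i = lo (h i)" "u \<bullet> i = hi (h i)" if "i \<in> Basis" for i
    using that by (auto simp: l_def u_def inner_sum_left_Basis)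
  have Bh: "B = h ` Basis" using h by (auto simp: bij_betw_def)
  have "T -` ?S = cbox l u"
    by (auto simp: Bh Th mem_box li)
  moreover have "closed ?S"
    unfolding Collect_ball_eq by (intro closed_INT ballI closed_Collect_conj closed_Collect_le continuous_intros)
  ultimately have "emeasure lborel ?S = emeasure lborel (cbox l u)"
    using lborel_orthogonal_image_emeasure[OF T borel_closed[of ?S]] by simp
  also have "\<dots> = ennreal (\<Prod>i\<in>Basis. (u - l) \<bullet> i)"
    using le hB by (subst emeasure_lborel_cbox) (auto simp: li)
  also have "(\<Prod>i\<in>Basis. (u - l) \<bullet> i) = (\<Prod>i\<in>Basis. hi (h i) - lo (h i))"
    by (intro prod.cong) (auto simp: inner_diff_left li)
  also have "\<dots> = (\<Prod>b\<in>B. hi b - lo b)" using h by (rule prod.reindex_bij_betw)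
  finally show ?thesis .
qed

lemma orthonormal_basis_extend:
  fixes S :: "'a::euclidean_space set"
  assumes "pairwise orthogonal S" "\<And>x. x \<in> S \<Longrightarrow> norm x = 1"
  obtains B where "orthonormal_basis B" "S \<subseteq> B"
proof -
  obtain U where U: "U \<inter> insert 0 S = {}" "pairwise orthogonal (S \<union> U)" "span (S \<union> U) = span (S \<union> UNIV)"
    using orthogonal_extension_strong[OF assms(1)] by metis
  define B where "B = (\<lambda>x. x /\<^sub>R norm x) ` (S \<union> U)"
  have nz: "0 \<notin> S \<union> U" using U(1) assms(2) by force
  have orth: "pairwise orthogonal B"
    unfolding B_def pairwise_def ball_simps
  proof (intro ballI impI)
    fix x y assume "x \<in> S \<union> U" "y \<in> S \<union> U" "x /\<^sub>R norm x \<noteq> y /\<^sub>R norm y"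
    hence "orthogonal x y" using U(2) unfolding pairwise_def by metis
    thus "orthogonal (x /\<^sub>R norm x) (y /\<^sub>R norm y)" by (simp add: orthogonal_def)
  qed
  have n1: "norm b = 1" if bB: "b \<in> B" for b 
  proof -
    obtain x where "x \<in> S \<union> U" "b = x /\<^sub>R norm x" using bB unfolding B_def by blast
    moreover have "x \<noteq> 0" using nz calculation(1) by metis
    ultimately show ?thesis by simp
  qed
  have ind: "independent B" using orth n1 by (intro pairwise_orthogonal_independent) force+
  have fin: "finite B" using ind by (rule independent_imp_finite)
  have "x \<in> span B" if "x \<in> S \<union> U" for x
  proof -
    have "x = norm x *\<^sub>R (x /\<^sub>R norm x)" using nz that by (cases "x = 0") auto
    moreover have "x /\<^sub>R norm x \<in> B" using that by (auto simp: B_def)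
    ultimately show ?thesis by (metis span_base span_mul)
  qed
  hence "span (S \<union> U) \<subseteq> span B" by (intro span_minimal) auto
  hence "span B = UNIV" using U(3) by auto
  hence "card B = DIM('a)" using ind by (metis dim_UNIV dim_eq_card dim_span)
  moreover have "S \<subseteq> B"
  proof
    fix x assume "x \<in> S"
    thus "x \<in> B" using assms(2)[of x] unfolding B_def by (intro image_eqI[of _ _ x]) auto
  qed
  ultimately show ?thesis using that[of B] orth n1 fin by (auto simp: orthonormal_basis_def)
qed

section \<open>The Hermitian inner product and nonisotropic balls\<close>

lemma hermitian_inner_simps:
  "hermitian_inner (x + y) w = hermitian_inner x w + hermitian_inner y w"
  "hermitian_inner (x - y) w = hermitian_inner x w - hermitian_inner y w"
  "hermitian_inner w (x + y) = hermitian_inner w x + hermitian_inner w y"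
  "hermitian_inner w (x - y) = hermitian_inner w x - hermitian_inner w y"
  "hermitian_inner (c *s x) w = c * hermitian_inner x w"
  "hermitian_inner w (c *s x) = cnj c * hermitian_inner w x"
  "hermitian_inner (r *\<^sub>R x) w = of_real r * hermitian_inner x w"
  "hermitian_inner w (r *\<^sub>R x) = of_real r * hermitian_inner w x"
  "hermitian_inner 0 w = 0" "hermitian_inner w 0 = 0"
  by (simp_all add: hermitian_inner_def sum.distrib sum_subtractf sum_distrib_left algebra_simps scaleR_conv_of_real[where 'a=complex])

lemma hermitian_inner_cnj: "hermitian_inner y x = cnj (hermitian_inner x y)"
  by (simp add: hermitian_inner_def mult.commute)

lemma Re_hermitian_inner: "Re (hermitian_inner x y) = x \<bullet> y"
  by (simp add: hermitian_inner_def inner_vec_def inner_complex_def)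

lemma Im_hermitian_inner: "Im (hermitian_inner x y) = x \<bullet> (\<i> *s y)"
  unfolding Re_hermitian_inner[symmetric] by (simp add: hermitian_inner_simps)

lemma norm_eq_hermitian_inner: "hermitian_inner x x = of_real ((norm x)\<^sup>2)"
proof (rule complex_eqI)
  have "Im (hermitian_inner x x) = - Im (hermitian_inner x x)"
    by (subst hermitian_inner_cnj) simp
  thus "Im (hermitian_inner x x) = Im (of_real ((norm x)\<^sup>2))" by simp
qed (simp add: Re_hermitian_inner power2_norm_eq_inner)

lemma norm_vector_smult: "norm (c *s (x :: complex ^ 'n)) = cmod c * norm x"
proof -
  have "of_real ((norm (c *s x))\<^sup>2) = (of_real ((cmod c * norm x)\<^sup>2) :: complex)"
    unfolding norm_eq_hermitian_inner[symmetric] power_mult_distrib of_real_mult complex_norm_square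
    by (simp only: hermitian_inner_simps mult_ac)
  thus ?thesis by (simp only: of_real_eq_iff power2_eq_iff_nonneg mult_nonneg_nonneg norm_ge_zero)
qed

lemma cmod_hermitian_inner_le: "cmod (hermitian_inner x y) \<le> norm x * norm y"
proof -
  define h where "h = hermitian_inner x y"
  define c where "c = cnj (sgn h)"
  have "cmod h = Re (c * h)"
  proof -
    have "Re (c * h) = ((Re h)\<^sup>2 + (Im h)\<^sup>2) / cmod h"
      by (simp add: c_def sgn_eq power2_eq_square add_divide_distrib)
    also have "\<dots> = cmod h" unfolding cmod_power2[symmetric] by (simp add: power2_eq_square)
    finally show ?thesis by simp
  qed
  also have "\<dots> = (c *s x) \<bullet> y" by (simp add: h_def Re_hermitian_inner[symmetric] hermitian_inner_simps)
  also have "\<dots> \<le> norm (c *s x) * norm y" by (rule norm_cauchy_schwarz)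
  also have "\<dots> = cmod c * (norm x * norm y)" by (simp add: norm_vector_smult)
  also have "\<dots> \<le> 1 * (norm x * norm y)"
    by (intro mult_right_mono) (auto simp: c_def norm_sgn)
  finally show ?thesis by (simp add: h_def)
qed

lemma continuous_on_hermitian_inner [continuous_intros]:
  fixes f g :: "'a::topological_space \<Rightarrow> complex ^ 'n"
  assumes "continuous_on S f" "continuous_on S g"
  shows "continuous_on S (\<lambda>x. hermitian_inner (f x) (g x))"
  unfolding hermitian_inner_def by (intro continuous_intros assms)

lemma borel_measurable_hermitian_inner [measurable (raw)]:
  fixes f g :: "'a \<Rightarrow> complex ^ 'n"
  assumes [measurable]: "f \<in> borel_measurable M" "g \<in> borel_measurable M"
  shows "(\<lambda>x. hermitian_inner (f x) (g x)) \<in> borel_measurable M"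
proof -
  have "(\<lambda>z. hermitian_inner (fst z) (snd z :: complex ^ 'n)) \<in> borel_measurable borel"
    by (intro borel_measurable_continuous_onI continuous_intros)
  hence m: "(\<lambda>z. hermitian_inner (fst z) (snd z :: complex ^ 'n)) \<in> borel_measurable (borel \<Otimes>\<^sub>M borel)"
    by (simp add: borel_prod)
  have "(\<lambda>x. (f x, g x)) \<in> M \<rightarrow>\<^sub>M borel \<Otimes>\<^sub>M borel" by measurable
  from measurable_compose[OF this m] show ?thesis by simp
qed

lemma orthonormal_basis_expansion:
  fixes B :: "'a::euclidean_space set"
  assumes B: "orthonormal_basis B"
  shows "(\<Sum>b\<in>B. (x \<bullet> b) *\<^sub>R b) = x"
proof -
  have fin: "finite B" and card: "card B = DIM('a)" and n1: "\<forall>b\<in>B. norm b = 1"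
    and po: "pairwise orthogonal B"
    using B by (auto simp: orthonormal_basis_def)
  have ind: "independent B" using po n1 by (intro pairwise_orthogonal_independent) force+
  have span: "span B = UNIV"
    using card_ge_dim_independent[of B UNIV] ind card by auto
  define y where "y = x - (\<Sum>b\<in>B. (x \<bullet> b) *\<^sub>R b)"
  have "orthogonal y b" if "b \<in> B" for b
  proof -
    have "(\<Sum>c\<in>B. (x \<bullet> c) * (c \<bullet> b)) = (\<Sum>c\<in>B. if c = b then x \<bullet> b else 0)"
      using that by (intro sum.cong) (auto simp: orthonormal_basis_inner[OF B])
    thus ?thesis using that fin by (simp add: y_def orthogonal_def inner_diff_left inner_sum_left)
  qed
  hence "orthogonal y y"
    using orthogonal_to_span[of y B y] span by (auto simp: orthogonal_def inner_commute)
  thus ?thesis by (simp add: orthogonal_def y_def)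
qed

lemma norm_le_sum_orthonormal_basis:
  assumes "orthonormal_basis B"
  shows "norm x \<le> (\<Sum>b\<in>B. \<bar>x \<bullet> b\<bar>)"
proof -
  have "norm x = norm (\<Sum>b\<in>B. (x \<bullet> b) *\<^sub>R b)" by (simp add: orthonormal_basis_expansion[OF assms])
  also have "\<dots> \<le> (\<Sum>b\<in>B. norm ((x \<bullet> b) *\<^sub>R b))" by (rule norm_sum)
  also have "\<dots> = (\<Sum>b\<in>B. \<bar>x \<bullet> b\<bar>)" using assms by (intro sum.cong) (auto simp: orthonormal_basis_def)
  finally show ?thesis .
qed

lemma norm_square_orthonormal_basis:
  assumes B: "orthonormal_basis B"
  shows "(norm x)\<^sup>2 = (\<Sum>b\<in>B. (x \<bullet> b)\<^sup>2)"
proof -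
  have "(norm x)\<^sup>2 = (\<Sum>b\<in>B. (x \<bullet> b) *\<^sub>R b) \<bullet> x"
    by (simp add: orthonormal_basis_expansion[OF B] power2_norm_eq_inner)
  also have "\<dots> = (\<Sum>b\<in>B. (x \<bullet> b)\<^sup>2)"
    by (simp add: inner_sum_left inner_sum_right power2_eq_square inner_commute)
  finally show ?thesis .
qed

text \<open>
  A unit vector \<open>\<zeta>\<close> and \<open>\<i> \<zeta>\<close> are orthogonal over the reals. They span the complex direction of
  \<open>\<zeta>\<close>, and the inner products with them are the real and imaginary part of \<open>\<langle>z, \<zeta>\<rangle>\<close>.
\<close>

lemma complex_orthonormal_basis:
  fixes \<zeta> :: "complex ^ 'n"
  assumes "norm \<zeta> = 1"
  obtains B where "orthonormal_basis B" "\<zeta> \<in> B" "\<i> *s \<zeta> \<in> B" "\<i> *s \<zeta> \<noteq> \<zeta>"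
    "card (B - {\<zeta>, \<i> *s \<zeta>}) = 2 * (CARD('n) - 1)"
proof -
  have orth: "\<zeta> \<bullet> (\<i> *s \<zeta>) = 0"
    unfolding Im_hermitian_inner[symmetric] by (simp add: norm_eq_hermitian_inner)
  hence ne: "\<i> *s \<zeta> \<noteq> \<zeta>" using assms by (metis inner_eq_zero_iff norm_zero zero_neq_one)
  obtain B where B: "orthonormal_basis B" "{\<zeta>, \<i> *s \<zeta>} \<subseteq> B"
    using assms orth by (elim orthonormal_basis_extend[rotated 2, of "{\<zeta>, \<i> *s \<zeta>}"])
      (auto simp: pairwise_insert orthogonal_def inner_commute norm_vector_smult)
  have "card (B - {\<zeta>, \<i> *s \<zeta>}) = card B - 2"
    using B ne by (subst card_Diff_subset) (auto simp: orthonormal_basis_def)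
  also have "card B = CARD('n) * 2" using B by (simp add: orthonormal_basis_def)
  finally show ?thesis using that[of B] B ne by (simp add: diff_mult_distrib2)
qed

lemma prod_split_two:
  fixes f :: "'a \<Rightarrow> real"
  assumes "finite B" "x \<in> B" "y \<in> B" "x \<noteq> y" "f x = a" "f y = a" "\<And>b. b \<in> B - {x, y} \<Longrightarrow> f b = c"
  shows "prod f B = a^2 * c ^ card (B - {x, y})"
proof -
  have "prod f B = prod f {x, y} * prod f (B - {x, y})"
    using assms by (subst prod.subset_diff[of "{x, y}" B]) (auto simp: mult.commute)
  also have "prod f (B - {x, y}) = c ^ card (B - {x, y})"
    using assms(7) by (simp add: prod_constant)
  finally show ?thesis using assms by (simp add: power2_eq_square)
qed

text \<open>
  A point of the set differs from \<open>\<zeta>\<close> by \<open>O(R)\<close> along \<open>\<zeta>\<close> and \<open>\<i> \<zeta>\<close>. Since its norm is at most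
  \<open>1 + 2 R\<close>, Pythagoras leaves \<open>O(sqrt R)\<close> for each of the other \<open>2 n - 2\<close> directions. A box with these
  side lengths has volume comparable to \<open>R^2 R^(n-1)\<close>.
\<close>

lemma emeasure_nonisotropic_ball_upper:
  fixes \<zeta> :: "complex ^ 'n"
  assumes \<zeta>: "norm \<zeta> = 1" and R: "0 < R" "R \<le> 1 / 4"
  shows "emeasure lborel {z. norm z \<le> 1 + 2 * R \<and> cmod (1 - hermitian_inner z \<zeta>) \<le> 4 * R}
    \<le> ennreal (8 ^ (2 * CARD('n)) * R ^ (CARD('n) + 1))"
proof -
  obtain B where B: "orthonormal_basis B" "\<zeta> \<in> B" "\<i> *s \<zeta> \<in> B" "\<i> *s \<zeta> \<noteq> \<zeta>"
    and cardB: "card (B - {\<zeta>, \<i> *s \<zeta>}) = 2 * (CARD('n) - 1)"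
    using complex_orthonormal_basis[OF \<zeta>] by metis
  have dims: "2 + 2 * (CARD('n) - 1) = 2 * CARD('n)" "2 + (CARD('n) - 1) = CARD('n) + 1"
    using zero_less_card_finite[where 'a='n] by (simp_all del: zero_less_card_finite)
  have fin: "finite B" using B by (simp add: orthonormal_basis_def)
  define lo where "lo b = (if b = \<zeta> then 1 - 4 * R else if b = \<i> *s \<zeta> then - 4 * R else - 4 * sqrt R)" for b
  define hi where "hi b = (if b = \<zeta> then 1 + 4 * R else if b = \<i> *s \<zeta> then 4 * R else 4 * sqrt R)" for b
  let ?Z = "{z. norm z \<le> 1 + 2 * R \<and> cmod (1 - hermitian_inner z \<zeta>) \<le> 4 * R}"
  let ?X = "{x. \<forall>b\<in>B. lo b \<le> x \<bullet> b \<and> x \<bullet> b \<le> hi b}"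
  have "?Z \<subseteq> ?X"
  proof clarify
    fix z b assume z: "norm z \<le> 1 + 2 * R" "cmod (1 - hermitian_inner z \<zeta>) \<le> 4 * R" and b: "b \<in> B"
    have re: "\<bar>1 - z \<bullet> \<zeta>\<bar> \<le> 4 * R"
      using abs_Re_le_cmod[of "1 - hermitian_inner z \<zeta>"] z by (simp add: Re_hermitian_inner)
    have im: "\<bar>z \<bullet> (\<i> *s \<zeta>)\<bar> \<le> 4 * R"
      using abs_Im_le_cmod[of "1 - hermitian_inner z \<zeta>"] z by (simp add: Im_hermitian_inner)
    have "\<bar>z \<bullet> b\<bar> \<le> 4 * sqrt R" if "b \<noteq> \<zeta>"
    proof -
      have "(z \<bullet> \<zeta>)\<^sup>2 + (z \<bullet> b)\<^sup>2 = (\<Sum>b\<in>{\<zeta>, b}. (z \<bullet> b)\<^sup>2)" using that by simp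
      also have "\<dots> \<le> (\<Sum>b\<in>B. (z \<bullet> b)\<^sup>2)" using fin B b by (intro sum_mono2) auto
      also have "\<dots> = (norm z)\<^sup>2" using norm_square_orthonormal_basis[OF B(1), of z] by simp
      also have "\<dots> \<le> (1 + 2 * R)\<^sup>2" using z by (intro power_mono) auto
      finally have "(z \<bullet> b)\<^sup>2 \<le> (1 + 2 * R)\<^sup>2 - (z \<bullet> \<zeta>)\<^sup>2" by simp
      also have "(z \<bullet> \<zeta>)\<^sup>2 \<ge> (1 - 4 * R)\<^sup>2" using re R by (intro power_mono) auto
      hence "(1 + 2 * R)\<^sup>2 - (z \<bullet> \<zeta>)\<^sup>2 \<le> (1 + 2 * R)\<^sup>2 - (1 - 4 * R)\<^sup>2" by simp
      also have "\<dots> = 12 * R * (1 - R)" by (simp add: power2_eq_square algebra_simps)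
      also have "\<dots> \<le> 12 * R * 1" using R by (intro mult_left_mono) auto
      also have "\<dots> \<le> (4 * sqrt R)\<^sup>2" using R by (simp add: power_mult_distrib)
      finally have "\<bar>z \<bullet> b\<bar> \<le> \<bar>4 * sqrt R\<bar>" by (simp only: abs_le_square_iff)
      thus ?thesis using R by simp
    qed
    thus "lo b \<le> z \<bullet> b \<and> z \<bullet> b \<le> hi b" using re im by (auto simp: lo_def hi_def)
  qed
  moreover have "closed ?X"
    unfolding Collect_ball_eq by (intro closed_INT ballI closed_Collect_conj closed_Collect_le continuous_intros)
  ultimately have "emeasure lborel ?Z \<le> emeasure lborel ?X" by (intro emeasure_mono) auto
  also have "\<dots> = ennreal (\<Prod>b\<in>B. hi b - lo b)"
    using R by (intro emeasure_orthonormal_box B) (auto simp: lo_def hi_def)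
  also have "(\<Prod>b\<in>B. hi b - lo b) = (8 * R)\<^sup>2 * (8 * sqrt R) ^ (2 * (CARD('n) - 1))"
    unfolding cardB[symmetric] using B fin by (intro prod_split_two) (auto simp: lo_def hi_def)
  also have "\<dots> = 8 ^ (2 + 2 * (CARD('n) - 1)) * R ^ (2 + (CARD('n) - 1))"
    using R by (simp add: power_mult power_mult_distrib power_add power2_eq_square power_eq_if[of _ "CARD('n)"])
  also have "\<dots> = 8 ^ (2 * CARD('n)) * R ^ (CARD('n) + 1)" by (simp only: dims)
  finally show ?thesis .
qed

text \<open>
  The unit ball of this norm has size \<open>d\<close> in the complex direction of \<open>\<zeta>\<close> and \<open>sqrt d\<close> in the
  complex tangential directions. It is a norm, so \<open>submean_powr_of_submean\<close> applies to it, and it is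
  invariant under unimodular complex factors, so \<open>circled_set_submean\<close> applies to its balls.
\<close>

definition nonisotropic_gauge :: "complex ^ 'n \<Rightarrow> real \<Rightarrow> complex ^ 'n \<Rightarrow> real" where
  "nonisotropic_gauge \<zeta> d v = cmod (hermitian_inner v \<zeta>) / d + norm v / sqrt d"

text \<open>
  The ball contains a box with sides proportional to \<open>d\<close> along \<open>\<zeta>\<close> and \<open>\<i> \<zeta>\<close> and to \<open>sqrt d\<close>
  in the other directions of an orthonormal basis.
\<close>

lemma emeasure_nonisotropic_ball_lower:
  fixes \<zeta> :: "complex ^ 'n"
  assumes \<zeta>: "norm \<zeta> = 1" and d: "0 < d" "d \<le> 1"
  shows "emeasure lborel {v. nonisotropic_gauge \<zeta> d v < 1}
    \<ge> ennreal ((1 / (4 * real CARD('n))) ^ (2 * CARD('n)) * d ^ (CARD('n) + 1))"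
proof -
  obtain B where B: "orthonormal_basis B" "\<zeta> \<in> B" "\<i> *s \<zeta> \<in> B" "\<i> *s \<zeta> \<noteq> \<zeta>"
    and cardB: "card (B - {\<zeta>, \<i> *s \<zeta>}) = 2 * (CARD('n) - 1)"
    using complex_orthonormal_basis[OF \<zeta>] by metis
  have dims: "2 + 2 * (CARD('n) - 1) = 2 * CARD('n)" "2 + (CARD('n) - 1) = CARD('n) + 1"
    using zero_less_card_finite[where 'a='n] by (simp_all del: zero_less_card_finite)
  have fin: "finite B" and cB: "card B = 2 * CARD('n)" using B by (simp_all add: orthonormal_basis_def)
  define n where "n = real CARD('n)"
  have n: "n \<ge> 1" using zero_less_card_finite[where 'a='n] by (simp add: n_def Suc_leI del: zero_less_card_finite)
  define l where "l b = (if b = \<zeta> \<or> b = \<i> *s \<zeta> then d / (8 * n) else sqrt d / (8 * n))" for b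
  let ?E = "{v. nonisotropic_gauge \<zeta> d v < 1}"
  let ?X = "{x. \<forall>b\<in>B. - l b \<le> x \<bullet> b \<and> x \<bullet> b \<le> l b}"
  have dd: "d \<le> sqrt d" using d by (intro real_le_rsqrt) (simp add: power2_eq_square mult_left_le)
  have "?X \<subseteq> ?E"
  proof clarify
    fix v assume v: "\<forall>b\<in>B. - l b \<le> v \<bullet> b \<and> v \<bullet> b \<le> l b"
    hence vb: "\<bar>v \<bullet> b\<bar> \<le> l b" if "b \<in> B" for b using that by (simp add: abs_le_iff minus_le_iff)
    have "cmod (hermitian_inner v \<zeta>) \<le> \<bar>v \<bullet> \<zeta>\<bar> + \<bar>v \<bullet> (\<i> *s \<zeta>)\<bar>"
      using cmod_le[of "hermitian_inner v \<zeta>"] by (simp add: Re_hermitian_inner Im_hermitian_inner)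
    also have "\<dots> \<le> d / (8 * n) + d / (8 * n)" using vb[OF B(2)] vb[OF B(3)] by (simp add: l_def)
    also have "\<dots> \<le> d / 4" using n d by (simp add: field_simps mult_left_le)
    finally have 1: "cmod (hermitian_inner v \<zeta>) / d \<le> 1 / 4" using d by (simp add: field_simps)
    have "norm v \<le> (\<Sum>b\<in>B. \<bar>v \<bullet> b\<bar>)" by (rule norm_le_sum_orthonormal_basis[OF B(1)])
    also have "\<dots> \<le> (\<Sum>b\<in>B. sqrt d / (8 * n))"
      using vb dd n by (intro sum_mono) (fastforce simp: l_def divide_right_mono split: if_splits intro: order_trans)
    also have "\<dots> = sqrt d / 4" using n by (simp add: cB n_def)
    finally have 2: "norm v / sqrt d \<le> 1 / 4" using d by (simp add: field_simps)
    show "nonisotropic_gauge \<zeta> d v < 1" using 1 2 unfolding nonisotropic_gauge_def by linarith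
  qed
  moreover have "open ?E"
    unfolding nonisotropic_gauge_def using d
    by (intro open_Collect_less continuous_intros) auto
  ultimately have "emeasure lborel ?X \<le> emeasure lborel ?E" by (intro emeasure_mono) auto
  moreover have "emeasure lborel ?X = ennreal (\<Prod>b\<in>B. l b - - l b)"
    using d n by (intro emeasure_orthonormal_box B) (auto simp: l_def)
  moreover have "(\<Prod>b\<in>B. l b - - l b) = (d / (4 * n))\<^sup>2 * (sqrt d / (4 * n)) ^ (2 * (CARD('n) - 1))"
    unfolding cardB[symmetric] using B fin by (intro prod_split_two) (auto simp: l_def)
  moreover have "\<dots> = (1 / (4 * n)) ^ (2 + 2 * (CARD('n) - 1)) * d ^ (2 + (CARD('n) - 1))"
    using d by (simp add: power_mult power_mult_distrib power_add power_divide power2_eq_square power_eq_if[of _ "CARD('n)"])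
  ultimately show ?thesis by (simp only: n_def dims)
qed

section \<open>Holomorphic functions of several variables\<close>

lemma bounded_linear_smult_vec: "bounded_linear (\<lambda>t::complex. t *s (v :: complex ^ 'n))"
  unfolding linear_conv_bounded_linear[symmetric]
  by (intro linearI) (simp_all add: vec_eq_iff algebra_simps)

lemma continuous_on_smult_vec [continuous_intros]:
  fixes g :: "'a::topological_space \<Rightarrow> complex ^ 'n"
  assumes "continuous_on S f" "continuous_on S g"
  shows "continuous_on S (\<lambda>x. f x *s g x)"
  unfolding vector_scalar_mult_def
  by (intro continuous_on_vec_lambda continuous_on_mult assms continuous_on_component)

lemma has_field_derivative_along_line:
  fixes a b :: "complex ^ 'n"
  assumes "(f has_derivative D) (at (a + t *s b))" "\<And>c v. D (c *s v) = c * D v"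
  shows "((\<lambda>t. f (a + t *s b)) has_field_derivative D b) (at t)"
proof -
  have "((\<lambda>t. a + t *s b) has_derivative (\<lambda>h. h *s b)) (at t)"
    using has_derivative_add[OF has_derivative_const bounded_linear_imp_has_derivative[OF bounded_linear_smult_vec], of a b]
    by simp
  from has_derivative_compose[OF this assms(1)] show ?thesis
    unfolding has_field_derivative_def by (simp add: assms(2) mult.commute[of _ "D b"])
qed

definition directional_deriv :: "complex ^ 'n \<Rightarrow> (complex ^ 'n \<Rightarrow> complex) \<Rightarrow> complex ^ 'n \<Rightarrow> complex" where
  "directional_deriv v f z = deriv (\<lambda>t. f (z + t *s v)) 0"

lemma directional_deriv_eq:
  assumes "(f has_derivative D) (at z)" "\<And>c v. D (c *s v) = c * D v"
  shows "directional_deriv v f z = D v"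
  unfolding directional_deriv_def
  by (rule DERIV_imp_deriv) (use has_field_derivative_along_line[of f D z 0 v] assms in simp)

lemma holomorphic_vec_onD:
  assumes "holomorphic_vec_on f U" "z \<in> U"
  shows "(f has_derivative (\<lambda>v. directional_deriv v f z)) (at z)"
    and "directional_deriv (c *s v) f z = c * directional_deriv v f z"
proof -
  obtain D where D: "(f has_derivative D) (at z)" "\<And>c v. D (c *s v) = c * D v"
    using assms unfolding holomorphic_vec_on_def by metis
  have "directional_deriv v f z = D v" for v by (rule directional_deriv_eq[OF D])
  thus "(f has_derivative (\<lambda>v. directional_deriv v f z)) (at z)"
    and "directional_deriv (c *s v) f z = c * directional_deriv v f z" using D by simp_all
qed

lemma holomorphic_vec_onI:
  assumes "\<And>z. z \<in> U \<Longrightarrow> (f has_derivative D z) (at z)"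
    and "\<And>z c v. z \<in> U \<Longrightarrow> D z (c *s v) = c * D z v"
  shows "holomorphic_vec_on f U"
  using assms unfolding holomorphic_vec_on_def by blast

lemma holomorphic_vec_on_imp_continuous_on:
  assumes "holomorphic_vec_on f U" shows "continuous_on U f"
  by (intro continuous_at_imp_continuous_on ballI has_derivative_continuous[OF holomorphic_vec_onD(1)[OF assms]])

lemma holomorphic_vec_on_line:
  assumes "holomorphic_vec_on f U" "\<And>t. t \<in> S \<Longrightarrow> a + t *s b \<in> U"
  shows "(\<lambda>t. f (a + t *s b)) holomorphic_on S"
  unfolding holomorphic_on_def field_differentiable_def
proof
  fix t assume "t \<in> S"
  hence "((\<lambda>t. f (a + t *s b)) has_field_derivative directional_deriv b f (a + t *s b)) (at t)"
    by (intro has_field_derivative_along_line holomorphic_vec_onD[OF assms(1)] assms(2))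
  thus "\<exists>f'. ((\<lambda>t. f (a + t *s b)) has_field_derivative f') (at t within S)"
    using has_field_derivative_at_within by blast
qed

text \<open>
  Cauchy's formula for the derivative, on the complex line through \<open>z\<close> in the direction \<open>v\<close>. It
  represents the derivative by values of \<open>f\<close>, which makes it accessible to differentiation under the
  integral sign.
\<close>

lemma directional_deriv_circle_mean:
  assumes f: "holomorphic_vec_on f U" and r: "r > 0"
    and U: "\<And>t. cmod t \<le> r \<Longrightarrow> z + t *s v \<in> U"
  shows "((\<lambda>x. f (z + (of_real r * exp (2 * of_real pi * \<i> * of_real x)) *s v)
      * (exp (- 2 * of_real pi * \<i> * of_real x) / of_real r)) has_integral directional_deriv v f z) {0..1}"
proof -
  define g where "g t = f (z + t *s v)" for t
  have g: "g holomorphic_on cball 0 r"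
    unfolding g_def by (intro holomorphic_vec_on_line[OF f] U) auto
  have "((\<lambda>u. g u / (u - 0) ^ Suc 1) has_contour_integral (2 * of_real pi * \<i>) / fact 1 * (deriv ^^ 1) g 0) (circlepath 0 r)"
    using Cauchy_has_contour_integral_higher_derivative_circlepath[of 0 r g 0 1] r
      holomorphic_on_imp_continuous_on[OF g] holomorphic_on_subset[OF g ball_subset_cball] by simp
  hence "((\<lambda>x. g (circlepath 0 r x) / (circlepath 0 r x)\<^sup>2 * vector_derivative (circlepath 0 r) (at x within {0..1}))
      has_integral 2 * of_real pi * \<i> * deriv g 0) {0..1}"
    unfolding has_contour_integral_def by (simp add: power2_eq_square)
  from has_integral_mult_left[OF this, of "1 / (2 * of_real pi * \<i>)"]
  have "((\<lambda>x. g (circlepath 0 r x) / (circlepath 0 r x)\<^sup>2 * vector_derivative (circlepath 0 r) (at x within {0..1})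
      * (1 / (2 * of_real pi * \<i>))) has_integral directional_deriv v f z) {0..1}"
    by (simp add: directional_deriv_def g_def[abs_def])
  moreover have "g (circlepath 0 r x) / (circlepath 0 r x)\<^sup>2 * vector_derivative (circlepath 0 r) (at x within {0..1})
      * (1 / (2 * of_real pi * \<i>))
    = f (z + (of_real r * exp (2 * of_real pi * \<i> * of_real x)) *s v) * (exp (- 2 * of_real pi * \<i> * of_real x) / of_real r)"
    if "x \<in> {0..1}" for x
    using r that
    by (subst vector_derivative_circlepath01)
      (auto simp: g_def circlepath power2_eq_square field_simps exp_minus exp_add[symmetric] exp_diff)
  ultimately show ?thesis by (rule has_integral_eq[rotated])
qed

lemma radius_of_directions:
  fixes v :: "complex ^ 'n"
  assumes "open U" "z0 \<in> U"
  obtains r e where "r > 0" "e > 0" "\<And>z t. z \<in> ball z0 e \<Longrightarrow> cmod t \<le> r \<Longrightarrow> z + t *s v \<in> U"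
proof -
  have "open ((\<lambda>(z, t). z + t *s v) -` U)"
    unfolding case_prod_unfold using assms by (intro open_vimage continuous_intros)
  moreover have "(z0, 0) \<in> (\<lambda>(z, t). z + t *s v) -` U" using assms by simp
  ultimately obtain A B where AB: "open A" "open B" "z0 \<in> A" "0 \<in> B" "A \<times> B \<subseteq> (\<lambda>(z, t). z + t *s v) -` U"
    by (metis mem_Sigma_iff open_prod_elim)
  obtain e where e: "e > 0" "ball z0 e \<subseteq> A" using AB openE by metis
  obtain r where r: "r > 0" "cball 0 r \<subseteq> B" using AB open_contains_cball by metis
  show ?thesis using e r AB(5) by (intro that[of r e]) (force simp: subset_iff)+
qed

lemma continuous_on_directional_deriv:
  assumes f: "holomorphic_vec_on f U" and U: "open U"
  shows "continuous_on U (directional_deriv v f)"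
proof (intro continuous_at_imp_continuous_on ballI)
  fix z0 assume "z0 \<in> U"
  then obtain r e where re: "r > 0" "e > 0" "\<And>z t. z \<in> ball z0 e \<Longrightarrow> cmod t \<le> r \<Longrightarrow> z + t *s v \<in> U"
    using radius_of_directions[OF U] by metis
  have "continuous_on (ball z0 e) (\<lambda>z. integral (cbox 0 1) (\<lambda>x::real. f (z + (of_real r * exp (2 * of_real pi * \<i> * of_real x)) *s v)
      * (exp (- 2 * of_real pi * \<i> * of_real x) / of_real r)))"
    using re by (intro integral_continuous_on_param)
      (auto simp: case_prod_unfold norm_mult intro!: continuous_intros
        continuous_on_compose2[OF holomorphic_vec_on_imp_continuous_on[OF f]])
  also have "?this \<longleftrightarrow> continuous_on (ball z0 e) (directional_deriv v f)"
    unfolding cbox_interval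
    by (intro continuous_on_cong refl integral_unique directional_deriv_circle_mean[OF f] re)
  finally show "isCont (directional_deriv v f) z0"
    using re(2) continuous_on_eq_continuous_at[OF open_ball, of z0 e] by (metis centre_in_ball)
qed

text \<open>
  Holomorphy is defined by mere differentiability, so continuity of the derivative comes first, from the
  mean over circles. Then the Leibniz rule applies to the same mean, and the derivative of
  the integral inherits complex linearity from the integrand.
\<close>

proposition holomorphic_vec_on_directional_deriv:
  fixes f :: "complex ^ 'n \<Rightarrow> complex"
  assumes f: "holomorphic_vec_on f U" and U: "open U"
  shows "holomorphic_vec_on (directional_deriv v f) U"
  unfolding holomorphic_vec_on_def
proof
  fix z0 assume z0: "z0 \<in> U"
  then obtain r e where re: "r > 0" "e > 0" "\<And>z t. z \<in> ball z0 e \<Longrightarrow> cmod t \<le> r \<Longrightarrow> z + t *s v \<in> U"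
    using radius_of_directions[OF U] by metis
  define \<gamma> where "\<gamma> x = of_real r * exp (2 * of_real pi * \<i> * of_real x)" for x :: real
  define c where "c x = exp (- 2 * of_real pi * \<i> * of_real x) / of_real r" for x :: real
  have \<gamma>: "z + \<gamma> x *s v \<in> U" if "z \<in> ball z0 e" for z x
    using re(1) by (intro re that) (simp add: \<gamma>_def norm_mult)
  define L where "L z x = Blinfun (\<lambda>w. directional_deriv w f (z + \<gamma> x *s v) * c x)" for z x
  have L: "blinfun_apply (L z x) = (\<lambda>w. directional_deriv w f (z + \<gamma> x *s v) * c x)" if "z \<in> ball z0 e" for z x
    unfolding L_def
    by (intro bounded_linear_Blinfun_apply bounded_linear_mult_const
        has_derivative_bounded_linear[OF holomorphic_vec_onD(1)[OF f \<gamma>[OF that]]])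
  have cont_\<gamma>: "continuous_on X (\<lambda>p. \<gamma> (snd p))" "continuous_on X (\<lambda>p. c (snd p))"
    for X :: "((complex ^ 'n) \<times> real) set"
    unfolding \<gamma>_def c_def using re(1) by (auto intro!: continuous_intros)
  have contL: "continuous_on (ball z0 e \<times> cbox 0 1) (\<lambda>(z, x). L z x)"
  proof (rule continuous_on_blinfun_componentwise)
    fix i :: "complex ^ 'n"
    have "continuous_on (ball z0 e \<times> cbox 0 1) (\<lambda>p. directional_deriv i f (fst p + \<gamma> (snd p) *s v) * c (snd p))"
      using \<gamma> by (intro continuous_intros cont_\<gamma> continuous_on_compose2[OF continuous_on_directional_deriv[OF f U]]) auto
    thus "continuous_on (ball z0 e \<times> cbox 0 1) (\<lambda>p. blinfun_apply (case p of (z, x) \<Rightarrow> L z x) i)"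
      by (rule continuous_on_eq) (auto simp: L)
  qed
  have der: "((\<lambda>z. integral (cbox 0 1) (\<lambda>x. f (z + \<gamma> x *s v) * c x)) has_derivative
      blinfun_apply (integral (cbox 0 1) (L z0))) (at z0 within ball z0 e)"
  proof (rule leibniz_rule[OF _ _ contL])
    fix z x assume z: "z \<in> ball z0 e"
    have "((\<lambda>z. z + \<gamma> x *s v) has_derivative (\<lambda>h. h)) (at z)" by (auto intro!: derivative_eq_intros)
    from has_derivative_compose[OF this holomorphic_vec_onD(1)[OF f \<gamma>[OF z]]]
    have "((\<lambda>z. f (z + \<gamma> x *s v) * c x) has_derivative (\<lambda>h. directional_deriv h f (z + \<gamma> x *s v) * c x)) (at z)"
      by (rule has_derivative_mult_left)
    thus "((\<lambda>z. f (z + \<gamma> x *s v) * c x) has_derivative blinfun_apply (L z x)) (at z within ball z0 e)"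
      unfolding L[OF z] by (rule has_derivative_at_withinI)
  next
    fix z assume z: "z \<in> ball z0 e"
    have "continuous_on {0..1} (\<lambda>x::real. f (z + \<gamma> x *s v) * c x)"
      unfolding c_def using re(1) \<gamma>[OF z]
      by (intro continuous_intros continuous_on_compose2[OF holomorphic_vec_on_imp_continuous_on[OF f]])
        (auto simp: \<gamma>_def intro!: continuous_intros)
    thus "(\<lambda>x. f (z + \<gamma> x *s v) * c x) integrable_on cbox 0 1"
      by (metis box_real(2) integrable_continuous_interval)
  qed (use re in auto)
  have eq: "integral (cbox 0 1) (\<lambda>x. f (z + \<gamma> x *s v) * c x) = directional_deriv v f z" if "z \<in> ball z0 e" for z
    unfolding \<gamma>_def c_def cbox_interval
    by (rule integral_unique[OF directional_deriv_circle_mean[OF f re(1) re(3)[OF that]]])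
  let ?D = "blinfun_apply (integral (cbox 0 1) (L z0))"
  have "(directional_deriv v f has_derivative ?D) (at z0 within ball z0 e)"
    by (rule has_derivative_transform[OF _ _ der]) (use re(2) eq in auto)
  hence "(directional_deriv v f has_derivative ?D) (at z0)"
    using re(2) by (subst (asm) at_within_open) auto
  moreover have "?D (a *s w) = a * ?D w" for a w
  proof -
    have z: "z0 \<in> ball z0 e" using re(2) by simp
    have "continuous_on (cbox 0 1) (\<lambda>x. (\<lambda>(z, x). L z x) (z0, x))"
      by (rule continuous_on_compose2[OF contL]) (auto intro!: continuous_intros simp: re)
    hence int: "L z0 integrable_on cbox 0 1" by (intro integrable_continuous) simp
    have "?D w = integral (cbox 0 1) (\<lambda>x. blinfun_apply (L z0 x) w)" for w
      using int by (rule blinfun_apply_integral)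
    thus ?thesis by (simp add: L[OF z] holomorphic_vec_onD(2)[OF f \<gamma>[OF z]] mult.assoc)
  qed
  ultimately show "\<exists>D. (directional_deriv v f has_derivative D) (at z0) \<and> (\<forall>c v. D (c *s v) = c * D v)" by blast
qed

lemma holomorphic_vec_on_sum:
  assumes "finite I" "\<And>i. i \<in> I \<Longrightarrow> holomorphic_vec_on (f i) U"
  shows "holomorphic_vec_on (\<lambda>z. \<Sum>i\<in>I. f i z) U"
proof (rule holomorphic_vec_onI)
  fix z assume "z \<in> U"
  thus "((\<lambda>z. \<Sum>i\<in>I. f i z) has_derivative (\<lambda>v. \<Sum>i\<in>I. directional_deriv v (f i) z)) (at z)"
    by (intro has_derivative_sum holomorphic_vec_onD[OF assms(2)])
qed (auto simp: sum_distrib_left holomorphic_vec_onD(2)[OF assms(2)] intro!: sum.cong)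

lemma holomorphic_vec_on_mult:
  assumes "holomorphic_vec_on f U" "holomorphic_vec_on g U"
  shows "holomorphic_vec_on (\<lambda>z. f z * g z) U"
proof (rule holomorphic_vec_onI)
  fix z assume "z \<in> U"
  thus "((\<lambda>z. f z * g z) has_derivative (\<lambda>v. f z * directional_deriv v g z + directional_deriv v f z * g z)) (at z)"
    by (intro has_derivative_mult holomorphic_vec_onD(1)[OF assms(1)] holomorphic_vec_onD(1)[OF assms(2)])
qed (auto simp: holomorphic_vec_onD(2)[OF assms(1)] holomorphic_vec_onD(2)[OF assms(2)] algebra_simps)

lemma holomorphic_vec_on_nth: "holomorphic_vec_on (\<lambda>z. z $ k) U"
  by (rule holomorphic_vec_onI[where D="\<lambda>_ v. v $ k"])
    (auto intro!: bounded_linear_imp_has_derivative bounded_linear_vec_nth)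

lemma complex_partial_eq: "complex_partial k f = directional_deriv (axis k 1) f"
proof -
  have "axis k t = t *s axis k 1" for t :: complex by (simp add: vec_eq_iff axis_def)
  thus ?thesis by (metis complex_partial_def directional_deriv_def ext)
qed

text \<open>
  The sum over the coordinates collapses to the derivative of \<open>f\<close> at \<open>z\<close> applied to \<open>z\<close> itself.
\<close>

lemma radial_deriv_eq:
  assumes "(f has_derivative D) (at z)" "\<And>c v. D (c *s v) = c * D v"
  shows "radial_deriv f z = D z"
proof -
  have "radial_deriv f z = (\<Sum>k\<in>UNIV. D ((z $ k) *s axis k 1))"
    by (simp add: radial_deriv_def complex_partial_eq directional_deriv_eq[OF assms] assms(2))
  also have "\<dots> = D (\<Sum>k\<in>UNIV. (z $ k) *s axis k 1)"
    by (rule linear_sum[symmetric]) (use assms(1) in \<open>auto dest: has_derivative_linear\<close>)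
  also have "(\<Sum>k\<in>UNIV. (z $ k) *s axis k 1) = z" by (rule basis_expansion)
  finally show ?thesis .
qed

lemma holomorphic_vec_on_radial_deriv:
  assumes "holomorphic_vec_on f U" "open U"
  shows "holomorphic_vec_on (radial_deriv f) U"
  unfolding radial_deriv_def[abs_def] complex_partial_eq
  by (intro holomorphic_vec_on_sum holomorphic_vec_on_mult holomorphic_vec_on_nth
      holomorphic_vec_on_directional_deriv assms finite)

lemma holomorphic_vec_on_radial_deriv_iterate:
  assumes "holomorphic_vec_on f U" "open U"
  shows "holomorphic_vec_on ((radial_deriv ^^ k) f) U"
  by (induction k) (auto intro: holomorphic_vec_on_radial_deriv assms)

lemma radial_deriv_cong:
  assumes "open U" "z \<in> U" "\<And>w. w \<in> U \<Longrightarrow> f w = g w" "holomorphic_vec_on g U"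
  shows "radial_deriv f z = radial_deriv g z"
proof -
  note D = holomorphic_vec_onD[OF assms(4,2)]
  have "(f has_derivative (\<lambda>v. directional_deriv v g z)) (at z)"
    by (rule has_derivative_transform_within_open[OF D(1) assms(1,2)]) (simp add: assms(3))
  from radial_deriv_eq[OF this D(2)] radial_deriv_eq[OF D] show ?thesis by simp
qed

text \<open>
  On a complex line through the origin the radial derivative becomes the Euler operator
  \<open>t d/dt\<close>, which reduces iterated radial derivatives to functions of one variable.
\<close>

lemma radial_deriv_along_ray:
  assumes f: "holomorphic_vec_on f U" and tz: "t *s z \<in> U"
  obtains d where "((\<lambda>t. f (t *s z)) has_field_derivative d) (at t)" "t * d = radial_deriv f (t *s z)"
proof (rule that)
  note D = holomorphic_vec_onD[OF f tz]
  show "((\<lambda>t. f (t *s z)) has_field_derivative directional_deriv z f (t *s z)) (at t)"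
    using has_field_derivative_along_line[of f "\<lambda>v. directional_deriv v f (t *s z)" 0 t z] D by simp
  show "t * directional_deriv z f (t *s z) = radial_deriv f (t *s z)"
    using radial_deriv_eq[OF D] D(2) by simp
qed

lemma has_derivative_hermitian_inner:
  "((\<lambda>z. hermitian_inner z a) has_derivative (\<lambda>v. hermitian_inner v a)) (at z)"
  unfolding hermitian_inner_def
  by (intro has_derivative_sum has_derivative_mult_left bounded_linear_imp_has_derivative bounded_linear_vec_nth)

lemma has_derivative_compose_hermitian_inner:
  assumes "(F has_field_derivative d) (at (hermitian_inner z a))"
  shows "((\<lambda>z. F (hermitian_inner z a)) has_derivative (\<lambda>v. d * hermitian_inner v a)) (at z)"
  using has_derivative_compose[OF has_derivative_hermitian_inner] assms
  unfolding has_field_derivative_def by blast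

lemma radial_deriv_compose_hermitian_inner:
  assumes "(F has_field_derivative d) (at (hermitian_inner z a))"
  shows "radial_deriv (\<lambda>z. F (hermitian_inner z a)) z = hermitian_inner z a * d"
  by (subst radial_deriv_eq[OF has_derivative_compose_hermitian_inner[OF assms]])
    (simp_all add: hermitian_inner_simps)

lemma holomorphic_vec_on_compose_hermitian_inner:
  assumes "\<And>z. z \<in> U \<Longrightarrow> (F has_field_derivative F' (hermitian_inner z a)) (at (hermitian_inner z a))"
  shows "holomorphic_vec_on (\<lambda>z. F (hermitian_inner z a)) U"
  by (rule holomorphic_vec_onI[OF has_derivative_compose_hermitian_inner[OF assms]])
    (simp_all add: hermitian_inner_simps)

section \<open>The sub-mean value property of powers of holomorphic functions\<close>

lemma orthogonal_transformation_rotation: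
  assumes "cmod c = 1"
  shows "orthogonal_transformation (\<lambda>v. c *s (v :: complex ^ 'n))"
  unfolding orthogonal_transformation
proof (intro conjI allI)
  show "linear (\<lambda>v. c *s (v :: complex ^ 'n))"
    by (intro linearI) (simp_all add: vec_eq_iff algebra_simps)
qed (simp add: norm_vector_smult assms)

text \<open>
  The rotations \<open>v \<mapsto> exp(2 \<pi> i x) v\<close> preserve \<open>E\<close> and Lebesgue measure, so after exchanging the
  integrals the inner one does not depend on \<open>x\<close>.
\<close>

lemma nn_integral_rotation_average:
  fixes F :: "complex ^ 'n \<Rightarrow> ennreal"
  assumes [measurable]: "F \<in> borel_measurable borel" "E \<in> sets borel"
    and circ: "\<And>c v. cmod c = 1 \<Longrightarrow> c *s v \<in> E \<longleftrightarrow> v \<in> E"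
  shows "(\<integral>\<^sup>+ v. indicator E v * (\<integral>\<^sup>+ x. indicator {0..1} x * F (w + exp (2 * of_real pi * \<i> * of_real x) *s v) \<partial>lborel) \<partial>lborel)
    = (\<integral>\<^sup>+ v. indicator E v * F (w + v) \<partial>lborel)"
proof -
  define e where "e x = exp (2 * of_real pi * \<i> * of_real x)" for x :: real
  have e1: "cmod (e x) = 1" for x by (simp add: e_def)
  have "(\<lambda>p. w + e (fst p) *s (snd p)) \<in> borel_measurable borel"
    by (intro borel_measurable_continuous_onI continuous_intros) (simp add: e_def continuous_intros)
  hence "(\<lambda>p. w + e (fst p) *s (snd p)) \<in> borel \<Otimes>\<^sub>M borel \<rightarrow>\<^sub>M borel" by (simp add: borel_prod)
  hence [measurable]: "(\<lambda>p. F (w + e (fst p) *s (snd p))) \<in> borel_measurable (borel \<Otimes>\<^sub>M borel)" by measurable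
  have "(\<lambda>v. w + e x *s v) \<in> borel_measurable borel" for x
    by (intro borel_measurable_continuous_onI continuous_intros)
  hence [measurable]: "(\<lambda>v. F (w + e x *s v)) \<in> borel_measurable borel" for x by measurable
  have "(\<lambda>x. w + e x *s v) \<in> borel_measurable borel" for v
    by (intro borel_measurable_continuous_onI continuous_intros) (simp add: e_def continuous_intros)
  hence [measurable]: "(\<lambda>x. F (w + e x *s v)) \<in> borel_measurable borel" for v by measurable
  have "(\<integral>\<^sup>+ v. indicator E v * (\<integral>\<^sup>+ x. indicator {0..1} x * F (w + e x *s v) \<partial>lborel) \<partial>lborel)
    = (\<integral>\<^sup>+ v. (\<integral>\<^sup>+ x. indicator E v * (indicator {0..1} x * F (w + e x *s v)) \<partial>lborel) \<partial>lborel)"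
    by (subst nn_integral_cmult) auto
  also have "\<dots> = (\<integral>\<^sup>+ x. (\<integral>\<^sup>+ v. indicator E v * (indicator {0..1} x * F (w + e x *s v)) \<partial>lborel) \<partial>lborel)"
    by (rule lborel_pair.Fubini') (auto simp: case_prod_unfold)
  also have "\<dots> = (\<integral>\<^sup>+ (x::real). indicator {0..1} x * (\<integral>\<^sup>+ v. indicator E v * F (w + v) \<partial>lborel) \<partial>lborel)"
  proof (rule nn_integral_cong)
    fix x :: real
    have "(\<integral>\<^sup>+ v. indicator E v * (indicator {0..1} x * F (w + e x *s v)) \<partial>lborel)
      = (\<integral>\<^sup>+ v. indicator {0..1} x * (indicator E (e x *s v) * F (w + e x *s v)) \<partial>lborel)"
      using circ[OF e1] by (intro nn_integral_cong) (simp add: indicator_def)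
    also have "\<dots> = (\<integral>\<^sup>+ v. indicator {0..1} x * (indicator E v * F (w + v)) \<partial>lborel)"
      by (rule nn_integral_lborel_orthogonal[OF orthogonal_transformation_rotation[OF e1]]) measurable
    also have "\<dots> = indicator {0..1} x * (\<integral>\<^sup>+ v. indicator E v * F (w + v) \<partial>lborel)"
      by (rule nn_integral_cmult) measurable
    finally show "(\<integral>\<^sup>+ v. indicator E v * (indicator {0..1} x * F (w + e x *s v)) \<partial>lborel) = \<dots>" .
  qed
  also have "\<dots> = (\<integral>\<^sup>+ v. indicator E v * F (w + v) \<partial>lborel)"
    by (subst nn_integral_multc) auto
  finally show ?thesis by (simp add: e_def)
qed

lemma circle_mean_value:
  assumes f: "holomorphic_vec_on f U" and U: "\<And>t. cmod t \<le> 1 \<Longrightarrow> z + t *s v \<in> U"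
  shows "((\<lambda>x. f (z + exp (2 * of_real pi * \<i> * of_real x) *s v)) has_integral f z) {0..1}"
proof -
  define g where "g t = f (z + t *s v)" for t
  have g: "g holomorphic_on cball 0 1"
    unfolding g_def by (intro holomorphic_vec_on_line[OF f] U) auto
  have "((\<lambda>u. g u / (u - 0) ^ Suc 0) has_contour_integral (2 * of_real pi * \<i>) / fact 0 * (deriv ^^ 0) g 0) (circlepath 0 1)"
    using Cauchy_has_contour_integral_higher_derivative_circlepath[of 0 1 g 0 0]
      holomorphic_on_imp_continuous_on[OF g] holomorphic_on_subset[OF g ball_subset_cball] by simp
  hence "((\<lambda>x. g (circlepath 0 1 x) / circlepath 0 1 x * vector_derivative (circlepath 0 1) (at x within {0..1}))
      has_integral 2 * of_real pi * \<i> * g 0) {0..1}"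
    unfolding has_contour_integral_def by simp
  from has_integral_mult_left[OF this, of "1 / (2 * of_real pi * \<i>)"]
  have "((\<lambda>x. g (circlepath 0 1 x) / circlepath 0 1 x * vector_derivative (circlepath 0 1) (at x within {0..1})
      * (1 / (2 * of_real pi * \<i>))) has_integral f z) {0..1}"
    by (simp add: g_def)
  moreover have "g (circlepath 0 1 x) / circlepath 0 1 x * vector_derivative (circlepath 0 1) (at x within {0..1})
      * (1 / (2 * of_real pi * \<i>)) = f (z + exp (2 * of_real pi * \<i> * of_real x) *s v)"
    if "x \<in> {0..1}" for x
    using that by (subst vector_derivative_circlepath01) (auto simp: g_def circlepath field_simps)
  ultimately show ?thesis by (rule has_integral_eq[rotated])
qed

text \<open>
  The mean value property on each circle \<open>x \<mapsto> w + exp(2 \<pi> i x) v\<close> gives the inequality for fixed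
  \<open>v\<close>; integrating over \<open>v\<close> and undoing the rotation removes the circle.
\<close>

lemma circled_set_submean:
  fixes f :: "complex ^ 'n \<Rightarrow> complex"
  assumes f: "holomorphic_vec_on f U" and U: "open U" and E[measurable]: "E \<in> sets borel"
    and circ: "\<And>c v. cmod c = 1 \<Longrightarrow> c *s v \<in> E \<longleftrightarrow> v \<in> E"
    and EU: "\<And>t v. v \<in> E \<Longrightarrow> cmod t \<le> 1 \<Longrightarrow> w + t *s v \<in> U"
  shows "ennreal (cmod (f w)) * emeasure lborel E \<le> (\<integral>\<^sup>+ v. indicator E v * ennreal (cmod (f (w + v))) \<partial>lborel)"
proof -
  define G where "G u = ennreal (cmod (if u \<in> U then f u else 0))" for u
  have "(\<lambda>u. if u \<in> U then f u else 0) \<in> borel_measurable borel"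
    using U holomorphic_vec_on_imp_continuous_on[OF f] by (intro borel_measurable_continuous_on_if) auto
  hence [measurable]: "G \<in> borel_measurable borel" unfolding G_def by measurable
  have "ennreal (cmod (f w)) * emeasure lborel E = (\<integral>\<^sup>+ v. indicator E v * ennreal (cmod (f w)) \<partial>lborel)"
    by (subst nn_integral_multc) (auto simp: mult.commute)
  also have "\<dots> \<le> (\<integral>\<^sup>+ v. indicator E v * (\<integral>\<^sup>+ x. indicator {0..1} x * G (w + exp (2 * of_real pi * \<i> * of_real x) *s v) \<partial>lborel) \<partial>lborel)"
  proof (intro nn_integral_mono)
    fix v :: "complex ^ 'n"
    show "indicator E v * ennreal (cmod (f w)) \<le> indicator E v * (\<integral>\<^sup>+ x. indicator {0..1} x * G (w + exp (2 * of_real pi * \<i> * of_real x) *s v) \<partial>lborel)"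
    proof (cases "v \<in> E")
      case True
      define h where "h x = f (w + exp (2 * of_real pi * \<i> * of_real x) *s v)" for x :: real
      have inU: "w + exp (2 * of_real pi * \<i> * of_real x) *s v \<in> U" for x :: real
        using EU[OF True] by simp
      have ch: "continuous_on {0..1} h" unfolding h_def
        by (intro continuous_on_compose2[OF holomorphic_vec_on_imp_continuous_on[OF f]] continuous_intros)
          (use inU in auto)
      have hi: "(h has_integral f w) {0..1}" unfolding h_def by (rule circle_mean_value[OF f EU[OF True]])
      have ni: "((\<lambda>x. cmod (h x)) has_integral integral {0..1} (\<lambda>x. cmod (h x))) {0..1}"
        by (intro integrable_integral integrable_continuous_interval continuous_intros ch)
      have "cmod (f w) \<le> integral {0..1} (\<lambda>x. cmod (h x))"
        using integral_norm_bound_integral[OF has_integral_integrable[OF hi] has_integral_integrable[OF ni]]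
        unfolding integral_unique[OF hi] by simp
      hence "ennreal (cmod (f w)) \<le> ennreal (integral {0..1} (\<lambda>x. cmod (h x)))" by (rule ennreal_leI)
      also have "\<dots> = (\<integral>\<^sup>+ x. ennreal (indicator {0..1} x * cmod (h x)) \<partial>lborel)"
        using nn_integral_has_integral_lebesgue[OF _ ni] by simp
      also have "\<dots> = (\<integral>\<^sup>+ x. indicator {0..1} x * G (w + exp (2 * of_real pi * \<i> * of_real x) *s v) \<partial>lborel)"
        using inU by (intro nn_integral_cong) (simp add: G_def h_def indicator_def)
      finally show ?thesis by (simp add: True)
    qed simp
  qed
  also have "\<dots> = (\<integral>\<^sup>+ v. indicator E v * G (w + v) \<partial>lborel)"
    by (rule nn_integral_rotation_average) (use circ in auto)
  also have "\<dots> = (\<integral>\<^sup>+ v. indicator E v * ennreal (cmod (f (w + v))) \<partial>lborel)"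
    using EU[of _ 1] by (intro nn_integral_cong) (auto simp: G_def indicator_def)
  finally show ?thesis .
qed

lemma nn_integral_lborel_scale:
  fixes f :: "'a::euclidean_space \<Rightarrow> ennreal"
  assumes [measurable]: "f \<in> borel_measurable borel" and c: "c > 0"
  shows "(\<integral>\<^sup>+ x. f x \<partial>lborel) = ennreal (c ^ DIM('a)) * (\<integral>\<^sup>+ x. f (c *\<^sub>R x) \<partial>lborel)"
  using c by (subst lborel_affine[of c 0])
    (simp_all add: nn_integral_density nn_integral_distr nn_integral_cmult)

text \<open>
  Passage from exponent 1 to \<open>p \<le> 1\<close>, after Hardy and Littlewood. Let \<open>m\<close> be the supremum of
  \<open>(1 - \<rho>(v))^D F(v)^p\<close> over the unit ball of \<open>\<rho>\<close>, where \<open>D\<close> is the dimension. On a ball around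
  \<open>v\<close> of half the distance to the boundary, write \<open>F = F^p F^(1-p)\<close> and bound the second factor
  through \<open>m\<close>. This yields \<open>m \<le> const (I / V)^p m^(1-p)\<close> with \<open>I\<close> the integral of \<open>F^p\<close>,
  and since \<open>m\<close> is finite it can be solved for.
\<close>

lemma submean_powr_of_submean:
  fixes F :: "'a::euclidean_space \<Rightarrow> real" and \<rho> :: "'a \<Rightarrow> real" and p :: real
  defines "E \<equiv> {v. \<rho> v < 1}"
  assumes p: "0 < p" "p \<le> 1"
    and \<rho>: "\<rho> 0 = 0" "\<And>v. \<rho> v \<ge> 0" "\<And>u v. \<rho> (u + v) \<le> \<rho> u + \<rho> v" "\<And>c v. c > 0 \<Longrightarrow> \<rho> (c *\<^sub>R v) = c * \<rho> v"
    and \<rho>_cont: "continuous_on UNIV \<rho>"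
    and F: "\<And>v. F v \<ge> 0" "\<And>v. v \<in> E \<Longrightarrow> F v \<le> M" and [measurable]: "F \<in> borel_measurable borel"
    and vol: "0 < V" "emeasure lborel E = ennreal V"
    and submean: "\<And>v s. \<rho> v + s < 1 \<Longrightarrow> s > 0 \<Longrightarrow>
      ennreal (F v) * emeasure lborel {u. \<rho> u < s} \<le> (\<integral>\<^sup>+ u. indicator {u. \<rho> u < s} u * ennreal (F (v + u)) \<partial>lborel)"
  shows "ennreal (F 0 powr p * V) \<le> ennreal (2 powr (DIM('a) / p)) * (\<integral>\<^sup>+ v. indicator E v * ennreal (F v powr p) \<partial>lborel)"
proof -
  have [measurable]: "\<rho> \<in> borel_measurable borel" by (rule borel_measurable_continuous_onI[OF \<rho>_cont])
  define D where "D = DIM('a)"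
  define J where "J = (\<integral>\<^sup>+ v. indicator E v * ennreal (F v powr p) \<partial>lborel)"
  have [measurable]: "E \<in> sets borel" unfolding E_def by measurable
  have M0: "M \<ge> 0" using F(1)[of 0] F(2)[of 0] \<rho>(1) by (simp add: E_def)
  have "J \<le> (\<integral>\<^sup>+ v. ennreal (M powr p) * indicator E v \<partial>lborel)"
    unfolding J_def using F p by (intro nn_integral_mono) (auto simp: indicator_def intro!: ennreal_leI powr_mono2)
  also have "\<dots> = ennreal (M powr p) * ennreal V" by (simp add: nn_integral_cmult vol)
  also have "\<dots> < top" by (simp add: ennreal_mult_less_top)
  finally obtain I where I: "J = ennreal I" "I \<ge> 0" by (cases J) auto
  \<comment> \<open>The gauge is homogeneous, so its balls scale like Euclidean ones.\<close>
  have volE: "emeasure lborel {u. \<rho> u < s} = ennreal (s ^ D * V)" if s: "s > 0" for s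
  proof -
    have "emeasure lborel {u. \<rho> u < s} = (\<integral>\<^sup>+ u. indicator {u. \<rho> u < s} u \<partial>lborel)" by simp
    also have "\<dots> = ennreal (s ^ D) * (\<integral>\<^sup>+ u. indicator {u. \<rho> u < s} (s *\<^sub>R u) \<partial>lborel)"
      unfolding D_def by (rule nn_integral_lborel_scale) (use s in auto)
    also have "(\<integral>\<^sup>+ u. indicator {u. \<rho> u < s} (s *\<^sub>R u) \<partial>lborel) = (\<integral>\<^sup>+ u. indicator E u \<partial>lborel)"
      using s by (intro nn_integral_cong) (auto simp: indicator_def E_def \<rho>(4))
    also have "\<dots> = ennreal V" using vol by simp
    finally show ?thesis using s vol by (simp add: ennreal_mult)
  qed
  define h where "h v = (1 - \<rho> v) ^ D * F v powr p" for v
  define m where "m = (SUP v\<in>E. h v)"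
  have zE: "0 \<in> E" using \<rho>(1) by (simp add: E_def)
  have hM: "h v \<le> M powr p" if "v \<in> E" for v
  proof -
    have "(1 - \<rho> v) ^ D \<le> 1" using that \<rho>(2)[of v] by (intro power_le_one) (auto simp: E_def)
    moreover have "F v powr p \<le> M powr p" using that F p by (intro powr_mono2) auto
    ultimately have "h v \<le> 1 * M powr p" using that unfolding h_def by (intro mult_mono) (auto simp: E_def)
    thus ?thesis by simp
  qed
  have hm: "h v \<le> m" if "v \<in> E" for v
    unfolding m_def by (rule cSUP_upper[OF that]) (use hM in \<open>auto simp: bdd_above_def\<close>)
  have m0: "m \<ge> 0" using hm[OF zE] F(1)[of 0] by (simp add: h_def \<rho>(1)) (metis order_trans powr_ge_zero)
  have main: "h v \<le> 2 ^ D * (I / V) powr p * m powr (1 - p)" if v: "v \<in> E" for v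
  proof -
    define s where "s = (1 - \<rho> v) / 2"
    have s: "s > 0" "\<rho> v + s < 1" using v by (auto simp: s_def E_def field_simps)
    define K where "K = (m / s ^ D) powr ((1 - p) / p)"
    have pt: "F (v + u) \<le> F (v + u) powr p * K" "v + u \<in> E" if u: "\<rho> u < s" for u
    proof -
      have 1: "1 - \<rho> (v + u) \<ge> s" using \<rho>(3)[of v u] u by (simp add: s_def)
      thus E: "v + u \<in> E" using s by (simp add: E_def)
      have "s ^ D * F (v + u) powr p \<le> h (v + u)"
        unfolding h_def using 1 s by (intro mult_right_mono power_mono) auto
      also have "\<dots> \<le> m" by (rule hm[OF E])
      finally have "F (v + u) powr p \<le> m / s ^ D" using s by (simp add: field_simps)
      hence "(F (v + u) powr p) powr ((1 - p) / p) \<le> K"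
        unfolding K_def using p by (intro powr_mono2) auto
      hence "F (v + u) powr (1 - p) \<le> K" using p by (simp add: powr_powr)
      hence "F (v + u) powr p * F (v + u) powr (1 - p) \<le> F (v + u) powr p * K" by (rule mult_left_mono) simp
      thus "F (v + u) \<le> F (v + u) powr p * K" using F(1)[of "v + u"] by (simp add: powr_add[symmetric])
    qed
    have "ennreal (F v * (s ^ D * V)) = ennreal (F v) * emeasure lborel {u. \<rho> u < s}"
      using s F vol by (simp add: volE ennreal_mult)
    also have "\<dots> \<le> (\<integral>\<^sup>+ u. indicator {u. \<rho> u < s} u * ennreal (F (v + u)) \<partial>lborel)"
      by (rule submean) (use s in auto)
    also have "\<dots> \<le> (\<integral>\<^sup>+ u. ennreal K * (indicator E (v + u) * ennreal (F (v + u) powr p)) \<partial>lborel)"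
      using pt by (intro nn_integral_mono) (auto simp: indicator_def K_def ennreal_mult[symmetric] mult.commute intro!: ennreal_leI)
    also have "\<dots> = ennreal K * J" unfolding J_def
      by (subst nn_integral_lborel_shift[of "\<lambda>u. ennreal K * (indicator E u * ennreal (F u powr p))"])
        (auto simp: nn_integral_cmult)
    also have "\<dots> = ennreal (K * I)" using I by (simp add: ennreal_mult K_def)
    finally have "F v * (s ^ D * V) \<le> K * I" using I by (subst (asm) ennreal_le_iff) (auto simp: K_def)
    hence "F v \<le> K * (I / V) / s ^ D" using s vol by (simp add: field_simps)
    hence "F v powr p \<le> (K * (I / V) / s ^ D) powr p" using p F by (intro powr_mono2) auto
    also have "\<dots> = (m / s ^ D) powr (1 - p) * (I / V) powr p / (s ^ D) powr p"
      using I vol s p m0 by (simp add: powr_mult powr_divide K_def powr_powr)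
    also have "\<dots> = m powr (1 - p) * (I / V) powr p / s ^ D"
    proof -
      have "(s ^ D) powr (1 - p) * (s ^ D) powr p = s ^ D" using s by (simp add: powr_add[symmetric])
      thus ?thesis using m0 s by (simp add: powr_divide field_simps)
    qed
    finally have "s ^ D * F v powr p \<le> (I / V) powr p * m powr (1 - p)" using s by (simp add: field_simps)
    hence "2 ^ D * (s ^ D * F v powr p) \<le> 2 ^ D * ((I / V) powr p * m powr (1 - p))" by (intro mult_left_mono) auto
    moreover have "2 ^ D * s ^ D = (1 - \<rho> v) ^ D"
    proof -
      have "2 * s = 1 - \<rho> v" by (simp add: s_def)
      thus ?thesis by (metis power_mult_distrib)
    qed
    ultimately show ?thesis by (simp add: h_def mult.assoc[symmetric])
  qed
  have mle: "m \<le> 2 ^ D * (I / V) powr p * m powr (1 - p)"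
    unfolding m_def by (rule cSUP_least) (use zE main[unfolded m_def] in auto)
  have "m \<le> 2 powr (D / p) * (I / V)"
  proof (cases "m = 0")
    case False
    hence m: "m > 0" using m0 by simp
    have "m powr p * m powr (1 - p) \<le> 2 ^ D * (I / V) powr p * m powr (1 - p)"
      using mle m by (simp add: powr_add[symmetric])
    hence "m powr p \<le> 2 ^ D * (I / V) powr p" using m by simp
    hence "(m powr p) powr (1 / p) \<le> (2 ^ D * (I / V) powr p) powr (1 / p)" using p by (intro powr_mono2) auto
    thus ?thesis using m p I vol by (simp add: powr_powr powr_mult powr_realpow[symmetric])
  qed (use I vol in auto)
  hence "m * V \<le> 2 powr (D / p) * I" using vol by (simp add: field_simps)
  moreover have "F 0 powr p * V \<le> m * V"
    using hm[OF zE] vol by (intro mult_right_mono) (auto simp: h_def \<rho>(1))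
  ultimately have "F 0 powr p * V \<le> 2 powr (D / p) * I" by linarith
  thus ?thesis unfolding J_def[symmetric] I(1) using I(2) by (simp add: ennreal_mult[symmetric] D_def ennreal_leI)
qed

lemma nonisotropic_gauge_simps:
  fixes \<zeta> :: "complex ^ 'n"
  assumes d: "d > 0"
  shows "nonisotropic_gauge \<zeta> d 0 = 0" "nonisotropic_gauge \<zeta> d v \<ge> 0"
    "nonisotropic_gauge \<zeta> d (u + v) \<le> nonisotropic_gauge \<zeta> d u + nonisotropic_gauge \<zeta> d v"
    "nonisotropic_gauge \<zeta> d (c *s v) = cmod c * nonisotropic_gauge \<zeta> d v"
    "r > 0 \<Longrightarrow> nonisotropic_gauge \<zeta> d (r *\<^sub>R v) = r * nonisotropic_gauge \<zeta> d v"
    "continuous_on S (nonisotropic_gauge \<zeta> d)"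
    "nonisotropic_gauge \<zeta> d v \<le> 1 \<Longrightarrow> cmod (hermitian_inner v \<zeta>) \<le> d"
    "nonisotropic_gauge \<zeta> d v \<le> 1 \<Longrightarrow> norm v \<le> sqrt d"
proof -
  show "nonisotropic_gauge \<zeta> d 0 = 0" by (simp add: nonisotropic_gauge_def hermitian_inner_simps)
  show "nonisotropic_gauge \<zeta> d v \<ge> 0" using d by (simp add: nonisotropic_gauge_def)
  have "cmod (hermitian_inner (u + v) \<zeta>) / d \<le> (cmod (hermitian_inner u \<zeta>) + cmod (hermitian_inner v \<zeta>)) / d"
    using d by (intro divide_right_mono) (auto simp: hermitian_inner_simps norm_triangle_ineq)
  moreover have "norm (u + v) / sqrt d \<le> (norm u + norm v) / sqrt d"
    using d by (intro divide_right_mono norm_triangle_ineq) auto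
  ultimately show "nonisotropic_gauge \<zeta> d (u + v) \<le> nonisotropic_gauge \<zeta> d u + nonisotropic_gauge \<zeta> d v"
    by (simp add: nonisotropic_gauge_def add_divide_distrib)
  show "nonisotropic_gauge \<zeta> d (c *s v) = cmod c * nonisotropic_gauge \<zeta> d v"
    by (simp add: nonisotropic_gauge_def hermitian_inner_simps norm_mult norm_vector_smult algebra_simps)
  show "r > 0 \<Longrightarrow> nonisotropic_gauge \<zeta> d (r *\<^sub>R v) = r * nonisotropic_gauge \<zeta> d v"
    by (simp add: nonisotropic_gauge_def hermitian_inner_simps norm_mult algebra_simps)
  show "continuous_on S (nonisotropic_gauge \<zeta> d)"
    unfolding nonisotropic_gauge_def[abs_def] using d by (intro continuous_intros) auto
  assume 1: "nonisotropic_gauge \<zeta> d v \<le> 1"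
  have nn: "cmod (hermitian_inner v \<zeta>) / d \<ge> 0" "norm v / sqrt d \<ge> 0" using d by auto
  have "cmod (hermitian_inner v \<zeta>) / d \<le> 1" using 1 nn unfolding nonisotropic_gauge_def by linarith
  thus "cmod (hermitian_inner v \<zeta>) \<le> d" using d by (simp add: field_simps)
  have "norm v / sqrt d \<le> 1" using 1 nn unfolding nonisotropic_gauge_def by linarith
  thus "norm v \<le> sqrt d" using d by (simp add: field_simps)
qed

text \<open>
  For exponent 1 the inequality holds on all smaller balls inside, since they are circled; the passage to
  exponent \<open>p\<close> needs \<open>f\<close> bounded, which compactness of the closed ball provides.
\<close>

lemma nonisotropic_ball_submean:
  fixes f :: "complex ^ 'n \<Rightarrow> complex"
  assumes p: "0 < p" "p \<le> 1" and d: "0 < d" "d \<le> 1" and \<zeta>: "norm \<zeta> = 1"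
    and f: "holomorphic_vec_on f U" and U: "open U"
    and sub: "\<And>v. nonisotropic_gauge \<zeta> d v \<le> 1 \<Longrightarrow> w + v \<in> U"
  shows "ennreal (cmod (f w) powr p * ((1 / (4 * real CARD('n))) ^ (2 * CARD('n)) * d ^ (CARD('n) + 1)))
    \<le> ennreal (2 powr (2 * CARD('n) / p)) *
      (\<integral>\<^sup>+ v. indicator {v. nonisotropic_gauge \<zeta> d (v - w) < 1} v * ennreal (cmod (f v) powr p) \<partial>lborel)"
proof -
  define \<rho> where "\<rho> = nonisotropic_gauge \<zeta> d"
  note \<rho> = nonisotropic_gauge_simps[OF d(1), where \<zeta> = \<zeta>, folded \<rho>_def]
  have [measurable]: "\<rho> \<in> borel_measurable borel" by (rule borel_measurable_continuous_onI[OF \<rho>(6)])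
  define g where "g v = (if v \<in> U then f v else 0)" for v
  have [measurable]: "g \<in> borel_measurable borel" unfolding g_def
    using U holomorphic_vec_on_imp_continuous_on[OF f] by (intro borel_measurable_continuous_on_if) auto
  let ?E = "{v. \<rho> v < 1}" and ?c = "(1 / (4 * real CARD('n))) ^ (2 * CARD('n)) * d ^ (CARD('n) + 1)"
  have bounded: "bounded {v. \<rho> v \<le> 1}" using \<rho>(8) by (auto simp: bounded_iff)
  have "closed {v. \<rho> v \<le> 1}" by (intro closed_Collect_le \<rho>(6) continuous_intros)
  hence "compact {v. \<rho> v \<le> 1}" using bounded by (simp add: compact_eq_bounded_closed)
  moreover have "continuous_on {v. \<rho> v \<le> 1} (\<lambda>v. f (w + v))"
    by (intro continuous_on_compose2[OF holomorphic_vec_on_imp_continuous_on[OF f]] continuous_intros)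
      (use sub in \<open>auto simp: \<rho>_def\<close>)
  ultimately have "bounded ((\<lambda>v. f (w + v)) ` {v. \<rho> v \<le> 1})"
    by (intro compact_imp_bounded compact_continuous_image)
  then obtain M where M: "\<And>v. \<rho> v \<le> 1 \<Longrightarrow> cmod (f (w + v)) \<le> M" unfolding bounded_iff by auto
  have "emeasure lborel ?E \<le> emeasure lborel (cball (0 :: complex ^ 'n) (sqrt d))"
    using \<rho>(8) by (intro emeasure_mono) auto
  also have "\<dots> < top" using emeasure_lborel_cball_finite by simp
  finally obtain V where V: "emeasure lborel ?E = ennreal V" "V \<ge> 0" by (cases "emeasure lborel ?E") auto
  have cV: "?c \<le> V" using emeasure_nonisotropic_ball_lower[OF \<zeta> d] V by (simp add: \<rho>_def)
  have c0: "?c > 0" using d by simp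
  have "ennreal (cmod (g (w + 0)) powr p * V) \<le> ennreal (2 powr (DIM(complex ^ 'n) / p)) *
      (\<integral>\<^sup>+ v. indicator ?E v * ennreal (cmod (g (w + v)) powr p) \<partial>lborel)"
  proof (rule submean_powr_of_submean[where \<rho> = \<rho> and M = M])
    fix v s assume vs: "\<rho> v + s < 1" "(s::real) > 0"
    have inU: "w + v + t *s u \<in> U" if "\<rho> u < s" "cmod t \<le> 1" for u t
    proof -
      have "\<rho> (v + t *s u) \<le> \<rho> v + cmod t * \<rho> u" using \<rho>(3)[of v "t *s u"] \<rho>(4) by simp
      also have "\<dots> \<le> \<rho> v + 1 * \<rho> u" using that \<rho>(2) by (intro add_left_mono mult_right_mono) auto
      finally have "\<rho> (v + t *s u) \<le> 1" using that vs by simp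
      thus ?thesis using sub[of "v + t *s u"] by (simp add: \<rho>_def add.assoc)
    qed
    have "ennreal (cmod (f (w + v))) * emeasure lborel {u. \<rho> u < s}
      \<le> (\<integral>\<^sup>+ u. indicator {u. \<rho> u < s} u * ennreal (cmod (f (w + v + u))) \<partial>lborel)"
      by (rule circled_set_submean[OF f U]) (use inU \<rho>(4) in auto)
    also have "\<dots> = (\<integral>\<^sup>+ u. indicator {u. \<rho> u < s} u * ennreal (cmod (g (w + (v + u)))) \<partial>lborel)"
      using inU[of _ 1] by (intro nn_integral_cong) (auto simp: g_def indicator_def add.assoc)
    also have "f (w + v) = g (w + v)" using inU[of 0 0] vs \<rho>(1) by (simp add: g_def)
    finally show "ennreal (cmod (g (w + v))) * emeasure lborel {u. \<rho> u < s}
      \<le> (\<integral>\<^sup>+ u. indicator {u. \<rho> u < s} u * ennreal (cmod (g (w + (v + u)))) \<partial>lborel)" .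
  next
    show "0 < V" using cV c0 by linarith
    show "cmod (g (w + v)) \<le> M" if "v \<in> {v. \<rho> v < 1}" for v
      using that M[of v] order_trans[OF norm_ge_zero M[of 0]] \<rho>(1) by (simp add: g_def)
  qed (use p \<rho> V in auto)
  also have "(\<integral>\<^sup>+ v. indicator ?E v * ennreal (cmod (g (w + v)) powr p) \<partial>lborel)
      = (\<integral>\<^sup>+ v. indicator ?E (w + v - w) * ennreal (cmod (g (w + v)) powr p) \<partial>lborel)" by simp
  also have "\<dots> = (\<integral>\<^sup>+ v. indicator ?E (v - w) * ennreal (cmod (g v) powr p) \<partial>lborel)"
    by (rule nn_integral_lborel_shift[of "\<lambda>v. indicator ?E (v - w) * ennreal (cmod (g v) powr p)"]) measurable
  also have "\<dots> = (\<integral>\<^sup>+ v. indicator {v. \<rho> (v - w) < 1} v * ennreal (cmod (f v) powr p) \<partial>lborel)"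
    using sub[of "v - w" for v] by (intro nn_integral_cong) (auto simp: g_def indicator_def \<rho>_def)
  finally have *: "ennreal (cmod (g w) powr p * V) \<le> ennreal (2 powr (DIM(complex ^ 'n) / p)) *
    (\<integral>\<^sup>+ v. indicator {v. \<rho> (v - w) < 1} v * ennreal (cmod (f v) powr p) \<partial>lborel)" by simp
  have "g w = f w" using sub[of 0] \<rho>(1) by (simp add: g_def \<rho>_def)
  hence "ennreal (cmod (f w) powr p * ?c) \<le> ennreal (cmod (g w) powr p * V)"
    using cV by (intro ennreal_leI) (simp add: mult_left_mono)
  from order_trans[OF this *] show ?thesis by (simp add: \<rho>_def mult.commute)
qed

section \<open>Iterated radial derivatives along a ray\<close>

lemma add_powr_le:
  fixes x y p :: real
  assumes p: "0 < p" "p \<le> 1" and "x \<ge> 0" "y \<ge> 0"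
  shows "(x + y) powr p \<le> x powr p + y powr p"
proof (cases "x + y = 0")
  case False
  define s where "s = x + y"
  have s: "s > 0" using False assms by (simp add: s_def)
  have *: "t \<le> t powr p" if "0 \<le> t" "t \<le> 1" for t :: real
  proof (cases "t = 0")
    case False
    thus ?thesis using powr_mono'[of p 1 t] that p by simp
  qed simp
  have "1 = x / s + y / s" using s by (simp add: s_def add_divide_distrib[symmetric])
  also have "\<dots> \<le> (x / s) powr p + (y / s) powr p"
    using assms s by (intro add_mono *) (auto simp: s_def)
  also have "\<dots> = (x powr p + y powr p) / s powr p" using assms s by (simp add: powr_divide add_divide_distrib)
  finally show ?thesis using s by (simp add: s_def field_simps)
qed (use assms in auto)

lemma sum_geometric_tail:
  fixes \<theta> :: real
  assumes "0 < \<theta>" "\<theta> < 1"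
  shows "(\<Sum>j\<in>{j0..<m}. \<theta> ^ j) \<le> \<theta> ^ j0 / (1 - \<theta>)"
proof (induction "m - j0" arbitrary: m)
  case 0
  thus ?case using assms by simp
next
  case (Suc d)
  have "(\<Sum>j\<in>{j0..<m}. \<theta> ^ j) = (\<theta> ^ j0 - \<theta> ^ m) / (1 - \<theta>)"
    using assms Suc(2) sum_gp[of \<theta> j0 "m - 1"] by (cases m) (auto simp: atLeastLessThanSuc_atLeastAtMost)
  thus ?case using assms by (simp add: divide_right_mono)
qed

text \<open>
  Summation by parts: a partial sum weighted geometrically from its last index on costs only a
  constant factor.
\<close>

lemma sum_geometric_partial_sums:
  fixes \<theta> :: real and c :: "nat \<Rightarrow> real"
  assumes \<theta>: "0 < \<theta>" "\<theta> < 1" and c: "\<And>i. c i \<ge> 0"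
  shows "(\<Sum>j<m. \<theta> ^ j * (\<Sum>i\<le>j. c i)) \<le> (1 / (1 - \<theta>)) * (\<Sum>i<m. \<theta> ^ i * c i)"
proof -
  have "(1 - \<theta>) * (\<Sum>j<m. \<theta> ^ j * (\<Sum>i\<le>j. c i)) = (\<Sum>i<m. \<theta> ^ i * c i) - \<theta> ^ m * (\<Sum>i<m. c i)"
  proof (induction m)
    case (Suc m)
    have "(1 - \<theta>) * (\<Sum>j<Suc m. \<theta> ^ j * (\<Sum>i\<le>j. c i))
        = (\<Sum>i<m. \<theta> ^ i * c i) - \<theta> ^ m * (\<Sum>i<m. c i) + (1 - \<theta>) * (\<theta> ^ m * (\<Sum>i\<le>m. c i))"
      using Suc by (simp add: distrib_left)
    also have "(\<Sum>i\<le>m. c i) = (\<Sum>i<m. c i) + c m" by (simp add: lessThan_Suc_atMost[symmetric])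
    finally show ?case by (simp add: algebra_simps)
  qed simp
  also have "\<dots> \<le> (\<Sum>i<m. \<theta> ^ i * c i)" using \<theta> c by (simp add: sum_nonneg)
  finally show ?thesis using \<theta> by (simp add: field_simps)
qed

text \<open>
  The situation on one ray: \<open>\<phi> k\<close> plays the role of \<open>t \<mapsto> R^k f(t z)\<close>.
\<close>

locale euler_chain =
  fixes \<phi> :: "nat \<Rightarrow> complex \<Rightarrow> complex" and S :: "complex set"
  assumes open_S: "open S" and disc_S: "cball 0 1 \<subseteq> S"
    and hol: "\<And>k. \<phi> k holomorphic_on S"
    and euler: "\<And>k t. t \<in> S \<Longrightarrow> t * deriv (\<phi> k) t = \<phi> (Suc k) t"
begin

lemma in_S: "cmod t \<le> 1 \<Longrightarrow> t \<in> S" using disc_S by auto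

lemma has_deriv: "t \<in> S \<Longrightarrow> (\<phi> k has_field_derivative deriv (\<phi> k) t) (at t within X)"
  using holomorphic_derivI[OF hol open_S] has_field_derivative_at_within by blast

lemma continuous_on_real: "X \<subseteq> {0..1} \<Longrightarrow> continuous_on X (\<lambda>t::real. cmod (\<phi> k (of_real t)))"
  by (intro continuous_intros continuous_on_compose2[OF holomorphic_on_imp_continuous_on[OF hol]])
    (auto intro!: in_S)

lemma vanish_0: "\<phi> (Suc k) 0 = 0" using euler[of 0 k] in_S[of 0] by simp

text \<open>
  Near the origin the factor \<open>1 / t\<close> in \<open>\<phi>_k' = \<phi>_(k+1) / t\<close> is harmless: by the maximum modulus
  principle the bound for \<open>\<phi>_k'\<close> on the circle of radius \<open>1/2\<close>, where that factor is 2, holds inside.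
\<close>

lemma half_disc_bound:
  assumes M: "\<And>t. cmod t \<le> 1 / 2 \<Longrightarrow> cmod (\<phi> (Suc m) t) \<le> M" and "k \<le> Suc m" "cmod t \<le> 1 / 2"
  shows "cmod (\<phi> k t - \<phi> k 0) \<le> M"
  using assms(2,3)
proof (induction arbitrary: t rule: inc_induct)
  case base
  thus ?case using M[of t] by (simp add: vanish_0)
next
  case (step k)
  have sub: "cball 0 (1 / 2) \<subseteq> S" using in_S by auto
  have bnd: "cmod (deriv (\<phi> k) u) \<le> 2 * M" if "u \<in> cball 0 (1 / 2)" for u
  proof (rule maximum_modulus_frontier[of "deriv (\<phi> k)" "cball 0 (1 / 2)"])
    show "deriv (\<phi> k) holomorphic_on interior (cball 0 (1 / 2))"
      using sub by (intro holomorphic_on_subset[OF holomorphic_deriv[OF hol open_S]]) auto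
    show "continuous_on (closure (cball 0 (1 / 2))) (deriv (\<phi> k))"
      using sub by (intro holomorphic_on_imp_continuous_on holomorphic_on_subset[OF holomorphic_deriv[OF hol open_S]]) auto
    fix z :: complex assume "z \<in> frontier (cball 0 (1 / 2))"
    hence z: "cmod z = 1 / 2" by (simp add: frontier_cball)
    have "cmod z * cmod (deriv (\<phi> k) z) = cmod (\<phi> (Suc k) z)"
      using euler[of z k] z in_S[of z] by (simp add: norm_mult[symmetric])
    also have "\<dots> \<le> M" using step.IH[of z] z by (simp add: vanish_0)
    finally show "cmod (deriv (\<phi> k) z) \<le> 2 * M" using z by simp
  qed (use that in auto)
  have M0: "M \<ge> 0" using order_trans[OF norm_ge_zero M[of 0]] by simp
  have "cmod (\<phi> k t - \<phi> k 0) \<le> 2 * M * cmod (t - 0)"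
    by (rule field_differentiable_bound[of "cball 0 (1 / 2)", where f' = "deriv (\<phi> k)"])
      (use step.prems bnd sub in \<open>auto intro: has_deriv\<close>)
  also have "\<dots> \<le> 2 * M * (1 / 2)" using step.prems M0 by (intro mult_left_mono) auto
  finally show ?case by simp
qed

text \<open>
  The nodes cut \<open>[1/2, 1)\<close> into blocks on which \<open>1 - t\<close> is comparable to \<open>2^(-j)\<close>.
\<close>

definition node :: "nat \<Rightarrow> real" where "node j = 1 - (1 / 2) ^ Suc j"

lemma node_bounds: "1 / 2 \<le> node j" "node j \<le> node (Suc j)" "node j < 1" "node (Suc j) - node j = (1 / 2) ^ Suc (Suc j)"
  by (auto simp: node_def power_le_one)

lemma block_max: "\<exists>t\<in>{node j..node (Suc j)}. \<forall>s\<in>{node j..node (Suc j)}. cmod (\<phi> k (of_real s)) \<le> cmod (\<phi> k (of_real t))"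
  using node_bounds[of j] node_bounds[of "Suc j"]
  by (intro continuous_attains_sup continuous_on_real) auto

definition peak :: "nat \<Rightarrow> nat \<Rightarrow> real" where
  "peak k j = (SOME t. t \<in> {node j..node (Suc j)} \<and> (\<forall>s\<in>{node j..node (Suc j)}. cmod (\<phi> k (of_real s)) \<le> cmod (\<phi> k (of_real t))))"

lemma peak: "peak k j \<in> {node j..node (Suc j)}"
  "s \<in> {node j..node (Suc j)} \<Longrightarrow> cmod (\<phi> k (of_real s)) \<le> cmod (\<phi> k (of_real (peak k j)))"
  using someI_ex[OF block_max[unfolded Bex_def, of j k]] unfolding peak_def by blast+

text \<open>
  The block has length \<open>2^(-j-2)\<close>, and there \<open>|\<phi>_k'| \<le> 2 |\<phi>_(k+1)|\<close> because \<open>t \<ge> 1/2\<close>.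
  Subadditivity of \<open>x \<mapsto> x^p\<close> then allows the estimate to be iterated.
\<close>

lemma block_increment:
  assumes p: "0 < p" "p \<le> 1" and t: "t \<in> {node j..node (Suc j)}"
  shows "cmod (\<phi> k (of_real t)) powr p \<le>
    cmod (\<phi> k (of_real (node j))) powr p + (2 powr (- p)) ^ j * cmod (\<phi> (Suc k) (of_real (peak (Suc k) j))) powr p"
proof -
  define B where "B = cmod (\<phi> (Suc k) (of_real (peak (Suc k) j)))"
  let ?I = "closed_segment (complex_of_real (node j)) (complex_of_real (node (Suc j)))"
  have I: "\<exists>s\<in>{node j..node (Suc j)}. u = of_real s" if "u \<in> ?I" for u
    using that node_bounds(2)[of j] by (auto simp: closed_segment_of_real closed_segment_eq_real_ivl)
  have "cmod (\<phi> k (of_real t) - \<phi> k (of_real (node j))) \<le> 2 * B * cmod (of_real t - of_real (node j))"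
  proof (rule field_differentiable_bound[OF convex_closed_segment[of "complex_of_real (node j)" "complex_of_real (node (Suc j))"],
        where f' = "deriv (\<phi> k)"])
    fix u assume "u \<in> ?I"
    then obtain s where s: "s \<in> {node j..node (Suc j)}" "u = of_real s" using I by blast
    have s1: "1 / 2 \<le> s" "s \<le> 1" using s node_bounds(1)[of j] node_bounds(3)[of "Suc j"] by auto
    hence "u \<in> S" using s by (intro in_S) simp
    thus "(\<phi> k has_field_derivative deriv (\<phi> k) u) (at u within ?I)" by (rule has_deriv)
    have "s * cmod (deriv (\<phi> k) u) = cmod (\<phi> (Suc k) u)"
      using s s1 unfolding euler[OF \<open>u \<in> S\<close>, of k, symmetric] by (simp add: norm_mult)
    also have "\<dots> \<le> B" unfolding B_def s(2) by (rule peak(2)[OF s(1)])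
    finally have "s * cmod (deriv (\<phi> k) u) \<le> B" .
    moreover have "(1 / 2) * cmod (deriv (\<phi> k) u) \<le> s * cmod (deriv (\<phi> k) u)"
      using s1 by (intro mult_right_mono) auto
    ultimately show "cmod (deriv (\<phi> k) u) \<le> 2 * B" by simp
  qed (use t node_bounds(2)[of j] in \<open>auto simp: closed_segment_of_real closed_segment_eq_real_ivl\<close>)
  also have "cmod (of_real t - of_real (node j)) = t - node j" using t by (simp flip: of_real_diff)
  also have "2 * B * (t - node j) \<le> 2 * B * (1 / 2) ^ Suc (Suc j)"
    using t node_bounds(4)[of j] by (intro mult_left_mono) (auto simp: B_def)
  also have "\<dots> \<le> (1 / 2) ^ j * B" by (simp add: B_def)
  finally have "cmod (\<phi> k (of_real t)) \<le> cmod (\<phi> k (of_real (node j))) + (1 / 2) ^ j * B"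
    using norm_triangle_sub[of "\<phi> k (of_real t)" "\<phi> k (of_real (node j))"] by linarith
  hence "cmod (\<phi> k (of_real t)) powr p \<le> (cmod (\<phi> k (of_real (node j))) + (1 / 2) ^ j * B) powr p"
    using p by (intro powr_mono2) auto
  also have "\<dots> \<le> cmod (\<phi> k (of_real (node j))) powr p + ((1 / 2) ^ j * B) powr p"
    using p by (intro add_powr_le) (auto simp: B_def)
  also have "((1 / 2) ^ j * B) powr p = (2 powr (- p)) ^ j * B powr p"
    by (simp add: powr_mult B_def powr_realpow[symmetric] powr_powr powr_divide powr_minus_divide mult.commute)
  finally show ?thesis by (simp add: B_def)
qed

lemma node_bound:
  assumes p: "0 < p" "p \<le> 1"
  shows "cmod (\<phi> k (of_real (node j))) powr p \<le>
    cmod (\<phi> k (1 / 2)) powr p + (\<Sum>i<j. (2 powr (- p)) ^ i * cmod (\<phi> (Suc k) (of_real (peak (Suc k) i))) powr p)"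
proof (induction j)
  case 0
  thus ?case by (simp add: node_def)
next
  case (Suc j)
  have "node (Suc j) \<in> {node j..node (Suc j)}" using node_bounds(2)[of j] by simp
  from block_increment[OF p this, of k] Suc show ?case by simp
qed

definition block_sum :: "real \<Rightarrow> nat \<Rightarrow> nat \<Rightarrow> real" where
  "block_sum p k m = (\<Sum>j<m. (2 powr (- (real k * p))) ^ j * cmod (\<phi> k (of_real (peak k j))) powr p)"

text \<open>
  Bounding each peak by the preceding increments produces a double sum over blocks; summation by
  parts collapses it to the sum with one more derivative and one more factor \<open>2^(-jp)\<close>.
\<close>

lemma block_sum_step:
  assumes p: "0 < p" "p \<le> 1" and k: "k \<ge> 1"
  shows "block_sum p k m \<le> 1 / (1 - 2 powr (- p)) * (cmod (\<phi> k (1 / 2)) powr p + block_sum p (Suc k) m)"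
proof -
  \<comment> \<open>The weight \<open>\<theta>\<close> belongs to the present derivative and \<open>\<eta>\<close> to one integration; their product
    is the weight of the next derivative.\<close>
  define \<theta> where "\<theta> = 2 powr (- (real k * p))"
  define \<eta> where "\<eta> = 2 powr (- p)"
  define H where "H = cmod (\<phi> k (1 / 2)) powr p"
  define c where "c i = \<eta> ^ i * cmod (\<phi> (Suc k) (of_real (peak (Suc k) i))) powr p" for i
  have \<eta>: "0 < \<eta>" "\<eta> < 1" using p by (auto simp: \<eta>_def powr_less_one)
  have \<theta>: "0 < \<theta>" "\<theta> \<le> \<eta>" using p k by (auto simp: \<theta>_def \<eta>_def)
  have "cmod (\<phi> k (of_real (peak k j))) powr p \<le> H + (\<Sum>i\<le>j. c i)" for j
    using block_increment[OF p peak(1)[of k j], of k] node_bound[OF p, of k j]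
    by (simp add: H_def c_def \<eta>_def lessThan_Suc_atMost[symmetric])
  hence "block_sum p k m \<le> (\<Sum>j<m. \<theta> ^ j * (H + (\<Sum>i\<le>j. c i)))"
    unfolding block_sum_def \<theta>_def[symmetric] using \<theta> by (intro sum_mono mult_left_mono) auto
  also have "\<dots> = H * (\<Sum>j<m. \<theta> ^ j) + (\<Sum>j<m. \<theta> ^ j * (\<Sum>i\<le>j. c i))"
    by (simp add: distrib_left sum.distrib sum_distrib_left mult.commute)
  also have "\<dots> \<le> H * (1 / (1 - \<theta>)) + (1 / (1 - \<theta>)) * (\<Sum>i<m. \<theta> ^ i * c i)"
    using \<theta> \<eta> sum_geometric_tail[of \<theta> 0 m]
    by (intro add_mono mult_left_mono sum_geometric_partial_sums) (auto simp: H_def c_def lessThan_atLeast0)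
  also have "(\<Sum>i<m. \<theta> ^ i * c i) = block_sum p (Suc k) m"
    unfolding block_sum_def c_def \<theta>_def \<eta>_def
    by (intro sum.cong refl) (simp add: power_mult_distrib[symmetric] powr_add[symmetric] algebra_simps)
  also have "H * (1 / (1 - \<theta>)) + 1 / (1 - \<theta>) * block_sum p (Suc k) m = 1 / (1 - \<theta>) * (H + block_sum p (Suc k) m)"
    by (simp add: algebra_simps)
  also have "\<dots> \<le> 1 / (1 - \<eta>) * (H + block_sum p (Suc k) m)"
    using \<theta> \<eta> by (intro mult_right_mono divide_left_mono) (auto simp: H_def block_sum_def intro!: sum_nonneg add_nonneg_nonneg)
  finally show ?thesis by (simp add: \<eta>_def H_def)
qed

lemma node_bound_iterated:
  assumes p: "0 < p" "p \<le> 1" and k: "1 \<le> k" "k \<le> N"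
    and M: "\<And>t. cmod t \<le> 1 / 2 \<Longrightarrow> cmod (\<phi> N t) \<le> M"
  defines "K \<equiv> 1 / (1 - 2 powr (- p))"
  shows "cmod (\<phi> 0 (of_real (node m))) powr p \<le>
    cmod (\<phi> 0 0) powr p + real k * K ^ k * M powr p + K ^ k * block_sum p k m"
proof -
  have K: "K \<ge> 1" using p unfolding K_def by (simp add: powr_less_one)
  obtain N' where N': "N = Suc N'" using k by (cases N) auto
  have half: "cmod (\<phi> i (1 / 2)) \<le> cmod (\<phi> i 0) + M" if "i \<le> N" for i
    using half_disc_bound[of N' M i "1 / 2"] M that norm_triangle_sub[of "\<phi> i (1 / 2)" "\<phi> i 0"]
    unfolding N' by simp
  have M0: "M \<ge> 0" using order_trans[OF norm_ge_zero M[of 0]] by simp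
  have nn: "block_sum p i m \<ge> 0" for i by (auto simp: block_sum_def intro!: sum_nonneg)
  show ?thesis using k
  proof (induction k rule: dec_induct)
    case base
    have "cmod (\<phi> 0 (1 / 2)) powr p \<le> (cmod (\<phi> 0 0) + M) powr p" using half[of 0] p by (intro powr_mono2) auto
    also have "\<dots> \<le> cmod (\<phi> 0 0) powr p + M powr p" using p M0 by (intro add_powr_le) auto
    also have "M powr p \<le> K * M powr p" using K mult_right_mono[of 1 K "M powr p"] by simp
    finally have "cmod (\<phi> 0 (1 / 2)) powr p \<le> cmod (\<phi> 0 0) powr p + K * M powr p" by simp
    moreover have "block_sum p 1 m \<le> K * block_sum p 1 m" using K nn mult_right_mono[of 1 K "block_sum p 1 m"] by simp
    ultimately show ?case using node_bound[OF p, of 0 m] by (simp add: block_sum_def)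
  next
    case (step k)
    have "\<phi> k 0 = 0" using step.hyps vanish_0[of "k - 1"] by (cases k) auto
    hence "cmod (\<phi> k (1 / 2)) powr p \<le> M powr p" using half[of k] step p by (intro powr_mono2) auto
    hence "K * (cmod (\<phi> k (1 / 2)) powr p + block_sum p (Suc k) m) \<le> K * (M powr p + block_sum p (Suc k) m)"
      using K by (intro mult_left_mono add_mono) auto
    hence "block_sum p k m \<le> K * (M powr p + block_sum p (Suc k) m)"
      using block_sum_step[OF p, of k m] step.hyps unfolding K_def[symmetric] by linarith
    hence "K ^ k * block_sum p k m \<le> K ^ k * (K * (M powr p + block_sum p (Suc k) m))"
      using K by (intro mult_left_mono) auto
    moreover have "real k * K ^ k * M powr p \<le> real k * K ^ Suc k * M powr p"
      using K by (intro mult_right_mono mult_left_mono power_increasing) auto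
    moreover have "K ^ k * (K * (M powr p + block_sum p (Suc k) m)) = K ^ Suc k * M powr p + K ^ Suc k * block_sum p (Suc k) m"
      "real (Suc k) * K ^ Suc k * M powr p = real k * K ^ Suc k * M powr p + K ^ Suc k * M powr p"
      by (simp_all add: algebra_simps)
    moreover have "cmod (\<phi> 0 (of_real (node m))) powr p \<le>
      cmod (\<phi> 0 0) powr p + real k * K ^ k * M powr p + K ^ k * block_sum p k m"
      using step by simp
    ultimately show ?case by linarith
  qed
qed

text \<open>
  Letting the nodes tend to 1 in the iterated bound. The points \<open>t j\<close> are the places
  of the block maxima, and \<open>\<kappa>\<close> is the place of the maximum over the disc of radius \<open>1/2\<close>.
\<close>

lemma radial_growth:
  assumes p: "0 < p" "p \<le> 1" and N: "N \<ge> 1"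
  obtains \<kappa> t where "cmod \<kappa> \<le> 1 / 2" "\<And>j. 1 / 2 \<le> t j" "\<And>j. (1 / 2) ^ (j + 2) \<le> 1 - t j" "\<And>j. t j < 1"
    "ennreal (cmod (\<phi> 0 1) powr p) \<le> ennreal (real N * (1 / (1 - 2 powr (- p))) ^ N) *
      (ennreal (cmod (\<phi> 0 0) powr p) + ennreal (cmod (\<phi> N \<kappa>) powr p)
        + (\<Sum>j. ennreal ((2 powr (- (real N * p))) ^ j * cmod (\<phi> N (of_real (t j))) powr p)))"
proof -
  define K where "K = 1 / (1 - 2 powr (- p))"
  have K: "K \<ge> 1" using p unfolding K_def by (simp add: powr_less_one)
  have "\<exists>x\<in>cball 0 (1 / 2). \<forall>y\<in>cball 0 (1 / 2). cmod (\<phi> N y) \<le> cmod (\<phi> N x)"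
    by (intro continuous_attains_sup continuous_intros holomorphic_on_imp_continuous_on
        holomorphic_on_subset[OF hol]) (auto intro: in_S)
  then obtain \<kappa> where \<kappa>: "cmod \<kappa> \<le> 1 / 2" "\<And>t. cmod t \<le> 1 / 2 \<Longrightarrow> cmod (\<phi> N t) \<le> cmod (\<phi> N \<kappa>)" by auto
  define A where "A = ennreal (cmod (\<phi> 0 0) powr p) + ennreal (cmod (\<phi> N \<kappa>) powr p)
        + (\<Sum>j. ennreal ((2 powr (- (real N * p))) ^ j * cmod (\<phi> N (of_real (peak N j))) powr p))"
  have bound: "ennreal (cmod (\<phi> 0 (of_real (node m))) powr p) \<le> ennreal (real N * K ^ N) * A" for m
  proof -
    have KN: "1 \<le> real N * K ^ N" "K ^ N \<le> real N * K ^ N"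
      using K N mult_mono[of 1 "real N" 1 "K ^ N"] mult_right_mono[of 1 "real N" "K ^ N"] by (auto simp: one_le_power)
    have nn: "block_sum p N m \<ge> 0" by (auto simp: block_sum_def intro!: sum_nonneg)
    have "cmod (\<phi> 0 (of_real (node m))) powr p \<le>
      1 * cmod (\<phi> 0 0) powr p + real N * K ^ N * cmod (\<phi> N \<kappa>) powr p + K ^ N * block_sum p N m"
      using node_bound_iterated[OF p N order_refl \<kappa>(2), of m] unfolding K_def by simp
    also have "\<dots> \<le> real N * K ^ N * cmod (\<phi> 0 0) powr p + real N * K ^ N * cmod (\<phi> N \<kappa>) powr p + real N * K ^ N * block_sum p N m"
      using KN nn by (intro add_mono mult_right_mono order_refl) auto
    also have "\<dots> = real N * K ^ N * (cmod (\<phi> 0 0) powr p + cmod (\<phi> N \<kappa>) powr p + block_sum p N m)"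
      by (simp add: algebra_simps)
    finally have 1: "ennreal (cmod (\<phi> 0 (of_real (node m))) powr p) \<le>
      ennreal (real N * K ^ N) * (ennreal (cmod (\<phi> 0 0) powr p) + ennreal (cmod (\<phi> N \<kappa>) powr p) + ennreal (block_sum p N m))"
      using nn K by (simp add: ennreal_mult[symmetric] ennreal_plus[symmetric] ennreal_leI del: ennreal_plus)
    have 2: "ennreal (block_sum p N m) \<le> (\<Sum>j. ennreal ((2 powr (- (real N * p))) ^ j * cmod (\<phi> N (of_real (peak N j))) powr p))"
    proof -
      have "ennreal (block_sum p N m) = (\<Sum>j<m. ennreal ((2 powr (- (real N * p))) ^ j * cmod (\<phi> N (of_real (peak N j))) powr p))"
        unfolding block_sum_def by (rule sum_ennreal[symmetric]) simp
      also have "\<dots> \<le> (\<Sum>j. ennreal ((2 powr (- (real N * p))) ^ j * cmod (\<phi> N (of_real (peak N j))) powr p))"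
        by (rule sum_le_suminf) (rule summableI, rule finite_lessThan, rule zero_le)
      finally show ?thesis .
    qed
    show ?thesis unfolding A_def by (rule order_trans[OF 1 mult_left_mono[OF add_left_mono[OF 2] zero_le]])
  qed
  have "node \<longlonglongrightarrow> 1 - 0"
    unfolding node_def by (intro tendsto_intros LIMSEQ_Suc LIMSEQ_power_zero) auto
  hence node1: "node \<longlonglongrightarrow> 1" by simp
  have "isCont (\<phi> 0) 1" using has_deriv[of 1 0 UNIV] in_S[of 1] DERIV_isCont by auto
  moreover have "(\<lambda>m. complex_of_real (node m)) \<longlonglongrightarrow> 1" using tendsto_of_real[OF node1] by simp
  ultimately have "(\<lambda>m. \<phi> 0 (of_real (node m))) \<longlonglongrightarrow> \<phi> 0 1" by (rule isCont_tendsto_compose)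
  hence "(\<lambda>m. cmod (\<phi> 0 (of_real (node m)))) \<longlonglongrightarrow> cmod (\<phi> 0 1)" by (rule tendsto_norm)
  hence "(\<lambda>m. ennreal (cmod (\<phi> 0 (of_real (node m))) powr p)) \<longlonglongrightarrow> ennreal (cmod (\<phi> 0 1) powr p)"
    using p by (intro tendsto_ennrealI tendsto_powr2 tendsto_const) auto
  hence "ennreal (cmod (\<phi> 0 1) powr p) \<le> ennreal (real N * K ^ N) * A"
    by (rule LIMSEQ_le_const2) (use bound in auto)
  thus ?thesis
  proof (intro that[of \<kappa> "peak N"])
    fix j
    show "1 / 2 \<le> peak N j" "peak N j < 1"
      using peak(1)[of N j] node_bounds[of j] node_bounds[of "Suc j"] by auto
    show "(1 / 2) ^ (j + 2) \<le> 1 - peak N j" using peak(1)[of N j] by (simp add: node_def)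
  qed (use \<kappa> in \<open>auto simp: A_def K_def\<close>)
qed

end

section \<open>The pointwise area estimate\<close>

text \<open>
  Expanding \<open>|\<tau> \<zeta> + v|^2\<close>, the cross term is controlled by \<open>\<langle>v, \<zeta>\<rangle>\<close> and the square by
  \<open>|v|^2\<close>, and both are at most a small multiple of \<open>1 - \<tau>\<close>. So the ball lies well inside
  the unit ball, and \<open>1 - |w|^2\<close> is comparable to \<open>1 - \<tau>\<close> on it.
\<close>

lemma nonisotropic_ball_defect:
  fixes \<zeta> :: "complex ^ 'n"
  assumes \<zeta>: "norm \<zeta> = 1" and \<tau>: "0 \<le> \<tau>" "\<tau> < 1"
    and w: "nonisotropic_gauge \<zeta> ((1 - \<tau>) / 16) (w - \<tau> *\<^sub>R \<zeta>) \<le> 1"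
  shows "cmod (hermitian_inner (w - \<tau> *\<^sub>R \<zeta>) \<zeta>) \<le> (1 - \<tau>) / 16"
    and "(1 - \<tau>) / 2 \<le> 1 - (norm w)\<^sup>2" and "1 - (norm w)\<^sup>2 \<le> 3 * (1 - \<tau>)"
    and "\<tau> \<le> 1 / 2 \<Longrightarrow> 1 / 4 \<le> 1 - (norm w)\<^sup>2"
proof -
  define \<delta> where "\<delta> = 1 - \<tau>"
  have \<delta>: "0 < \<delta>" "\<delta> \<le> 1" using \<tau> by (auto simp: \<delta>_def)
  define v where "v = w - \<tau> *\<^sub>R \<zeta>"
  have v: "cmod (hermitian_inner v \<zeta>) \<le> \<delta> / 16" "norm v \<le> sqrt (\<delta> / 16)"
    using nonisotropic_gauge_simps(7,8)[of "\<delta> / 16" \<zeta> v] w \<delta> by (auto simp: v_def \<delta>_def)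
  thus "cmod (hermitian_inner (w - \<tau> *\<^sub>R \<zeta>) \<zeta>) \<le> (1 - \<tau>) / 16" by (simp add: v_def \<delta>_def)
  have "(norm w)\<^sup>2 = (\<tau> *\<^sub>R \<zeta> + v) \<bullet> (\<tau> *\<^sub>R \<zeta> + v)" by (simp add: v_def power2_norm_eq_inner)
  also have "\<dots> = \<tau>\<^sup>2 * (\<zeta> \<bullet> \<zeta>) + 2 * \<tau> * (v \<bullet> \<zeta>) + v \<bullet> v"
    by (simp add: inner_add_left inner_add_right inner_commute power2_eq_square algebra_simps)
  also have "\<zeta> \<bullet> \<zeta> = 1" using \<zeta> by (simp add: norm_eq_1)
  also have "v \<bullet> v = (norm v)\<^sup>2" by (simp add: power2_norm_eq_inner)
  finally have nw: "(norm w)\<^sup>2 = \<tau>\<^sup>2 + 2 * (\<tau> * (v \<bullet> \<zeta>)) + (norm v)\<^sup>2" by simp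
  have "(norm v)\<^sup>2 \<le> (sqrt (\<delta> / 16))\<^sup>2" using v(2) by (intro power_mono) auto
  hence a: "(norm v)\<^sup>2 \<le> \<delta> / 16" using \<delta> by simp
  have "\<bar>v \<bullet> \<zeta>\<bar> \<le> \<delta> / 16" using v(1) abs_Re_le_cmod[of "hermitian_inner v \<zeta>"] by (simp add: Re_hermitian_inner)
  moreover have "\<bar>\<tau> * (v \<bullet> \<zeta>)\<bar> \<le> 1 * \<bar>v \<bullet> \<zeta>\<bar>" using \<tau> unfolding abs_mult by (intro mult_right_mono) auto
  ultimately have b: "\<bar>\<tau> * (v \<bullet> \<zeta>)\<bar> \<le> \<delta> / 16" by linarith
  have c: "1 - \<tau>\<^sup>2 = \<delta> * (1 + \<tau>)" by (simp add: \<delta>_def power2_eq_square algebra_simps)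
  have "\<delta> * 1 \<le> \<delta> * (1 + \<tau>)" "\<delta> * (1 + \<tau>) \<le> \<delta> * 2" using \<delta> \<tau> by (auto intro!: mult_left_mono)
  thus "(1 - \<tau>) / 2 \<le> 1 - (norm w)\<^sup>2" "1 - (norm w)\<^sup>2 \<le> 3 * (1 - \<tau>)"
    using nw a b c \<delta> zero_le_power2[of "norm v"] unfolding \<delta>_def[symmetric] abs_le_iff by linarith+
  thus "1 / 4 \<le> 1 - (norm w)\<^sup>2" if "\<tau> \<le> 1 / 2" using that by simp
qed

text \<open>
  The constant 8 is large enough for every nonisotropic ball that is centred on the segment from 0 to \<open>z\<close>
  or at a point of norm at most \<open>1/2\<close>.
\<close>

definition approach_region :: "complex ^ 'n \<Rightarrow> (complex ^ 'n) set" where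
  "approach_region z = {w \<in> ball 0 1. cmod (1 - hermitian_inner z w) \<le> 8 * (1 - (norm w)\<^sup>2)}"

lemma nonisotropic_ball_subset_ball:
  fixes \<zeta> :: "complex ^ 'n"
  assumes \<zeta>: "norm \<zeta> = 1" and \<tau>: "0 \<le> \<tau>" "\<tau> < 1"
    and w: "nonisotropic_gauge \<zeta> ((1 - \<tau>) / 16) (w - \<tau> *\<^sub>R \<zeta>) \<le> 1"
  shows "norm w < 1"
proof -
  have "(norm w)\<^sup>2 < 1" using nonisotropic_ball_defect(2)[OF assms] \<tau> by simp
  thus ?thesis by (simp add: abs_square_less_1)
qed

text \<open>
  On the ray, \<open>1 - \<langle>z, w\<rangle>\<close> is \<open>1 - x \<tau>\<close> up to a small multiple of \<open>1 - \<tau>\<close>, and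
  \<open>1 - x \<tau> \<le> 1 - \<tau>^2\<close> since \<open>\<tau> \<le> x\<close>. Near the origin the trivial bound \<open>|1 - \<langle>z, w\<rangle>| \<le> 2\<close> suffices.
\<close>

lemma nonisotropic_ball_subset_region:
  fixes \<zeta> :: "complex ^ 'n"
  assumes \<zeta>: "norm \<zeta> = 1" and \<tau>: "0 \<le> \<tau>" "\<tau> < 1"
    and w: "nonisotropic_gauge \<zeta> ((1 - \<tau>) / 16) (w - \<tau> *\<^sub>R \<zeta>) \<le> 1"
    and z: "norm z < 1" and "\<tau> \<le> 1 / 2 \<or> (\<exists>x. \<tau> \<le> x \<and> x < 1 \<and> z = x *\<^sub>R \<zeta>)"
  shows "w \<in> approach_region z"
proof -
  note N = nonisotropic_ball_defect[OF \<zeta> \<tau> w]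
  have w1: "norm w < 1" by (rule nonisotropic_ball_subset_ball[OF \<zeta> \<tau> w])
  have "cmod (1 - hermitian_inner z w) \<le> 8 * (1 - (norm w)\<^sup>2)"
    using assms(6)
  proof
    assume "\<tau> \<le> 1 / 2"
    have "cmod (1 - hermitian_inner z w) \<le> 1 + cmod (hermitian_inner z w)"
      using norm_triangle_ineq4[of 1 "hermitian_inner z w"] by simp
    also have "\<dots> \<le> 1 + norm z * norm w" by (simp add: cmod_hermitian_inner_le)
    also have "\<dots> \<le> 1 + 1 * 1" using z w1 by (intro add_left_mono mult_mono) auto
    finally show ?thesis using N(4) \<open>\<tau> \<le> 1 / 2\<close> by simp
  next
    assume "\<exists>x. \<tau> \<le> x \<and> x < 1 \<and> z = x *\<^sub>R \<zeta>"
    then obtain x where x: "\<tau> \<le> x" "x < 1" "z = x *\<^sub>R \<zeta>" by blast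
    define v where "v = w - \<tau> *\<^sub>R \<zeta>"
    have w_eq: "w = \<tau> *\<^sub>R \<zeta> + v" by (simp add: v_def)
    have "hermitian_inner z w = of_real (x * \<tau>) + of_real x * cnj (hermitian_inner v \<zeta>)"
      unfolding w_eq x(3) using \<zeta>
      by (simp add: hermitian_inner_simps norm_eq_hermitian_inner hermitian_inner_cnj[of v \<zeta>] hermitian_inner_cnj[of \<zeta> v, symmetric])
    hence "1 - hermitian_inner z w = of_real (1 - x * \<tau>) - of_real x * cnj (hermitian_inner v \<zeta>)" by simp
    also have "cmod \<dots> \<le> cmod (of_real (1 - x * \<tau>)) + cmod (of_real x * cnj (hermitian_inner v \<zeta>))"
      by (rule norm_triangle_ineq4)
    also have "cmod (of_real (1 - x * \<tau>)) = 1 - x * \<tau>"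
      using x \<tau> mult_mono[of x 1 \<tau> 1] by (simp only: norm_of_real) auto
    also have "\<dots> \<le> 1 - \<tau> * \<tau>" using x \<tau> by (simp add: mult_right_mono)
    also have "\<dots> = (1 - \<tau>) * (1 + \<tau>)" by (simp add: algebra_simps)
    also have "\<dots> \<le> (1 - \<tau>) * 2" using \<tau> by (intro mult_left_mono) auto
    also have "cmod (of_real x * cnj (hermitian_inner v \<zeta>)) \<le> 1 * cmod (hermitian_inner v \<zeta>)"
      using x \<tau> by (simp add: norm_mult mult_left_le_one_le)
    also have "\<dots> \<le> (1 - \<tau>) / 16" using N(1) by (simp add: v_def)
    finally have "cmod (1 - hermitian_inner z w) \<le> (1 - \<tau>) * 2 + (1 - \<tau>) / 16" by simp
    thus ?thesis using N(2) \<tau> unfolding diff_divide_distrib by argo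
  qed
  thus ?thesis using w1 by (simp add: approach_region_def)
qed

text \<open>
  On this ball \<open>(1 - |w|^2)^(-(n+1))\<close> is comparable to the reciprocal of the volume, so the weighted
  integral is an average up to constants.
\<close>

lemma weighted_local_estimate:
  fixes p :: real
  assumes p: "0 < p" "p \<le> 1"
  obtains C where "C > 0"
    "\<And>(f :: complex ^ 'n \<Rightarrow> complex) \<zeta> \<tau>. holomorphic_vec_on f (ball 0 1) \<Longrightarrow> norm (\<zeta> :: complex ^ 'n) = 1 \<Longrightarrow> 0 \<le> \<tau> \<Longrightarrow> \<tau> < 1 \<Longrightarrow>
      ennreal (cmod (f (\<tau> *\<^sub>R \<zeta>)) powr p) \<le> ennreal C *
        (\<integral>\<^sup>+ w. indicator {w. nonisotropic_gauge \<zeta> ((1 - \<tau>) / 16) (w - \<tau> *\<^sub>R \<zeta>) < 1} w *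
          ennreal ((1 - (norm w)\<^sup>2) powr (- real (CARD('n) + 1)) * cmod (f w) powr p) \<partial>lborel)"
proof -
  define b where "b = (1 / (4 * real CARD('n))) ^ (2 * CARD('n))"
  define A where "A = 2 powr (2 * CARD('n) / p)"
  define C where "C = A * 48 ^ (CARD('n) + 1) / b"
  have b: "b > 0" and A: "A > 0" by (simp_all add: b_def A_def)
  have C: "C > 0" using b A by (simp add: C_def)
  show ?thesis
  proof (rule that[OF C])
    fix f :: "complex ^ 'n \<Rightarrow> complex" and \<zeta> :: "complex ^ 'n" and \<tau> :: real
    assume f: "holomorphic_vec_on f (ball 0 1)" and \<zeta>: "norm \<zeta> = 1" and \<tau>: "0 \<le> \<tau>" "\<tau> < 1"
    define d where "d = (1 - \<tau>) / 16"
    have d: "0 < d" "d \<le> 1" using \<tau> by (auto simp: d_def)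
    let ?E = "{w. nonisotropic_gauge \<zeta> d (w - \<tau> *\<^sub>R \<zeta>) < 1}"
    let ?F = "\<lambda>w. (1 - (norm w)\<^sup>2) powr (- real (CARD('n) + 1)) * cmod (f w) powr p"
    have open_E: "open ?E"
      by (intro open_Collect_less continuous_on_compose2[OF nonisotropic_gauge_simps(6)[OF d(1), of UNIV]] continuous_intros) auto
    have [measurable]: "?E \<in> sets borel" using open_E by simp
    have E: "norm w < 1" "1 \<le> (48 * d) ^ (CARD('n) + 1) * (1 - (norm w)\<^sup>2) powr (- real (CARD('n) + 1))" if "w \<in> ?E" for w
    proof -
      have w: "nonisotropic_gauge \<zeta> ((1 - \<tau>) / 16) (w - \<tau> *\<^sub>R \<zeta>) \<le> 1" using that by (simp add: d_def)
      show "norm w < 1" by (rule nonisotropic_ball_subset_ball[OF \<zeta> \<tau> w])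
      have s: "0 < 1 - (norm w)\<^sup>2" "1 - (norm w)\<^sup>2 \<le> 48 * d"
        using nonisotropic_ball_defect(2,3)[OF \<zeta> \<tau> w] \<tau> by (auto simp: d_def)
      hence "(1 - (norm w)\<^sup>2) ^ (CARD('n) + 1) \<le> (48 * d) ^ (CARD('n) + 1)" by (intro power_mono) auto
      thus "1 \<le> (48 * d) ^ (CARD('n) + 1) * (1 - (norm w)\<^sup>2) powr (- real (CARD('n) + 1))"
        using s by (simp add: powr_minus powr_realpow field_simps del: power_Suc of_nat_Suc of_nat_add)
    qed
    have "ennreal (cmod (f (\<tau> *\<^sub>R \<zeta>)) powr p * (b * d ^ (CARD('n) + 1))) \<le> ennreal A *
      (\<integral>\<^sup>+ v. indicator ?E v * ennreal (cmod (f v) powr p) \<partial>lborel)"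
      unfolding A_def b_def
    proof (rule nonisotropic_ball_submean[OF p d \<zeta> f open_ball])
      fix v assume "nonisotropic_gauge \<zeta> d v \<le> 1"
      thus "\<tau> *\<^sub>R \<zeta> + v \<in> ball 0 1"
        using nonisotropic_ball_subset_ball[OF \<zeta> \<tau>, of "\<tau> *\<^sub>R \<zeta> + v"] by (simp add: d_def)
    qed
    also have "(\<integral>\<^sup>+ v. indicator ?E v * ennreal (cmod (f v) powr p) \<partial>lborel)
      \<le> (\<integral>\<^sup>+ v. ennreal ((48 * d) ^ (CARD('n) + 1)) * (indicator ?E v * ennreal (?F v)) \<partial>lborel)"
    proof (rule nn_integral_mono)
      fix v
      show "indicator ?E v * ennreal (cmod (f v) powr p) \<le> ennreal ((48 * d) ^ (CARD('n) + 1)) * (indicator ?E v * ennreal (?F v))"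
      proof (cases "v \<in> ?E")
        case True
        have "1 * cmod (f v) powr p \<le> ((48 * d) ^ (CARD('n) + 1) * (1 - (norm v)\<^sup>2) powr (- real (CARD('n) + 1))) * cmod (f v) powr p"
          by (rule mult_right_mono[OF E(2)[OF True]]) simp
        thus ?thesis using d True by (simp add: ennreal_mult[symmetric] mult.assoc ennreal_leI del: power_Suc)
      qed simp
    qed
    also have "\<dots> = ennreal ((48 * d) ^ (CARD('n) + 1)) * (\<integral>\<^sup>+ v. indicator ?E v * ennreal (?F v) \<partial>lborel)"
    proof (rule nn_integral_cmult)
      have "(\<lambda>v. indicator ?E v *\<^sub>R f v) \<in> borel_measurable borel"
        using E(1) open_E
        by (intro borel_measurable_continuous_on_indicator continuous_on_subset[OF holomorphic_vec_on_imp_continuous_on[OF f]]) auto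
      hence "(\<lambda>v. indicator ?E v * ennreal ((1 - (norm v)\<^sup>2) powr (- real (CARD('n) + 1)) * cmod (indicator ?E v *\<^sub>R f v) powr p)) \<in> borel_measurable borel"
        by measurable
      also have "(\<lambda>v. indicator ?E v * ennreal ((1 - (norm v)\<^sup>2) powr (- real (CARD('n) + 1)) * cmod (indicator ?E v *\<^sub>R f v) powr p))
        = (\<lambda>v. indicator ?E v * ennreal (?F v))" by (auto simp: indicator_def)
      finally show "(\<lambda>v. indicator ?E v * ennreal (?F v)) \<in> borel_measurable lborel" by simp
    qed
    finally have main: "ennreal (cmod (f (\<tau> *\<^sub>R \<zeta>)) powr p * (b * d ^ (CARD('n) + 1)))
      \<le> ennreal A * (ennreal ((48 * d) ^ (CARD('n) + 1)) * (\<integral>\<^sup>+ v. indicator ?E v * ennreal (?F v) \<partial>lborel))"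
      by (simp add: mult_left_mono)
    define Q where "Q = b * d ^ (CARD('n) + 1)"
    have Q: "Q > 0" using b d by (simp add: Q_def)
    have "ennreal (cmod (f (\<tau> *\<^sub>R \<zeta>)) powr p) = ennreal (1 / Q) * ennreal (cmod (f (\<tau> *\<^sub>R \<zeta>)) powr p * Q)"
      using Q by (simp add: ennreal_mult[symmetric])
    also have "\<dots> \<le> ennreal (1 / Q) * (ennreal A * (ennreal ((48 * d) ^ (CARD('n) + 1)) * (\<integral>\<^sup>+ v. indicator ?E v * ennreal (?F v) \<partial>lborel)))"
      using main unfolding Q_def by (rule mult_left_mono) simp
    also have "\<dots> = ennreal (1 / Q * A * (48 * d) ^ (CARD('n) + 1)) * (\<integral>\<^sup>+ v. indicator ?E v * ennreal (?F v) \<partial>lborel)"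
    proof -
      have gen: "ennreal a * (ennreal b * (ennreal c * X)) = ennreal (a * b * c) * X" if "a > 0" "b > 0" "c > 0" for a b c X
        using that by (simp add: ennreal_mult mult.assoc)
      show ?thesis by (rule gen) (use Q A d in auto)
    qed
    also have "1 / Q * A * (48 * d) ^ (CARD('n) + 1) = C"
      using b d by (simp add: Q_def C_def power_mult_distrib field_simps)
    finally show "ennreal (cmod (f (\<tau> *\<^sub>R \<zeta>)) powr p) \<le> ennreal C *
        (\<integral>\<^sup>+ w. indicator {w. nonisotropic_gauge \<zeta> ((1 - \<tau>) / 16) (w - \<tau> *\<^sub>R \<zeta>) < 1} w *
          ennreal ((1 - (norm w)\<^sup>2) powr (- real (CARD('n) + 1)) * cmod (f w) powr p) \<partial>lborel)"
      by (simp add: d_def)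
  qed
qed

text \<open>
  The sum is dominated by its first term, whose index is the least with \<open>2^(-j) \<le> D\<close>.
\<close>

lemma suminf_geometric_below_threshold:
  fixes q D :: real
  assumes q: "q > 0" and D: "D > 0"
  shows "(\<Sum>j. ennreal (if (1 / 2) ^ j \<le> D then (2 powr (- q)) ^ j else 0)) \<le> ennreal (D powr q / (1 - 2 powr (- q)))"
proof (rule suminf_le_const)
  fix m
  define \<theta> where "\<theta> = 2 powr (- q)"
  have \<theta>: "0 < \<theta>" "\<theta> < 1" using q by (auto simp: \<theta>_def powr_less_one)
  have "(\<Sum>j<m. if (1 / 2) ^ j \<le> D then \<theta> ^ j else 0) \<le> D powr q / (1 - \<theta>)"
  proof (cases "\<exists>j. (1 / 2) ^ j \<le> D")
    case True
    define j0 where "j0 = (LEAST j. (1 / 2) ^ j \<le> D)"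
    have j0: "(1 / 2) ^ j0 \<le> D" unfolding j0_def using True by (rule LeastI_ex)
    have le: "j0 \<le> j" if "(1 / 2) ^ j \<le> D" for j unfolding j0_def using that by (rule Least_le)
    have "(\<Sum>j<m. if (1 / 2) ^ j \<le> D then \<theta> ^ j else 0) \<le> (\<Sum>j<m. if j \<in> {j0..<m} then \<theta> ^ j else 0)"
      using le \<theta> by (intro sum_mono) auto
    also have "\<dots> = (\<Sum>j\<in>{j0..<m}. \<theta> ^ j)" by (intro sum.mono_neutral_cong_right) auto
    also have "\<dots> \<le> \<theta> ^ j0 / (1 - \<theta>)" by (rule sum_geometric_tail[OF \<theta>])
    also have "\<theta> ^ j0 = ((1 / 2) ^ j0) powr q"
      by (simp add: \<theta>_def powr_realpow[symmetric] powr_powr powr_divide powr_minus_divide mult.commute)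
    also have "\<dots> \<le> D powr q" using j0 q by (intro powr_mono2) auto
    finally show ?thesis using \<theta> by (simp add: divide_right_mono)
  next
    case False
    thus ?thesis using \<theta> by simp
  qed
  hence "ennreal (\<Sum>j<m. if (1 / 2) ^ j \<le> D then \<theta> ^ j else 0) \<le> ennreal (D powr q / (1 - \<theta>))" by (rule ennreal_leI)
  moreover have "(\<Sum>j<m. ennreal (if (1 / 2) ^ j \<le> D then \<theta> ^ j else 0)) = ennreal (\<Sum>j<m. if (1 / 2) ^ j \<le> D then \<theta> ^ j else 0)"
    by (rule sum_ennreal) (use \<theta> in auto)
  ultimately show "(\<Sum>j<m. ennreal (if (1 / 2) ^ j \<le> D then (2 powr (- q)) ^ j else 0)) \<le> ennreal (D powr q / (1 - 2 powr (- q)))"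
    unfolding \<theta>_def by simp
qed (rule summableI)

lemma polar_form:
  fixes z :: "complex ^ 'n"
  obtains \<zeta> where "norm \<zeta> = 1" "z = norm z *\<^sub>R \<zeta>"
proof (cases "z = 0")
  case True
  thus ?thesis using that[of "axis undefined 1"] by simp
next
  case False
  thus ?thesis using that[of "z /\<^sub>R norm z"] by simp
qed

lemma euler_chain_radial_deriv:
  fixes f :: "complex ^ 'n \<Rightarrow> complex"
  assumes f: "holomorphic_vec_on f (ball 0 1)" and z: "norm z < 1"
  shows "euler_chain (\<lambda>k t. (radial_deriv ^^ k) f (t *s z)) {t. norm (t *s z) < 1}"
proof
  show "open {t. norm (t *s z) < 1}"
    by (intro open_Collect_less continuous_intros)
  show "cball 0 1 \<subseteq> {t. norm (t *s z) < 1}"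
  proof
    fix t :: complex assume "t \<in> cball 0 1"
    hence "norm (t *s z) \<le> 1 * norm z" unfolding norm_vector_smult by (intro mult_right_mono) auto
    thus "t \<in> {t. norm (t *s z) < 1}" using z by simp
  qed
  fix k
  note hk = holomorphic_vec_on_radial_deriv_iterate[OF f open_ball, of k]
  show "(\<lambda>t. (radial_deriv ^^ k) f (t *s z)) holomorphic_on {t. norm (t *s z) < 1}"
    using holomorphic_vec_on_line[OF hk, of "{t. norm (t *s z) < 1}" 0 z] by simp
  fix t assume "t \<in> {t. norm (t *s z) < 1}"
  hence "t *s z \<in> ball 0 1" by simp
  from radial_deriv_along_ray[OF hk this] obtain d where
    "((\<lambda>t. (radial_deriv ^^ k) f (t *s z)) has_field_derivative d) (at t)"
    "t * d = radial_deriv ((radial_deriv ^^ k) f) (t *s z)" by metis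
  thus "t * deriv (\<lambda>t. (radial_deriv ^^ k) f (t *s z)) t = (radial_deriv ^^ Suc k) f (t *s z)"
    by (simp add: DERIV_imp_deriv)
qed

lemma approach_region_borel [measurable]: "approach_region z \<in> sets borel"
proof -
  have "closed {w. cmod (1 - hermitian_inner z w) \<le> 8 * (1 - (norm w)\<^sup>2)}"
    by (intro closed_Collect_le continuous_intros)
  moreover have "approach_region z = ball 0 1 \<inter> {w. cmod (1 - hermitian_inner z w) \<le> 8 * (1 - (norm w)\<^sup>2)}"
    by (auto simp: approach_region_def)
  ultimately show ?thesis by (simp add: borel_closed borel_open sets.Int)
qed

text \<open>
  For \<open>N = 0\<close> this is the average over one nonisotropic ball at \<open>z\<close>. For \<open>N \<ge> 1\<close> every value of \<open>R^N f\<close> in \<open>euler_chain.radial_growth\<close> is replaced by an average over a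
  nonisotropic ball. A point \<open>w\<close> lies in the \<open>j\<close>-th ball only if \<open>2^(-j) \<le> 8 (1 - |w|^2)\<close>. Infinitely
  many balls may contain \<open>w\<close>, but the weights \<open>2^(-jNp)\<close> sum to a multiple of \<open>(1 - |w|^2)^(Np)\<close>.
\<close>

lemma pointwise_area_estimate:
  fixes p :: real and N :: nat
  assumes p: "0 < p" "p \<le> 1"
  obtains C where "C > 0"
    "\<And>(f :: complex ^ 'n \<Rightarrow> complex) z. holomorphic_vec_on f (ball 0 1) \<Longrightarrow> norm z < 1 \<Longrightarrow>
      ennreal (cmod (f z) powr p) \<le> ennreal C * (ennreal (cmod (f 0) powr p) +
        (\<integral>\<^sup>+ w. indicator (approach_region z) w *
          ennreal ((1 - (norm w)\<^sup>2) powr (p * real N - real (CARD('n) + 1)) * cmod ((radial_deriv ^^ N) f w) powr p) \<partial>lborel))"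
proof -
  obtain C1 where C1: "C1 > 0" and local:
    "\<And>(f :: complex ^ 'n \<Rightarrow> complex) \<zeta> \<tau>. holomorphic_vec_on f (ball 0 1) \<Longrightarrow> norm \<zeta> = 1 \<Longrightarrow> 0 \<le> \<tau> \<Longrightarrow> \<tau> < 1 \<Longrightarrow>
      ennreal (cmod (f (\<tau> *\<^sub>R \<zeta>)) powr p) \<le> ennreal C1 *
        (\<integral>\<^sup>+ w. indicator {w. nonisotropic_gauge \<zeta> ((1 - \<tau>) / 16) (w - \<tau> *\<^sub>R \<zeta>) < 1} w *
          ennreal ((1 - (norm w)\<^sup>2) powr (- real (CARD('n) + 1)) * cmod (f w) powr p) \<partial>lborel)"
    by (rule weighted_local_estimate[OF p, where 'n = 'n]) (rule that)
  show ?thesis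
  proof (cases "N = 0")
    case True
    show ?thesis
    proof (rule that[OF C1])
      fix f :: "complex ^ 'n \<Rightarrow> complex" and z :: "complex ^ 'n"
      assume f: "holomorphic_vec_on f (ball 0 1)" and z: "norm z < 1"
      obtain \<zeta> where \<zeta>: "norm \<zeta> = 1" "z = norm z *\<^sub>R \<zeta>" using polar_form by metis
      let ?E = "{w. nonisotropic_gauge \<zeta> ((1 - norm z) / 16) (w - norm z *\<^sub>R \<zeta>) < 1}"
      let ?H = "\<lambda>w. ennreal ((1 - (norm w)\<^sup>2) powr (- real (CARD('n) + 1)) * cmod (f w) powr p)"
      have "?E \<subseteq> approach_region z"
      proof
        fix w assume "w \<in> ?E"
        hence w: "nonisotropic_gauge \<zeta> ((1 - norm z) / 16) (w - norm z *\<^sub>R \<zeta>) \<le> 1" by simp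
        show "w \<in> approach_region z"
          using nonisotropic_ball_subset_region[OF \<zeta>(1) norm_ge_zero z w z] \<zeta>(2) z by blast
      qed
      hence "(\<integral>\<^sup>+ w. indicator ?E w * ?H w \<partial>lborel) \<le> (\<integral>\<^sup>+ w. indicator (approach_region z) w * ?H w \<partial>lborel)"
        by (intro nn_integral_mono) (auto simp: indicator_def)
      hence "ennreal C1 * (\<integral>\<^sup>+ w. indicator ?E w * ?H w \<partial>lborel) \<le>
        ennreal C1 * (ennreal (cmod (f 0) powr p) + (\<integral>\<^sup>+ w. indicator (approach_region z) w * ?H w \<partial>lborel))"
        by (intro mult_left_mono) (auto intro: order_trans add_increasing)
      from order_trans[OF local[OF f \<zeta>(1) norm_ge_zero z] this]
      show "ennreal (cmod (f z) powr p) \<le> ennreal C1 * (ennreal (cmod (f 0) powr p) +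
        (\<integral>\<^sup>+ w. indicator (approach_region z) w *
          ennreal ((1 - (norm w)\<^sup>2) powr (p * real N - real (CARD('n) + 1)) * cmod ((radial_deriv ^^ N) f w) powr p) \<partial>lborel))"
        using True \<zeta>(2) by simp
    qed
  next
    case False
    hence N: "N \<ge> 1" by simp
    define q where "q = p * real N"
    have q: "q > 0" using p N by (simp add: q_def)
    define \<theta> where "\<theta> = 2 powr (- q)"
    have \<theta>: "0 < \<theta>" "\<theta> < 1" using q by (auto simp: \<theta>_def powr_less_one)
    define K where "K = 1 / (1 - 2 powr (- p))"
    have K: "K > 0" using p by (simp add: K_def powr_less_one)
    define C2 where "C2 = C1 * (4 powr q) + C1 * (8 powr q / (1 - \<theta>))"
    have C2: "C2 > 0" using C1 \<theta> by (simp add: C2_def add_pos_pos)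
    define C3 where "C3 = real N * K ^ N"
    have C3: "C3 > 0" using K N by (simp add: C3_def)
    have C: "C3 * max 1 C2 > 0" using C3 by simp
    show ?thesis
    proof (rule that[OF C])
      fix f :: "complex ^ 'n \<Rightarrow> complex" and z :: "complex ^ 'n"
      assume f: "holomorphic_vec_on f (ball 0 1)" and z: "norm z < 1"
      define g where "g = (radial_deriv ^^ N) f"
      have g: "holomorphic_vec_on g (ball 0 1)"
        unfolding g_def by (rule holomorphic_vec_on_radial_deriv_iterate[OF f open_ball])
      \<comment> \<open>Outside the ball \<open>f\<close> is arbitrary, so measurability is available only after cutting off.\<close>
      define g' where "g' w = (if w \<in> ball 0 1 then g w else 0)" for w
      have [measurable]: "g' \<in> borel_measurable borel" unfolding g'_def
        using holomorphic_vec_on_imp_continuous_on[OF g] by (intro borel_measurable_continuous_on_if) auto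
      define G where "G w = ennreal ((1 - (norm w)\<^sup>2) powr (- real (CARD('n) + 1)) * cmod (g' w) powr p)" for w
      have [measurable]: "G \<in> borel_measurable borel" unfolding G_def by measurable
      define H where "H w = ennreal ((1 - (norm w)\<^sup>2) powr (q - real (CARD('n) + 1)) * cmod (g w) powr p)" for w
      have GH: "ennreal ((1 - (norm w)\<^sup>2) powr q) * G w = H w" if "norm w < 1" for w
      proof -
        have "(1 - (norm w)\<^sup>2) powr (q - a) = (1 - (norm w)\<^sup>2) powr q * (1 - (norm w)\<^sup>2) powr (- a)" for a
          using powr_add[of _ q "- a"] by simp
        thus ?thesis unfolding G_def H_def using that
          by (simp add: g'_def ennreal_mult[symmetric] mult.assoc[symmetric])
      qed
      let ?\<Gamma> = "approach_region z"
      have \<Gamma>1: "norm w < 1" if "w \<in> ?\<Gamma>" for w using that by (simp add: approach_region_def)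
      define J where "J = (\<integral>\<^sup>+ w. indicator ?\<Gamma> w * H w \<partial>lborel)"
      have [measurable]: "(\<lambda>w. indicator ?\<Gamma> w * H w) \<in> borel_measurable borel"
      proof -
        have "(\<lambda>w. indicator ?\<Gamma> w * (ennreal ((1 - (norm w)\<^sup>2) powr q) * G w)) \<in> borel_measurable borel" by measurable
        also have "(\<lambda>w. indicator ?\<Gamma> w * (ennreal ((1 - (norm w)\<^sup>2) powr q) * G w)) = (\<lambda>w. indicator ?\<Gamma> w * H w)"
          using GH \<Gamma>1 by (auto simp: indicator_def fun_eq_iff)
        finally show ?thesis .
      qed
      define E where "E \<zeta> \<tau> = {w. nonisotropic_gauge \<zeta> ((1 - \<tau>) / 16) (w - \<tau> *\<^sub>R \<zeta>) < 1}" for \<zeta> :: "complex ^ 'n" and \<tau>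
      have E_borel: "E \<zeta> \<tau> \<in> sets borel" if "\<tau> < 1" for \<zeta> \<tau>
      proof -
        have "open (E \<zeta> \<tau>)" unfolding E_def using that
          by (intro open_Collect_less continuous_on_compose2[OF nonisotropic_gauge_simps(6)[of _ UNIV]] continuous_intros) auto
        thus ?thesis by simp
      qed
      have local_E: "ennreal (cmod (g (\<tau> *\<^sub>R \<zeta>)) powr p) \<le> ennreal C1 * (\<integral>\<^sup>+ w. indicator (E \<zeta> \<tau>) w * G w \<partial>lborel)"
        if "norm \<zeta> = 1" "0 \<le> \<tau>" "\<tau> < 1" for \<zeta> \<tau>
      proof -
        have "(\<integral>\<^sup>+ w. indicator (E \<zeta> \<tau>) w * ennreal ((1 - (norm w)\<^sup>2) powr (- real (CARD('n) + 1)) * cmod (g w) powr p) \<partial>lborel)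
          = (\<integral>\<^sup>+ w. indicator (E \<zeta> \<tau>) w * G w \<partial>lborel)"
          using nonisotropic_ball_subset_ball[OF that]
          by (intro nn_integral_cong) (auto simp: E_def G_def g'_def indicator_def)
        thus ?thesis using local[OF g that] unfolding E_def by simp
      qed
      obtain \<zeta> where \<zeta>: "norm \<zeta> = 1" "z = norm z *\<^sub>R \<zeta>" using polar_form by metis
      interpret euler_chain "\<lambda>k t. (radial_deriv ^^ k) f (t *s z)" "{t. norm (t *s z) < 1}"
        by (rule euler_chain_radial_deriv[OF f z])
      obtain \<kappa> t where \<kappa>: "cmod \<kappa> \<le> 1 / 2" and t: "\<And>j. 1 / 2 \<le> t j" "\<And>j. (1 / 2) ^ (j + 2) \<le> 1 - t j" "\<And>j. t j < 1"
        and grow: "ennreal (cmod (f (1 *s z)) powr p) \<le> ennreal C3 *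
          (ennreal (cmod (f (0 *s z)) powr p) + ennreal (cmod (g (\<kappa> *s z)) powr p)
          + (\<Sum>j. ennreal ((2 powr (- (real N * p))) ^ j * cmod (g (of_real (t j) *s z)) powr p)))"
        using radial_growth[OF p N] unfolding C3_def K_def g_def by auto
      \<comment> \<open>The ball at \<open>\<kappa> z\<close> stays where \<open>1 - |w|^2 \<ge> 1/4\<close>, so inserting the weight costs \<open>4^q\<close>.\<close>
      have inner: "ennreal (cmod (g (\<kappa> *s z)) powr p) \<le> ennreal (C1 * (4 powr q)) * J"
      proof -
        obtain \<eta> where \<eta>: "norm \<eta> = 1" "\<kappa> *s z = norm (\<kappa> *s z) *\<^sub>R \<eta>" using polar_form by metis
        define \<tau> where "\<tau> = norm (\<kappa> *s z)"
        have "\<tau> \<le> 1 / 2 * 1" unfolding \<tau>_def norm_vector_smult using \<kappa> z by (intro mult_mono) auto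
        hence \<tau>: "0 \<le> \<tau>" "\<tau> < 1" "\<tau> \<le> 1 / 2" by (auto simp: \<tau>_def)
        have "(\<integral>\<^sup>+ w. indicator (E \<eta> \<tau>) w * G w \<partial>lborel) \<le> (\<integral>\<^sup>+ w. ennreal (4 powr q) * (indicator ?\<Gamma> w * H w) \<partial>lborel)"
        proof (rule nn_integral_mono)
          fix w
          show "indicator (E \<eta> \<tau>) w * G w \<le> ennreal (4 powr q) * (indicator ?\<Gamma> w * H w)"
          proof (cases "w \<in> E \<eta> \<tau>")
            case True
            hence w: "nonisotropic_gauge \<eta> ((1 - \<tau>) / 16) (w - \<tau> *\<^sub>R \<eta>) \<le> 1" by (simp add: E_def)
            have reg: "w \<in> ?\<Gamma>" using nonisotropic_ball_subset_region[OF \<eta>(1) \<tau>(1,2) w z] \<tau>(3) by simp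
            have "1 / 4 \<le> 1 - (norm w)\<^sup>2" by (rule nonisotropic_ball_defect(4)[OF \<eta>(1) \<tau>(1,2) w \<tau>(3)])
            hence "1 powr q \<le> (4 * (1 - (norm w)\<^sup>2)) powr q" using q by (intro powr_mono2) auto
            also have "\<dots> = 4 powr q * (1 - (norm w)\<^sup>2) powr q"
              by (rule powr_mult)
            finally have "ennreal 1 * G w \<le> ennreal (4 powr q * (1 - (norm w)\<^sup>2) powr q) * G w"
              by (intro mult_right_mono ennreal_leI) auto
            also have "\<dots> = ennreal (4 powr q) * H w"
              using GH[OF \<Gamma>1[OF reg]] by (simp add: ennreal_mult mult.assoc)
            finally show ?thesis using reg True by simp
          qed simp
        qed
        also have "\<dots> = ennreal (4 powr q) * J" unfolding J_def by (rule nn_integral_cmult) measurable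
        finally have "ennreal C1 * (\<integral>\<^sup>+ w. indicator (E \<eta> \<tau>) w * G w \<partial>lborel) \<le> ennreal C1 * (ennreal (4 powr q) * J)"
          by (rule mult_left_mono) simp
        from order_trans[OF local_E[OF \<eta>(1) \<tau>(1,2)] this] show ?thesis
          using \<eta>(2) C1 by (simp add: \<tau>_def ennreal_mult mult.assoc)
      qed
      have outer: "(\<Sum>j. ennreal (\<theta> ^ j * cmod (g (of_real (t j) *s z)) powr p)) \<le> ennreal (C1 * (8 powr q / (1 - \<theta>))) * J"
      proof -
        define \<tau> where "\<tau> j = t j * norm z" for j
        have tz: "of_real (t j) *s z = \<tau> j *\<^sub>R \<zeta>" for j
        proof -
          have "of_real (t j) *s z = t j *\<^sub>R z" by (simp add: vec_eq_iff scaleR_conv_of_real[where 'a=complex])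
          also have "\<dots> = t j *\<^sub>R (norm z *\<^sub>R \<zeta>)" using \<zeta>(2) by simp
          finally show ?thesis by (simp add: \<tau>_def)
        qed
        have \<tau>: "0 \<le> \<tau> j" "\<tau> j \<le> norm z" "\<tau> j \<le> t j" "\<tau> j < 1" for j
        proof -
          have "0 \<le> t j" "t j \<le> 1" using t(1)[of j] t(3)[of j] by auto
          thus "0 \<le> \<tau> j" "\<tau> j \<le> norm z" "\<tau> j \<le> t j"
            using z by (auto simp: \<tau>_def mult_left_le_one_le mult_left_le)
          thus "\<tau> j < 1" using z by simp
        qed
        have [measurable]: "E \<zeta> (\<tau> j) \<in> sets borel" for j by (rule E_borel[OF \<tau>(4)])
        have "(\<Sum>j. ennreal (\<theta> ^ j * cmod (g (of_real (t j) *s z)) powr p))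
          \<le> (\<Sum>j. ennreal C1 * (\<integral>\<^sup>+ w. ennreal (\<theta> ^ j) * (indicator (E \<zeta> (\<tau> j)) w * G w) \<partial>lborel))"
        proof (intro suminf_le summableI)
          fix j
          have "ennreal (\<theta> ^ j * cmod (g (of_real (t j) *s z)) powr p) = ennreal (\<theta> ^ j) * ennreal (cmod (g (\<tau> j *\<^sub>R \<zeta>)) powr p)"
            using \<theta> by (simp add: ennreal_mult tz)
          also have "\<dots> \<le> ennreal (\<theta> ^ j) * (ennreal C1 * (\<integral>\<^sup>+ w. indicator (E \<zeta> (\<tau> j)) w * G w \<partial>lborel))"
            by (intro mult_left_mono local_E \<zeta> \<tau>) simp
          also have "\<dots> = ennreal C1 * (\<integral>\<^sup>+ w. ennreal (\<theta> ^ j) * (indicator (E \<zeta> (\<tau> j)) w * G w) \<partial>lborel)"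
            by (subst nn_integral_cmult) (auto simp: mult_ac)
          finally show "ennreal (\<theta> ^ j * cmod (g (of_real (t j) *s z)) powr p)
            \<le> ennreal C1 * (\<integral>\<^sup>+ w. ennreal (\<theta> ^ j) * (indicator (E \<zeta> (\<tau> j)) w * G w) \<partial>lborel)" .
        qed
        also have "\<dots> = ennreal C1 * (\<integral>\<^sup>+ w. (\<Sum>j. ennreal (\<theta> ^ j) * (indicator (E \<zeta> (\<tau> j)) w * G w)) \<partial>lborel)"
          by (subst nn_integral_suminf) auto
        also have "(\<integral>\<^sup>+ w. (\<Sum>j. ennreal (\<theta> ^ j) * (indicator (E \<zeta> (\<tau> j)) w * G w)) \<partial>lborel)
          \<le> (\<integral>\<^sup>+ w. ennreal (8 powr q / (1 - \<theta>)) * (indicator ?\<Gamma> w * H w) \<partial>lborel)"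
        proof (rule nn_integral_mono)
          fix w
          have mem: "w \<in> ?\<Gamma>" "(1 / 2) ^ j \<le> 8 * (1 - (norm w)\<^sup>2)" if "w \<in> E \<zeta> (\<tau> j)" for j
          proof -
            have w: "nonisotropic_gauge \<zeta> ((1 - \<tau> j) / 16) (w - \<tau> j *\<^sub>R \<zeta>) \<le> 1" using that by (simp add: E_def)
            show "w \<in> ?\<Gamma>" using nonisotropic_ball_subset_region[OF \<zeta>(1) \<tau>(1,4) w z] \<tau>(2)[of j] z \<zeta>(2) by blast
            have "(1 / 2) ^ (j + 2) \<le> 1 - \<tau> j" using t(2)[of j] \<tau>(3)[of j] by simp
            thus "(1 / 2) ^ j \<le> 8 * (1 - (norm w)\<^sup>2)"
              using nonisotropic_ball_defect(2)[OF \<zeta>(1) \<tau>(1,4) w] by simp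
          qed
          show "(\<Sum>j. ennreal (\<theta> ^ j) * (indicator (E \<zeta> (\<tau> j)) w * G w)) \<le> ennreal (8 powr q / (1 - \<theta>)) * (indicator ?\<Gamma> w * H w)"
          proof (cases "w \<in> ?\<Gamma>")
            case True
            define D where "D = 8 * (1 - (norm w)\<^sup>2)"
            have s: "1 - (norm w)\<^sup>2 > 0" using \<Gamma>1[OF True] by (simp add: abs_square_less_1)
            have "(\<Sum>j. ennreal (\<theta> ^ j) * (indicator (E \<zeta> (\<tau> j)) w * G w)) = (\<Sum>j. ennreal (\<theta> ^ j) * indicator (E \<zeta> (\<tau> j)) w) * G w"
              by (simp add: mult.assoc flip: ennreal_suminf_multc)
            also have "(\<Sum>j. ennreal (\<theta> ^ j) * indicator (E \<zeta> (\<tau> j)) w) \<le> (\<Sum>j. ennreal (if (1 / 2) ^ j \<le> D then \<theta> ^ j else 0))"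
              using mem(2) by (intro suminf_le summableI) (auto simp: indicator_def D_def)
            also have "\<dots> \<le> ennreal (D powr q / (1 - \<theta>))"
              unfolding \<theta>_def by (rule suminf_geometric_below_threshold) (use q s in \<open>auto simp: D_def\<close>)
            also have "D powr q / (1 - \<theta>) = 8 powr q / (1 - \<theta>) * (1 - (norm w)\<^sup>2) powr q"
            proof -
              have "D powr q = 8 powr q * (1 - (norm w)\<^sup>2) powr q" unfolding D_def by (rule powr_mult)
              thus ?thesis by simp
            qed
            finally have "(\<Sum>j. ennreal (\<theta> ^ j) * (indicator (E \<zeta> (\<tau> j)) w * G w))
              \<le> ennreal (8 powr q / (1 - \<theta>) * (1 - (norm w)\<^sup>2) powr q) * G w" by (simp add: mult_right_mono)
            also have "\<dots> = ennreal (8 powr q / (1 - \<theta>)) * (ennreal ((1 - (norm w)\<^sup>2) powr q) * G w)"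
              by (subst ennreal_mult) (use \<theta> in \<open>auto simp: mult.assoc\<close>)
            finally show ?thesis using True GH[OF \<Gamma>1[OF True]] by simp
          next
            case False
            hence "w \<notin> E \<zeta> (\<tau> j)" for j using mem(1) by blast
            thus ?thesis by simp
          qed
        qed
        also have "\<dots> = ennreal (8 powr q / (1 - \<theta>)) * J" unfolding J_def by (rule nn_integral_cmult) measurable
        finally have fin: "(\<Sum>j. ennreal (\<theta> ^ j * cmod (g (of_real (t j) *s z)) powr p))
          \<le> ennreal C1 * (ennreal (8 powr q / (1 - \<theta>)) * J)" by (simp add: mult_left_mono)
        have "ennreal (C1 * (8 powr q / (1 - \<theta>))) * J = ennreal C1 * (ennreal (8 powr q / (1 - \<theta>)) * J)"
          by (subst ennreal_mult) (use C1 \<theta> in \<open>auto simp: mult.assoc\<close>)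
        thus ?thesis using fin by (simp only:)
      qed
      have "ennreal (cmod (f z) powr p) \<le> ennreal C3 *
          (ennreal (cmod (f 0) powr p) + ennreal (C1 * (4 powr q)) * J + ennreal (C1 * (8 powr q / (1 - \<theta>))) * J)"
      proof -
        have "2 powr (- (real N * p)) = \<theta>" by (simp add: \<theta>_def q_def mult.commute)
        hence "ennreal (cmod (f z) powr p) \<le> ennreal C3 * (ennreal (cmod (f 0) powr p) + ennreal (cmod (g (\<kappa> *s z)) powr p)
          + (\<Sum>j. ennreal (\<theta> ^ j * cmod (g (of_real (t j) *s z)) powr p)))" using grow by simp
        also have "\<dots> \<le> ennreal C3 *
          (ennreal (cmod (f 0) powr p) + ennreal (C1 * (4 powr q)) * J + ennreal (C1 * (8 powr q / (1 - \<theta>))) * J)"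
          by (intro mult_left_mono add_mono inner outer order_refl) simp
        finally show ?thesis .
      qed
      also have "\<dots> = ennreal C3 * (ennreal (cmod (f 0) powr p) + ennreal C2 * J)"
        using C1 \<theta> by (simp add: C2_def ennreal_plus distrib_right add.assoc)
      also have "\<dots> \<le> ennreal C3 * (ennreal (max 1 C2) * ennreal (cmod (f 0) powr p) + ennreal (max 1 C2) * J)"
      proof -
        have "1 * ennreal (cmod (f 0) powr p) \<le> ennreal (max 1 C2) * ennreal (cmod (f 0) powr p)"
          by (intro mult_right_mono) (simp_all add: ennreal_1[symmetric] ennreal_leI del: ennreal_1)
        thus ?thesis by (intro mult_left_mono add_mono mult_right_mono ennreal_leI) auto
      qed
      also have "\<dots> = ennreal (C3 * max 1 C2) * (ennreal (cmod (f 0) powr p) + J)"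
        using C3 by (simp add: ennreal_mult distrib_left mult.assoc)
      finally show "ennreal (cmod (f z) powr p) \<le> ennreal (C3 * max 1 C2) * (ennreal (cmod (f 0) powr p) +
        (\<integral>\<^sup>+ w. indicator (approach_region z) w *
          ennreal ((1 - (norm w)\<^sup>2) powr (p * real N - real (CARD('n) + 1)) * cmod ((radial_deriv ^^ N) f w) powr p) \<partial>lborel))"
        by (simp add: J_def H_def g_def q_def)
    qed
  qed
qed

section \<open>Carleson tubes and weighted volume\<close>

lemma carleson_tube_eq: "carleson_tube r \<zeta> = ball 0 1 \<inter> {z. cmod (1 - hermitian_inner z \<zeta>) < r}"
  by (auto simp: carleson_tube_def)

lemma open_carleson_tube: "open (carleson_tube r \<zeta>)"
  unfolding carleson_tube_eq by (intro open_Int open_ball open_Collect_less continuous_intros)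

lemma carleson_tube_borel [measurable]: "carleson_tube r \<zeta> \<in> sets borel"
  by (rule borel_open[OF open_carleson_tube])

lemma borel_measure_on_ball_sets:
  assumes "borel_measure_on_ball \<mu>"
  shows "space \<mu> = ball 0 1" "A \<in> sets borel \<Longrightarrow> A \<subseteq> ball 0 1 \<Longrightarrow> A \<in> sets \<mu>"
proof -
  have s: "sets \<mu> = sets (restrict_space borel (ball 0 1))" using assms by (simp add: borel_measure_on_ball_def)
  show "space \<mu> = ball 0 1" using sets_eq_imp_space_eq[OF s] by (simp add: space_restrict_space)
  show "A \<in> sets borel \<Longrightarrow> A \<subseteq> ball 0 1 \<Longrightarrow> A \<in> sets \<mu>" unfolding s by (simp add: sets_restrict_space_iff)
qed

text \<open>
  Finitely many tubes cover a neighbourhood of the sphere, and what they leave out of the ball is compact.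
\<close>

lemma finite_of_finite_on_tubes:
  fixes \<mu> :: "(complex ^ 'n) measure"
  assumes \<mu>: "borel_measure_on_ball \<mu>" and r: "r > 0"
    and fin: "\<And>\<zeta>. norm \<zeta> = 1 \<Longrightarrow> emeasure \<mu> (carleson_tube r \<zeta>) < \<infinity>"
  shows "emeasure \<mu> (ball 0 1) < \<infinity>"
proof -
  note S = borel_measure_on_ball_sets[OF \<mu>]
  define U where "U \<zeta> = {z. cmod (1 - hermitian_inner z \<zeta>) < r}" for \<zeta> :: "complex ^ 'n"
  have U: "open (U \<zeta>)" for \<zeta> unfolding U_def by (intro open_Collect_less continuous_intros)
  have "sphere 0 1 \<subseteq> (\<Union>\<zeta>\<in>sphere 0 1. U \<zeta>)"
  proof
    fix \<zeta> :: "complex ^ 'n" assume \<zeta>: "\<zeta> \<in> sphere 0 1"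
    hence "\<zeta> \<in> U \<zeta>" using r by (simp add: U_def norm_eq_hermitian_inner)
    thus "\<zeta> \<in> (\<Union>\<zeta>\<in>sphere 0 1. U \<zeta>)" using \<zeta> by blast
  qed
  then obtain C where C: "C \<subseteq> sphere 0 1" "finite C" "sphere 0 1 \<subseteq> (\<Union>\<zeta>\<in>C. U \<zeta>)"
    using compactE_image[OF compact_sphere, of "sphere 0 1" U 0 1] U by metis
  define K where "K = cball 0 1 - (\<Union>\<zeta>\<in>C. U \<zeta>)"
  have "compact K" unfolding K_def using U by (intro compact_diff compact_cball open_UN) auto
  moreover have K: "K \<subseteq> ball 0 1"
  proof
    fix z assume z: "z \<in> K"
    hence "z \<notin> sphere 0 1" using C(3) by (auto simp: K_def)
    thus "z \<in> ball 0 1" using z by (auto simp: K_def)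
  qed
  ultimately have "emeasure \<mu> K < \<infinity>" using \<mu> by (simp add: borel_measure_on_ball_def)
  have Ks: "K \<in> sets \<mu>" using K \<open>compact K\<close> by (intro S(2)) (auto intro: borel_compact)
  have Ts: "carleson_tube r \<zeta> \<in> sets \<mu>" for \<zeta> by (intro S(2)) (auto simp: carleson_tube_def)
  have "emeasure \<mu> (ball 0 1) \<le> emeasure \<mu> (K \<union> (\<Union>\<zeta>\<in>C. carleson_tube r \<zeta>))"
  proof (rule emeasure_mono)
    show "ball 0 1 \<subseteq> K \<union> (\<Union>\<zeta>\<in>C. carleson_tube r \<zeta>)"
      by (auto simp: K_def U_def carleson_tube_def)
  qed (use Ks Ts C(2) in auto)
  also have "\<dots> \<le> emeasure \<mu> K + emeasure \<mu> (\<Union>\<zeta>\<in>C. carleson_tube r \<zeta>)"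
    by (rule emeasure_subadditive) (use Ks Ts C(2) in auto)
  also have "emeasure \<mu> (\<Union>\<zeta>\<in>C. carleson_tube r \<zeta>) \<le> (\<Sum>\<zeta>\<in>C. emeasure \<mu> (carleson_tube r \<zeta>))"
    by (rule emeasure_subadditive_finite) (use Ts C(2) in auto)
  also have "emeasure \<mu> K + (\<Sum>\<zeta>\<in>C. emeasure \<mu> (carleson_tube r \<zeta>)) < \<infinity>"
  proof -
    have "(\<Sum>\<zeta>\<in>C. emeasure \<mu> (carleson_tube r \<zeta>)) < top" using fin C by (subst ennreal_sum_less_top) auto
    thus ?thesis using \<open>emeasure \<mu> K < \<infinity>\<close> by (simp add: ennreal_add_less_top)
  qed
  finally show ?thesis by (simp add: add_left_mono)
qed

lemma one_minus_square_powr_le: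
  fixes x t :: real
  assumes "0 \<le> x" "x < 1"
  shows "(1 - x\<^sup>2) powr t \<le> 2 powr \<bar>t\<bar> * (1 - x) powr t"
proof -
  have "1 - x\<^sup>2 = (1 + x) * (1 - x)" by (simp add: power2_eq_square algebra_simps)
  hence "(1 - x\<^sup>2) powr t = (1 + x) powr t * (1 - x) powr t" using assms by (simp add: powr_mult)
  also have "(1 + x) powr t \<le> 2 powr \<bar>t\<bar>"
  proof (cases "t \<ge> 0")
    case True
    thus ?thesis using assms by (auto intro!: powr_mono2)
  next
    case False
    have "(1 + x) powr t \<le> (1 + x) powr 0" using False assms by (intro powr_mono) auto
    also have "\<dots> \<le> 2 powr \<bar>t\<bar>" using assms by (simp add: ge_one_powr_ge_zero)
    finally show ?thesis .
  qed
  finally show ?thesis by (simp add: mult_right_mono)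
qed

lemma nn_integral_powr_near_boundary:
  fixes \<rho> t R :: real
  assumes "\<rho> > 0" "t > -1" "R > 0"
  shows "(\<integral>\<^sup>+ l. ennreal (indicator {0..R} (1 - l * \<rho>) * (1 - l * \<rho>) powr t) \<partial>lborel) = ennreal (R powr (t + 1) / (t + 1) / \<rho>)"
proof -
  define F where "F y = ennreal (indicator {0..R} y * y powr t)" for y :: real
  have [measurable]: "F \<in> borel_measurable borel" unfolding F_def by measurable
  have "(\<integral>\<^sup>+ y. F y \<partial>lborel) = ennreal (R powr (t + 1) / (t + 1))"
    unfolding F_def using assms by (intro nn_integral_has_integral_lebesgue has_integral_powr_from_0) auto
  moreover have "(\<integral>\<^sup>+ y. F y \<partial>lborel) = ennreal \<bar>- \<rho>\<bar> * (\<integral>\<^sup>+ l. F (1 + (- \<rho>) * l) \<partial>lborel)"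
    by (rule nn_integral_real_affine) (use assms in auto)
  ultimately have *: "ennreal \<rho> * (\<integral>\<^sup>+ l. F (1 - l * \<rho>) \<partial>lborel) = ennreal (R powr (t + 1) / (t + 1))"
    using assms by (simp add: mult.commute)
  have "(\<integral>\<^sup>+ l. F (1 - l * \<rho>) \<partial>lborel) = ennreal (1 / \<rho>) * (ennreal \<rho> * (\<integral>\<^sup>+ l. F (1 - l * \<rho>) \<partial>lborel))"
    using assms by (simp add: mult.assoc[symmetric] ennreal_mult[symmetric])
  also have "\<dots> = ennreal (R powr (t + 1) / (t + 1) / \<rho>)"
    unfolding * using assms by (simp add: ennreal_mult[symmetric])
  finally show ?thesis by (simp add: F_def)
qed

text \<open>
  Only the singularity of the weight at the sphere matters. The integral \<open>J\<close> over the tube is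
  at most the average of its dilated versions, under \<open>z \<mapsto> l z\<close> with \<open>l\<close> in \<open>[1 - R, 1]\<close>. For a fixed \<open>z\<close> the integral
  over \<open>l\<close> of the weight is elementary, of order \<open>R^(t+1)\<close>, and the points \<open>z\<close> that
  contribute lie in a nonisotropic ball of volume of order \<open>R^(n+1)\<close>.
\<close>

lemma weighted_tube_volume_small:
  fixes t :: real
  assumes t: "t > -1"
  obtains C where "C > 0"
    "\<And>(\<zeta> :: complex ^ 'n) R. norm \<zeta> = 1 \<Longrightarrow> 0 < R \<Longrightarrow> R \<le> 1 / 4 \<Longrightarrow>
      (\<integral>\<^sup>+ z. indicator (carleson_tube R \<zeta>) z * ennreal ((1 - (norm z)\<^sup>2) powr t) \<partial>lborel) \<le> ennreal (C * R powr (real CARD('n) + 1 + t))"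
proof -
  define c where "c = 2 powr \<bar>t\<bar> * 2 / (t + 1)"
  have c: "c > 0" using t by (simp add: c_def)
  show ?thesis
  proof (rule that[of "c * 8 ^ (2 * CARD('n))"])
    show "c * 8 ^ (2 * CARD('n)) > 0" using c by simp
    fix \<zeta> :: "complex ^ 'n" and R :: real
    assume \<zeta>: "norm \<zeta> = 1" and R: "0 < R" "R \<le> 1 / 4"
    define g where "g z = indicator (carleson_tube R \<zeta>) z * ennreal ((1 - (norm z)\<^sup>2) powr t)" for z :: "complex ^ 'n"
    have [measurable]: "g \<in> borel_measurable borel" unfolding g_def by measurable
    define J where "J = (\<integral>\<^sup>+ z. g z \<partial>lborel)"
    define Z where "Z = {z :: complex ^ 'n. norm z \<le> 1 + 2 * R \<and> cmod (1 - hermitian_inner z \<zeta>) \<le> 4 * R}"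
    have "closed Z" unfolding Z_def by (intro closed_Collect_conj closed_Collect_le continuous_intros)
    hence [measurable]: "Z \<in> sets borel" by simp
    \<comment> \<open>Dilating outwards by \<open>1 / l\<close> with \<open>l\<close> in \<open>I\<close> moves the tube into \<open>Z\<close>.\<close>
    define I where "I = {1 - R..1}"
    have J_le: "J \<le> (\<integral>\<^sup>+ z. g (l *\<^sub>R z) \<partial>lborel)" if l: "l \<in> I" for l
    proof -
      have l': "0 < l" "l \<le> 1" using l R by (auto simp: I_def)
      have "J = ennreal (l ^ DIM(complex ^ 'n)) * (\<integral>\<^sup>+ z. g (l *\<^sub>R z) \<partial>lborel)"
        unfolding J_def by (rule nn_integral_lborel_scale) (use l' in auto)
      also have "\<dots> \<le> 1 * (\<integral>\<^sup>+ z. g (l *\<^sub>R z) \<partial>lborel)"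
      proof (rule mult_right_mono)
        have "l ^ DIM(complex ^ 'n) \<le> 1" using l' by (intro power_le_one) auto
        thus "ennreal (l ^ DIM(complex ^ 'n)) \<le> 1" using ennreal_leI[of _ 1] by simp
      qed simp
      finally show ?thesis by simp
    qed
    have "ennreal R * J = (\<integral>\<^sup>+ (l::real). J * indicator I l \<partial>lborel)"
      using R by (subst nn_integral_cmult_indicator) (auto simp: I_def mult.commute)
    also have "\<dots> \<le> (\<integral>\<^sup>+ l. (\<integral>\<^sup>+ z. indicator I l * g (l *\<^sub>R z) \<partial>lborel) \<partial>lborel)"
    proof (rule nn_integral_mono)
      fix l
      show "J * indicator I l \<le> (\<integral>\<^sup>+ z. indicator I l * g (l *\<^sub>R z) \<partial>lborel)"
        using J_le[of l] by (cases "l \<in> I") auto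
    qed
    also have "\<dots> = (\<integral>\<^sup>+ z. (\<integral>\<^sup>+ l. indicator I l * g (l *\<^sub>R z) \<partial>lborel) \<partial>lborel)"
      by (rule lborel_pair.Fubini') (simp add: I_def case_prod_unfold)
    also have "\<dots> \<le> (\<integral>\<^sup>+ z. ennreal (c * R powr (t + 1)) * indicator Z z \<partial>lborel)"
    proof (rule nn_integral_mono)
      fix z :: "complex ^ 'n"
      define \<rho> where "\<rho> = norm z"
      have supp: "z \<in> Z \<and> \<rho> \<ge> 1 / 2 \<and> l * \<rho> < 1 \<and> 1 - l * \<rho> \<le> R \<and> 0 \<le> l" if l: "l \<in> I" and nz: "l *\<^sub>R z \<in> carleson_tube R \<zeta>" for l
      proof -
        have l': "3 / 4 \<le> l" "1 - R \<le> l" "l \<le> 1" using l R by (auto simp: I_def)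
        have 1: "l * \<rho> < 1" using nz l' by (simp add: carleson_tube_def \<rho>_def)
        have 2: "cmod (1 - of_real l * hermitian_inner z \<zeta>) < R"
          using nz by (simp add: carleson_tube_def hermitian_inner_simps)
        have "cmod (of_real l * hermitian_inner z \<zeta>) \<le> l * \<rho>"
          using l' cmod_hermitian_inner_le[of z \<zeta>] \<zeta> by (simp add: norm_mult \<rho>_def mult_left_mono)
        hence 3: "1 - l * \<rho> \<le> R"
          using 2 norm_triangle_ineq2[of 1 "of_real l * hermitian_inner z \<zeta>"] by simp
        have 4: "l * \<rho> \<le> 1 * \<rho>" using l' by (intro mult_right_mono) (auto simp: \<rho>_def)
        have "(1 - R) * \<rho> \<le> l * \<rho>" using l' by (intro mult_right_mono) (auto simp: \<rho>_def)
        hence "(1 - R) * \<rho> \<le> 1" using 1 by simp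
        also have "1 \<le> (1 - R) * (1 + 2 * R)" 
        proof -
          have "0 \<le> R * (1 - 2 * R)" using R by simp
          thus ?thesis by (simp add: algebra_simps)
        qed
        finally have 5: "\<rho> \<le> 1 + 2 * R" using R by simp
        have "l * cmod (1 - hermitian_inner z \<zeta>) = cmod ((1 - of_real l * hermitian_inner z \<zeta>) - of_real (1 - l))"
        proof -
          have "(1 - of_real l * hermitian_inner z \<zeta>) - of_real (1 - l) = of_real l * (1 - hermitian_inner z \<zeta>)"
            by (simp add: algebra_simps)
          thus ?thesis using l' by (simp add: norm_mult)
        qed
        also have "\<dots> \<le> cmod (1 - of_real l * hermitian_inner z \<zeta>) + cmod (of_real (1 - l))" by (rule norm_triangle_ineq4)
        also have "cmod (of_real (1 - l)) = 1 - l" unfolding norm_of_real using l' by simp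
        finally have "l * cmod (1 - hermitian_inner z \<zeta>) \<le> 2 * R" using 2 l' by linarith
        moreover have "(1 / 2) * cmod (1 - hermitian_inner z \<zeta>) \<le> l * cmod (1 - hermitian_inner z \<zeta>)"
          using l' by (intro mult_right_mono) auto
        ultimately have "cmod (1 - hermitian_inner z \<zeta>) \<le> 4 * R" by simp
        thus ?thesis using 1 3 4 5 l' R by (auto simp: Z_def \<rho>_def)
      qed
      show "(\<integral>\<^sup>+ l. indicator I l * g (l *\<^sub>R z) \<partial>lborel) \<le> ennreal (c * R powr (t + 1)) * indicator Z z"
      proof (cases "z \<in> Z \<and> \<rho> \<ge> 1 / 2")
        case True
        have "(\<integral>\<^sup>+ l. indicator I l * g (l *\<^sub>R z) \<partial>lborel)
          \<le> (\<integral>\<^sup>+ l. ennreal (2 powr \<bar>t\<bar>) * ennreal (indicator {0..R} (1 - l * \<rho>) * (1 - l * \<rho>) powr t) \<partial>lborel)"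
        proof (rule nn_integral_mono)
          fix l
          show "indicator I l * g (l *\<^sub>R z) \<le> ennreal (2 powr \<bar>t\<bar>) * ennreal (indicator {0..R} (1 - l * \<rho>) * (1 - l * \<rho>) powr t)"
          proof (cases "l \<in> I \<and> l *\<^sub>R z \<in> carleson_tube R \<zeta>")
            case True
            hence s: "l * \<rho> < 1" "1 - l * \<rho> \<le> R" "0 \<le> l" using supp[of l] by auto
            have "(1 - (l * \<rho>)\<^sup>2) powr t \<le> 2 powr \<bar>t\<bar> * (1 - l * \<rho>) powr t"
              using s by (intro one_minus_square_powr_le) (auto simp: \<rho>_def)
            thus ?thesis using True s by (simp add: g_def \<rho>_def ennreal_mult[symmetric] ennreal_leI)
          qed (auto simp: g_def)
        qed
        also have "\<dots> = ennreal (2 powr \<bar>t\<bar>) * (\<integral>\<^sup>+ l. ennreal (indicator {0..R} (1 - l * \<rho>) * (1 - l * \<rho>) powr t) \<partial>lborel)"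
          by (rule nn_integral_cmult) measurable
        also have "\<dots> = ennreal (2 powr \<bar>t\<bar> * (R powr (t + 1) / (t + 1) / \<rho>))"
        proof -
          have i: "(\<integral>\<^sup>+ l. ennreal (indicator {0..R} (1 - l * \<rho>) * (1 - l * \<rho>) powr t) \<partial>lborel) = ennreal (R powr (t + 1) / (t + 1) / \<rho>)"
            using True R t by (intro nn_integral_powr_near_boundary) auto
          show ?thesis unfolding i by (rule ennreal_mult[symmetric]) (use True t in auto)
        qed
        also have "2 powr \<bar>t\<bar> * (R powr (t + 1) / (t + 1) / \<rho>) \<le> 2 powr \<bar>t\<bar> * (R powr (t + 1) / (t + 1) / (1 / 2))"
          using True t by (intro mult_left_mono divide_left_mono) auto
        hence "ennreal (2 powr \<bar>t\<bar> * (R powr (t + 1) / (t + 1) / \<rho>)) \<le> ennreal (c * R powr (t + 1))"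
          by (intro ennreal_leI) (simp add: c_def mult_ac)
        finally show ?thesis using True by simp
      next
        case False
        hence "indicator I l * g (l *\<^sub>R z) = 0" for l using supp[of l] by (auto simp: g_def indicator_def)
        hence z: "(\<lambda>l. indicator I l * g (l *\<^sub>R z)) = (\<lambda>_. 0)" by (rule ext)
        show ?thesis unfolding z by simp
      qed
    qed
    also have "\<dots> = ennreal (c * R powr (t + 1)) * emeasure lborel Z" by (rule nn_integral_cmult_indicator) simp
    also have "\<dots> \<le> ennreal (c * R powr (t + 1)) * ennreal (8 ^ (2 * CARD('n)) * R ^ (CARD('n) + 1))"
      unfolding Z_def by (intro mult_left_mono emeasure_nonisotropic_ball_upper \<zeta> R) simp
    also have "\<dots> = ennreal (R * (c * 8 ^ (2 * CARD('n)) * R powr (real CARD('n) + 1 + t)))"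
    proof -
      have "R powr (t + 1) * R ^ (CARD('n) + 1) = R powr (t + 1) * R powr (real (CARD('n) + 1))"
        using R by (subst powr_realpow) auto
      also have "\<dots> = R powr (1 + (real CARD('n) + 1 + t))" by (simp add: powr_add[symmetric] algebra_simps)
      also have "\<dots> = R * R powr (real CARD('n) + 1 + t)" using R by (subst powr_add) simp
      finally have pw: "R powr (t + 1) * R ^ (CARD('n) + 1) = R * R powr (real CARD('n) + 1 + t)" .
      have "c * R powr (t + 1) * (8 ^ (2 * CARD('n)) * R ^ (CARD('n) + 1))
          = (c * 8 ^ (2 * CARD('n))) * (R powr (t + 1) * R ^ (CARD('n) + 1))"
        by (simp only: mult_ac)
      also have "\<dots> = R * (c * 8 ^ (2 * CARD('n)) * R powr (real CARD('n) + 1 + t))"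
        unfolding pw by (simp only: mult_ac)
      finally have "c * R powr (t + 1) * (8 ^ (2 * CARD('n)) * R ^ (CARD('n) + 1)) = R * (c * 8 ^ (2 * CARD('n)) * R powr (real CARD('n) + 1 + t))" .
      thus ?thesis using c R by (simp only: ennreal_mult[symmetric] mult_nonneg_nonneg less_imp_le powr_ge_zero zero_le_power)
    qed
    finally have "ennreal R * J \<le> ennreal R * ennreal (c * 8 ^ (2 * CARD('n)) * R powr (real CARD('n) + 1 + t))"
      using c R by (simp add: ennreal_mult)
    hence "J \<le> ennreal (c * 8 ^ (2 * CARD('n)) * R powr (real CARD('n) + 1 + t))"
      using R by (subst (asm) ennreal_mult_le_mult_iff) auto
    thus "(\<integral>\<^sup>+ z. indicator (carleson_tube R \<zeta>) z * ennreal ((1 - (norm z)\<^sup>2) powr t) \<partial>lborel) \<le> ennreal (c * 8 ^ (2 * CARD('n)) * R powr (real CARD('n) + 1 + t))"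
      by (simp add: J_def g_def)
  qed
qed

lemma one_minus_norm_square_pos: "norm z < 1 \<Longrightarrow> 0 < 1 - (norm z)\<^sup>2"
  by (simp add: abs_square_less_1)

lemma weighted_volume_measure:
  "sets (weighted_volume \<alpha> :: (complex ^ 'n) measure) = sets (restrict_space borel (ball 0 1))"
  "space (weighted_volume \<alpha> :: (complex ^ 'n) measure) = ball 0 1"
  by (simp_all add: weighted_volume_def sets_restrict_space space_restrict_space)

lemma nn_integral_weighted_volume:
  fixes F :: "complex ^ 'n \<Rightarrow> ennreal"
  assumes "(\<lambda>z. indicator (ball 0 1) z * F z) \<in> borel_measurable borel"
  shows "(\<integral>\<^sup>+ z. F z \<partial>weighted_volume \<alpha>) = (\<integral>\<^sup>+ z. indicator (ball 0 1) z * (ennreal ((1 - (norm z)\<^sup>2) powr \<alpha>) * F z) \<partial>lborel)"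
proof -
  have b: "(ball 0 1 :: (complex ^ 'n) set) \<inter> space lborel \<in> sets lborel" by simp
  have F: "F \<in> borel_measurable (restrict_space lborel (ball 0 1))"
    using assms by (subst borel_measurable_restrict_space_iff_ennreal[OF b]) (simp add: mult.commute)
  have w: "(\<lambda>z. ennreal ((1 - (norm z)\<^sup>2) powr \<alpha>)) \<in> borel_measurable (restrict_space lborel (ball 0 1 :: (complex ^ 'n) set))"
    by (intro measurable_restrict_space1) measurable
  have "(\<integral>\<^sup>+ z. F z \<partial>weighted_volume \<alpha>) = (\<integral>\<^sup>+ z. ennreal ((1 - (norm z)\<^sup>2) powr \<alpha>) * F z \<partial>restrict_space lborel (ball 0 1))"
    unfolding weighted_volume_def by (rule nn_integral_density[OF w F])
  also have "\<dots> = (\<integral>\<^sup>+ z. ennreal ((1 - (norm z)\<^sup>2) powr \<alpha>) * F z * indicator (ball 0 1) z \<partial>lborel)"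
    by (rule nn_integral_restrict_space[OF b])
  finally show ?thesis by (simp add: mult_ac)
qed

lemma emeasure_weighted_volume:
  assumes [measurable]: "A \<in> sets borel" and "A \<subseteq> ball 0 1"
  shows "emeasure (weighted_volume \<alpha> :: (complex ^ 'n) measure) A = (\<integral>\<^sup>+ z. indicator A z * ennreal ((1 - (norm z)\<^sup>2) powr \<alpha>) \<partial>lborel)"
proof -
  have "A \<in> sets (weighted_volume \<alpha> :: (complex ^ 'n) measure)"
    using assms by (simp add: weighted_volume_measure sets_restrict_space_iff)
  hence "emeasure (weighted_volume \<alpha>) A = (\<integral>\<^sup>+ z. indicator A z \<partial>weighted_volume \<alpha>)" by simp
  also have "\<dots> = (\<integral>\<^sup>+ z. indicator (ball 0 1) z * (ennreal ((1 - (norm z)\<^sup>2) powr \<alpha>) * indicator A z) \<partial>lborel)"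
    by (rule nn_integral_weighted_volume) (intro borel_measurable_times_ennreal borel_measurable_indicator, use assms in auto)
  also have "\<dots> = (\<integral>\<^sup>+ z. indicator A z * ennreal ((1 - (norm z)\<^sup>2) powr \<alpha>) \<partial>lborel)"
    using assms(2) by (intro nn_integral_cong) (auto simp: indicator_def)
  finally show ?thesis .
qed

lemma borel_measure_on_ball_weighted_volume: "borel_measure_on_ball (weighted_volume \<alpha> :: (complex ^ 'n) measure)"
  unfolding borel_measure_on_ball_def
proof (intro conjI allI impI)
  fix K :: "(complex ^ 'n) set" assume K: "compact K \<and> K \<subseteq> ball 0 1"
  have "continuous_on K (\<lambda>z. (1 - (norm z)\<^sup>2) powr \<alpha>)"
    using K one_minus_norm_square_pos by (intro continuous_intros) (force simp: subset_iff)+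
  hence "bounded ((\<lambda>z. (1 - (norm z)\<^sup>2) powr \<alpha>) ` K)" using K by (intro compact_imp_bounded compact_continuous_image) auto
  then obtain M where M: "\<And>z. z \<in> K \<Longrightarrow> (1 - (norm z)\<^sup>2) powr \<alpha> \<le> M" unfolding bounded_iff by force
  have Kb: "K \<in> sets borel" using K borel_compact by blast
  have "emeasure (weighted_volume \<alpha>) K = (\<integral>\<^sup>+ z. indicator K z * ennreal ((1 - (norm z)\<^sup>2) powr \<alpha>) \<partial>lborel)"
    by (rule emeasure_weighted_volume) (use K Kb in auto)
  also have "\<dots> \<le> (\<integral>\<^sup>+ z. ennreal M * indicator K z \<partial>lborel)"
    using M by (intro nn_integral_mono) (auto simp: indicator_def intro: ennreal_leI)
  also have "\<dots> = ennreal M * emeasure lborel K" using Kb by (intro nn_integral_cmult_indicator) simp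
  also have "emeasure lborel K < \<infinity>" using K by (intro emeasure_compact_finite) auto
  hence "ennreal M * emeasure lborel K < \<infinity>" by (simp add: ennreal_mult_less_top)
  finally show "emeasure (weighted_volume \<alpha>) K < \<infinity>" .
qed (rule weighted_volume_measure)

lemma weighted_volume_tubes:
  fixes t :: real
  assumes t: "t > -1"
  obtains C where "C > 0" "emeasure (weighted_volume t :: (complex ^ 'n) measure) (ball 0 1) < \<infinity>"
    "\<And>(\<zeta> :: complex ^ 'n) R. norm \<zeta> = 1 \<Longrightarrow> 0 < R \<Longrightarrow>
      emeasure (weighted_volume t) (carleson_tube R \<zeta>) \<le> ennreal (C * R powr (real CARD('n) + 1 + t))"
proof -
  let ?V = "weighted_volume t :: (complex ^ 'n) measure"
  define e where "e = real CARD('n) + 1 + t"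
  have e: "e > 0" using t by (simp add: e_def)
  have sub: "carleson_tube R \<zeta> \<subseteq> ball 0 1" for R and \<zeta> :: "complex ^ 'n" by (auto simp: carleson_tube_def)
  obtain C where C: "C > 0" "\<And>(\<zeta> :: complex ^ 'n) R. norm \<zeta> = 1 \<Longrightarrow> 0 < R \<Longrightarrow> R \<le> 1 / 4 \<Longrightarrow>
      (\<integral>\<^sup>+ z. indicator (carleson_tube R \<zeta>) z * ennreal ((1 - (norm z)\<^sup>2) powr t) \<partial>lborel) \<le> ennreal (C * R powr (real CARD('n) + 1 + t))"
    by (rule weighted_tube_volume_small[OF t, where 'n = 'n]) (rule that)
  have small: "emeasure ?V (carleson_tube R \<zeta>) \<le> ennreal (C * R powr e)"
    if "norm \<zeta> = 1" "0 < R" "R \<le> 1 / 4" for R and \<zeta> :: "complex ^ 'n"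
    unfolding emeasure_weighted_volume[OF carleson_tube_borel sub] e_def by (rule C(2)[OF that])
  have fin: "emeasure ?V (ball 0 1) < \<infinity>"
  proof (rule finite_of_finite_on_tubes[OF borel_measure_on_ball_weighted_volume, of "1 / 4"])
    fix \<zeta> :: "complex ^ 'n" assume "norm \<zeta> = 1"
    from small[OF this, of "1 / 4"] show "emeasure ?V (carleson_tube (1 / 4) \<zeta>) < \<infinity>"
      by (simp add: order_le_less_trans)
  qed simp
  then obtain m where m: "emeasure ?V (ball 0 1) = ennreal m" "m \<ge> 0" by (cases "emeasure ?V (ball 0 1)") auto
  show ?thesis
  proof (rule that[of "C + m * 4 powr e"])
    show "C + m * 4 powr e > 0" using C(1) m(2) by (simp add: add_pos_nonneg)
    fix \<zeta> :: "complex ^ 'n" and R :: real assume \<zeta>: "norm \<zeta> = 1" and R: "0 < R"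
    show "emeasure ?V (carleson_tube R \<zeta>) \<le> ennreal ((C + m * 4 powr e) * R powr (real CARD('n) + 1 + t))"
    proof (cases "R \<le> 1 / 4")
      case True
      have "C * R powr e \<le> (C + m * 4 powr e) * R powr e" using m by (intro mult_right_mono) auto
      thus ?thesis using order_trans[OF small[OF \<zeta> R True] ennreal_leI] by (simp add: e_def)
    next
      case False
      have "emeasure ?V (carleson_tube R \<zeta>) \<le> emeasure ?V (ball 0 1)"
        by (intro emeasure_mono sub borel_measure_on_ball_sets(2)[OF borel_measure_on_ball_weighted_volume]) auto
      also have "\<dots> = ennreal m" by (rule m)
      also have "m \<le> (C + m * 4 powr e) * R powr e"
      proof -
        have "1 \<le> (4 * R) powr e" using False e by (intro ge_one_powr_ge_zero) auto
        hence "1 \<le> 4 powr e * R powr e" by (simp only: powr_mult)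
        hence "m * 1 \<le> m * (4 powr e * R powr e)" using m by (intro mult_left_mono) auto
        also have "\<dots> \<le> (C + m * 4 powr e) * R powr e" using C(1) by (simp add: algebra_simps)
        finally show ?thesis by simp
      qed
      finally show ?thesis by (simp add: e_def ennreal_leI)
    qed
  qed (fact fin)
qed

lemma tube_scale:
  fixes d r :: real
  assumes "r > 0" "x \<ge> r" "x \<ge> d / 2"
  obtains k :: nat where "d < 2 ^ k * r" "2 ^ k * r / 4 \<le> x"
proof -
  obtain k0 where "d / r < 2 ^ k0" using real_arch_pow[of 2 "d / r"] by auto
  hence ex: "\<exists>k. d < 2 ^ k * r" using assms by (auto simp: field_simps)
  define k where "k = (LEAST k. d < 2 ^ k * r)"
  have k: "d < 2 ^ k * r" unfolding k_def using ex by (rule LeastI_ex)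
  have "2 ^ k * r / 4 \<le> x"
  proof (cases k)
    case 0
    thus ?thesis using assms by simp
  next
    case (Suc k')
    have "\<not> d < 2 ^ k' * r" using not_less_Least[of k' "\<lambda>k. d < 2 ^ k * r"] Suc by (simp add: k_def)
    hence "2 ^ k' * r \<le> 2 * x" using assms(3) by linarith
    thus ?thesis using Suc by (simp add: field_simps)
  qed
  thus ?thesis using that k by blast
qed

text \<open>
  With \<open>a = (1 - r) \<zeta>\<close>, the modulus of \<open>1 - \<langle>z, a\<rangle>\<close> is at least \<open>r\<close> and at least half of
  \<open>|1 - \<langle>z, \<zeta>\<rangle>|\<close>. So on the tube of radius \<open>2^k r\<close> minus the preceding one it is at least of order
  \<open>2^k r\<close>, and the tubes contribute a geometric series that converges because \<open>q > n + 1 + t\<close>.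
\<close>

proposition forelli_rudin_upper:
  fixes t q :: real
  assumes t: "t > -1" and q: "q > real CARD('n) + 1 + t"
  obtains C where "C > 0" "\<And>(\<zeta> :: complex ^ 'n) r. norm \<zeta> = 1 \<Longrightarrow> 0 < r \<Longrightarrow> r < 1 \<Longrightarrow>
      (\<integral>\<^sup>+ z. ennreal (cmod (1 - hermitian_inner z ((1 - r) *\<^sub>R \<zeta>)) powr (- q)) \<partial>weighted_volume t)
        \<le> ennreal (C * r powr (real CARD('n) + 1 + t - q))"
proof -
  define e where "e = real CARD('n) + 1 + t"
  let ?V = "weighted_volume t :: (complex ^ 'n) measure"
  obtain C where C: "C > 0" "\<And>(\<zeta> :: complex ^ 'n) R. norm \<zeta> = 1 \<Longrightarrow> 0 < R \<Longrightarrow>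
      emeasure ?V (carleson_tube R \<zeta>) \<le> ennreal (C * R powr (real CARD('n) + 1 + t))"
    by (rule weighted_volume_tubes[OF t, where 'n = 'n]) (rule that)
  define \<theta> where "\<theta> = 2 powr (e - q)"
  have \<theta>: "0 < \<theta>" "\<theta> < 1" using q by (auto simp: \<theta>_def e_def powr_less_one)
  have q0: "q > 0" using q t by simp
  show ?thesis
  proof (rule that[of "4 powr q * C * (1 / (1 - \<theta>))"])
    show "4 powr q * C * (1 / (1 - \<theta>)) > 0" using C \<theta> by simp
    fix \<zeta> :: "complex ^ 'n" and r :: real
    assume \<zeta>: "norm \<zeta> = 1" and r: "0 < r" "r < 1"
    define T where "T k = carleson_tube (2 ^ k * r) \<zeta>" for k :: nat
    have T[measurable]: "T k \<in> sets ?V" for k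
      unfolding T_def by (intro borel_measure_on_ball_sets(2)[OF borel_measure_on_ball_weighted_volume])
        (auto simp: carleson_tube_def)
    define c where "c k = 4 powr q * (2 ^ k * r) powr (- q)" for k :: nat
    have c: "c k \<ge> 0" for k by (simp add: c_def)
    have "(\<integral>\<^sup>+ z. ennreal (cmod (1 - hermitian_inner z ((1 - r) *\<^sub>R \<zeta>)) powr (- q)) \<partial>?V)
      \<le> (\<integral>\<^sup>+ z. (\<Sum>k. ennreal (c k) * indicator (T k) z) \<partial>?V)"
    proof (rule nn_integral_mono)
      fix z assume "z \<in> space ?V"
      hence z: "norm z < 1" by (simp add: weighted_volume_measure)
      define x where "x = cmod (1 - hermitian_inner z ((1 - r) *\<^sub>R \<zeta>))"
      define d where "d = cmod (1 - hermitian_inner z \<zeta>)"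
      have h1: "cmod (hermitian_inner z \<zeta>) \<le> 1" using cmod_hermitian_inner_le[of z \<zeta>] z \<zeta> by simp
      have eq: "hermitian_inner z ((1 - r) *\<^sub>R \<zeta>) = of_real (1 - r) * hermitian_inner z \<zeta>" by (simp only: hermitian_inner_simps)
      have "cmod (hermitian_inner z ((1 - r) *\<^sub>R \<zeta>)) \<le> (1 - r) * 1"
        unfolding eq norm_mult norm_of_real using r h1 by (intro mult_mono) auto
      hence x1: "x \<ge> r" using norm_triangle_ineq2[of 1 "hermitian_inner z ((1 - r) *\<^sub>R \<zeta>)"] by (simp add: x_def)
      have "1 - hermitian_inner z \<zeta> = (1 - hermitian_inner z ((1 - r) *\<^sub>R \<zeta>)) - of_real r * hermitian_inner z \<zeta>"
        unfolding eq by (simp add: algebra_simps)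
      hence "d \<le> x + cmod (of_real r * hermitian_inner z \<zeta>)"
        unfolding d_def x_def by (metis norm_triangle_ineq4)
      also have "cmod (of_real r * hermitian_inner z \<zeta>) \<le> r * 1"
        unfolding norm_mult norm_of_real using r h1 by (intro mult_mono) auto
      finally have "x \<ge> d / 2" using x1 by simp
      then obtain k where k: "d < 2 ^ k * r" "2 ^ k * r / 4 \<le> x" using tube_scale[OF r(1) x1] by metis
      have "x powr (- q) \<le> (2 ^ k * r / 4) powr (- q)" using k r q0 by (intro powr_mono2') auto
      also have "\<dots> = c k" using r by (simp add: c_def powr_divide powr_minus field_simps)
      finally have "ennreal (x powr (- q)) \<le> ennreal (c k) * indicator (T k) z"
        using k z by (simp add: T_def carleson_tube_def d_def ennreal_leI)
      also have "\<dots> \<le> (\<Sum>j. ennreal (c j) * indicator (T j) z)"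
      proof -
        define h where "h j = ennreal (c j) * indicator (T j) z" for j
        have "sum h {k} \<le> suminf h" by (intro sum_le_suminf summableI) auto
        thus ?thesis by (simp add: h_def[abs_def, symmetric] h_def[symmetric])
      qed
      finally show "ennreal (cmod (1 - hermitian_inner z ((1 - r) *\<^sub>R \<zeta>)) powr (- q)) \<le> (\<Sum>k. ennreal (c k) * indicator (T k) z)"
        by (simp add: x_def)
    qed
    also have "\<dots> = (\<Sum>k. ennreal (c k) * emeasure ?V (T k))"
      by (subst nn_integral_suminf) (auto simp: nn_integral_cmult_indicator)
    also have "\<dots> \<le> (\<Sum>k. ennreal (4 powr q * C * r powr (e - q) * \<theta> ^ k))"
    proof (intro suminf_le summableI)
      fix k
      have "ennreal (c k) * emeasure ?V (T k) \<le> ennreal (c k) * ennreal (C * (2 ^ k * r) powr e)"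
        unfolding T_def e_def by (intro mult_left_mono C(2) \<zeta>) (use r in auto)
      also have "\<dots> = ennreal (c k * (C * (2 ^ k * r) powr e))" using c C by (simp add: ennreal_mult)
      also have "c k * (C * (2 ^ k * r) powr e) = 4 powr q * C * ((2 ^ k * r) powr (- q) * (2 ^ k * r) powr e)"
        by (simp add: c_def mult_ac)
      also have "(2 ^ k * r) powr (- q) * (2 ^ k * r) powr e = (2 ^ k * r) powr (e - q)"
        unfolding powr_add[symmetric] by simp
      also have "\<dots> = (2 ^ k) powr (e - q) * r powr (e - q)" by (rule powr_mult)
      also have "(2 ^ k) powr (e - q) = \<theta> ^ k"
        by (simp add: \<theta>_def powr_realpow[symmetric] powr_powr mult.commute)
      finally show "ennreal (c k) * emeasure ?V (T k) \<le> ennreal (4 powr q * C * r powr (e - q) * \<theta> ^ k)"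
        by (simp add: mult_ac)
    qed
    also have "\<dots> = ennreal (4 powr q * C * r powr (e - q) * (1 / (1 - \<theta>)))"
      using \<theta> C by (intro suminf_ennreal_eq sums_mult geometric_sums) auto
    also have "4 powr q * C * r powr (e - q) * (1 / (1 - \<theta>)) = 4 powr q * C * (1 / (1 - \<theta>)) * r powr (real CARD('n) + 1 + t - q)"
      by (simp add: e_def)
    finally show "(\<integral>\<^sup>+ z. ennreal (cmod (1 - hermitian_inner z ((1 - r) *\<^sub>R \<zeta>)) powr (- q)) \<partial>?V)
        \<le> ennreal (4 powr q * C * (1 / (1 - \<theta>)) * r powr (real CARD('n) + 1 + t - q))" .
  qed
qed

text \<open>
  The normalization changes integrals by a positive finite factor, because for \<open>\<alpha> > -1\<close> the total
  mass is finite and positive.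
\<close>

lemma nn_integral_dv_measure:
  fixes \<alpha> :: real
  obtains c where "c > 0" "\<And>F :: complex ^ 'n \<Rightarrow> ennreal. (\<lambda>z. indicator (ball 0 1) z * F z) \<in> borel_measurable borel \<Longrightarrow>
    (\<integral>\<^sup>+ z. F z \<partial>dv_measure \<alpha>) = ennreal c * (\<integral>\<^sup>+ z. F z \<partial>weighted_volume \<alpha>)"
proof (cases "\<alpha> > -1")
  case False
  thus ?thesis using that[of 1] by (simp add: dv_measure_def)
next
  case True
  let ?V = "weighted_volume \<alpha> :: (complex ^ 'n) measure"
  have sp: "space ?V = ball 0 1" by (rule weighted_volume_measure)
  have fin: "emeasure ?V (ball 0 1) < \<infinity>" by (rule weighted_volume_tubes[OF True, where 'n = 'n])
  have "emeasure ?V (ball 0 1) \<noteq> 0"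
  proof
    assume "emeasure ?V (ball 0 1) = 0"
    hence "(\<integral>\<^sup>+ z. indicator (ball 0 1) z * ennreal ((1 - (norm z)\<^sup>2) powr \<alpha>) \<partial>(lborel :: (complex ^ 'n) measure)) = 0"
      by (subst (asm) emeasure_weighted_volume) auto
    moreover have "(\<lambda>z :: complex ^ 'n. indicator (ball 0 1) z * ennreal ((1 - (norm z)\<^sup>2) powr \<alpha>)) \<in> borel_measurable lborel"
      by (intro borel_measurable_times_ennreal borel_measurable_indicator) auto
    ultimately have "AE z in (lborel :: (complex ^ 'n) measure). indicator (ball 0 1) z * ennreal ((1 - (norm z)\<^sup>2) powr \<alpha>) = 0"
      by (subst (asm) nn_integral_0_iff_AE)
    hence "AE z in (lborel :: (complex ^ 'n) measure). z \<notin> ball 0 1"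
      by (rule AE_mp) (auto intro!: AE_I2 simp: indicator_def split: if_splits dest!: one_minus_norm_square_pos)
    hence "ball (0 :: complex ^ 'n) 1 \<in> null_sets lborel" by (subst AE_iff_null_sets) auto
    hence "emeasure lborel (ball (0 :: complex ^ 'n) 1) = 0" by (simp add: null_sets_def)
    thus False using content_ball_pos[of 1 "0 :: complex ^ 'n"] by (simp add: measure_def)
  qed
  then obtain m where m: "emeasure ?V (ball 0 1) = ennreal m" "m > 0"
    using fin by (cases "emeasure ?V (ball 0 1)") auto
  show ?thesis
  proof (rule that[of "1 / m"])
    fix F :: "complex ^ 'n \<Rightarrow> ennreal"
    assume "(\<lambda>z. indicator (ball 0 1) z * F z) \<in> borel_measurable borel"
    hence "F \<in> borel_measurable (restrict_space borel (ball 0 1))"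
      by (subst borel_measurable_restrict_space_iff_ennreal) (auto simp: mult.commute)
    hence "F \<in> borel_measurable ?V" by (subst measurable_cong_sets[OF weighted_volume_measure(1) refl])
    moreover have "dv_measure \<alpha> = scale_measure (inverse (ennreal m)) ?V" using True by (simp add: dv_measure_def sp m)
    moreover have "inverse (ennreal m) = ennreal (1 / m)" using m by (simp add: inverse_ennreal inverse_eq_divide)
    ultimately show "(\<integral>\<^sup>+ z. F z \<partial>dv_measure \<alpha>) = ennreal (1 / m) * (\<integral>\<^sup>+ z. F z \<partial>?V)"
      by (simp add: nn_integral_scale_measure)
  qed (use m in simp)
qed

section \<open>Sufficiency of the tube condition\<close>

lemma ennreal_powr_norm_ge:
  assumes p: "0 < p" and a: "a \<ge> 0"
  shows "ennreal (a powr p) \<le> ennreal_powr (ennreal a + ennreal_powr I (1 / p)) p"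
    and "I \<le> ennreal_powr (ennreal a + ennreal_powr I (1 / p)) p"
proof -
  have "ennreal (a powr p) \<le> ennreal_powr (ennreal a + ennreal_powr I (1 / p)) p \<and>
    I \<le> ennreal_powr (ennreal a + ennreal_powr I (1 / p)) p"
  proof (cases I)
    case (real i)
    have "ennreal_powr (ennreal a + ennreal_powr I (1 / p)) p = ennreal ((a + i powr (1 / p)) powr p)"
      using real a by (simp add: ennreal_powr_def ennreal_plus[symmetric] del: ennreal_plus)
    moreover have "a powr p \<le> (a + i powr (1 / p)) powr p" using p a by (intro powr_mono2) auto
    moreover have "i \<le> (a + i powr (1 / p)) powr p"
    proof -
      have "i = (i powr (1 / p)) powr p" using real p by (simp add: powr_powr)
      also have "\<dots> \<le> (a + i powr (1 / p)) powr p" using p a by (intro powr_mono2) auto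
      finally show ?thesis .
    qed
    ultimately show ?thesis using real by (auto intro: ennreal_leI)
  next
    case top
    thus ?thesis by (simp add: ennreal_powr_def)
  qed
  thus "ennreal (a powr p) \<le> ennreal_powr (ennreal a + ennreal_powr I (1 / p)) p"
    "I \<le> ennreal_powr (ennreal a + ennreal_powr I (1 / p)) p" by auto
qed

lemma ennreal_powr_norm_le:
  assumes p: "0 < p" "p \<le> 1" and a: "a \<ge> 0" and i: "i \<ge> 0"
  shows "ennreal_powr (ennreal a + ennreal_powr (ennreal i) (1 / p)) p \<le> ennreal (a powr p + i)"
proof -
  have "ennreal_powr (ennreal a + ennreal_powr (ennreal i) (1 / p)) p = ennreal ((a + i powr (1 / p)) powr p)"
    using i a by (simp add: ennreal_powr_def ennreal_plus[symmetric] del: ennreal_plus)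
  also have "(a + i powr (1 / p)) powr p \<le> a powr p + (i powr (1 / p)) powr p"
    using p a by (intro add_powr_le) auto
  hence "ennreal ((a + i powr (1 / p)) powr p) \<le> ennreal (a powr p + i)"
    using p i by (intro ennreal_leI) (simp add: powr_powr)
  finally show ?thesis .
qed

lemma measurable_on_ball:
  fixes g :: "complex ^ 'n \<Rightarrow> complex"
  assumes g: "holomorphic_vec_on g (ball 0 1)"
  shows "(\<lambda>z. indicator (ball 0 1) z * ennreal ((1 - (norm z)\<^sup>2) powr s * cmod (g z) powr p)) \<in> borel_measurable borel"
proof -
  have [measurable]: "(\<lambda>z. if z \<in> ball 0 1 then g z else 0) \<in> borel_measurable borel"
    using holomorphic_vec_on_imp_continuous_on[OF g] by (intro borel_measurable_continuous_on_if) auto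
  have [measurable]: "ball (0 :: complex ^ 'n) 1 \<in> sets borel" by (intro borel_open) simp
  have "(\<lambda>z. indicator (ball 0 1) z * ennreal ((1 - (norm z)\<^sup>2) powr s * cmod (if z \<in> ball 0 1 then g z else 0) powr p)) \<in> borel_measurable borel"
    by measurable
  also have "(\<lambda>z. indicator (ball 0 1) z * ennreal ((1 - (norm z)\<^sup>2) powr s * cmod (if z \<in> ball 0 1 then g z else 0) powr p))
    = (\<lambda>z. indicator (ball 0 1) z * ennreal ((1 - (norm z)\<^sup>2) powr s * cmod (g z) powr p))"
    by (auto simp: fun_eq_iff indicator_def)
  finally show ?thesis .
qed

lemma weighted_integral_dv_measure:
  fixes \<alpha> p :: real
  obtains c where "c > 0" "\<And>(g :: complex ^ 'n \<Rightarrow> complex) s. holomorphic_vec_on g (ball 0 1) \<Longrightarrow>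
    (\<integral>\<^sup>+ z. ennreal ((1 - (norm z)\<^sup>2) powr s * cmod (g z) powr p) \<partial>dv_measure \<alpha>)
      = ennreal c * (\<integral>\<^sup>+ z. indicator (ball 0 1) z * ennreal ((1 - (norm z)\<^sup>2) powr (s + \<alpha>) * cmod (g z) powr p) \<partial>lborel)"
proof -
  obtain c where c: "c > 0" "\<And>F :: complex ^ 'n \<Rightarrow> ennreal. (\<lambda>z. indicator (ball 0 1) z * F z) \<in> borel_measurable borel \<Longrightarrow>
    (\<integral>\<^sup>+ z. F z \<partial>dv_measure \<alpha>) = ennreal c * (\<integral>\<^sup>+ z. F z \<partial>weighted_volume \<alpha>)"
    by (rule nn_integral_dv_measure[where 'n = 'n and \<alpha> = \<alpha>]) (rule that)
  show ?thesis
  proof (rule that[OF c(1)])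
    fix g :: "complex ^ 'n \<Rightarrow> complex" and s assume g: "holomorphic_vec_on g (ball 0 1)"
    note m = measurable_on_ball[OF g, of s p]
    show "(\<integral>\<^sup>+ z. ennreal ((1 - (norm z)\<^sup>2) powr s * cmod (g z) powr p) \<partial>dv_measure \<alpha>)
      = ennreal c * (\<integral>\<^sup>+ z. indicator (ball 0 1) z * ennreal ((1 - (norm z)\<^sup>2) powr (s + \<alpha>) * cmod (g z) powr p) \<partial>lborel)"
      unfolding c(2)[OF m] nn_integral_weighted_volume[OF m]
      by (intro arg_cong2[where f = "(*)"] refl nn_integral_cong)
        (simp add: ennreal_mult[symmetric] powr_add mult_ac)
  qed
qed

text \<open>
  For \<open>r \<ge> 1\<close> the bound holds because the total mass is finite and the exponent is positive.
\<close>

lemma tube_bound_all_radii: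
  fixes \<mu> :: "(complex ^ 'n) measure"
  assumes \<mu>: "borel_measure_on_ball \<mu>" and e: "e > 0"
    and b: "\<And>\<zeta> r. norm \<zeta> = 1 \<Longrightarrow> 0 < r \<Longrightarrow> r < 1 \<Longrightarrow> emeasure \<mu> (carleson_tube r \<zeta>) \<le> ennreal (C0 * r powr e)"
  obtains C where "C > 0" "emeasure \<mu> (ball 0 1) \<le> ennreal C"
    "\<And>\<zeta> r. norm \<zeta> = 1 \<Longrightarrow> 0 < r \<Longrightarrow> emeasure \<mu> (carleson_tube r \<zeta>) \<le> ennreal (C * r powr e)"
proof -
  have "emeasure \<mu> (ball 0 1) < \<infinity>"
  proof (rule finite_of_finite_on_tubes[OF \<mu>, of "1 / 2"])
    fix \<zeta> :: "complex ^ 'n" assume "norm \<zeta> = 1"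
    from b[OF this, of "1 / 2"] show "emeasure \<mu> (carleson_tube (1 / 2) \<zeta>) < \<infinity>"
      by (simp add: order_le_less_trans)
  qed simp
  then obtain m where m: "emeasure \<mu> (ball 0 1) = ennreal m" "m \<ge> 0" by (cases "emeasure \<mu> (ball 0 1)") auto
  define C where "C = \<bar>C0\<bar> + m + 1"
  have C: "C > 0" "C0 \<le> C" "m \<le> C" using m by (auto simp: C_def)
  show ?thesis
  proof (rule that[OF C(1)])
    show "emeasure \<mu> (ball 0 1) \<le> ennreal C" using m C by (simp add: ennreal_leI)
    fix \<zeta> :: "complex ^ 'n" and r :: real assume \<zeta>: "norm \<zeta> = 1" and r: "0 < r"
    show "emeasure \<mu> (carleson_tube r \<zeta>) \<le> ennreal (C * r powr e)"
    proof (cases "r < 1")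
      case True
      have "C0 * r powr e \<le> C * r powr e" using C by (intro mult_right_mono) auto
      thus ?thesis using order_trans[OF b[OF \<zeta> r True] ennreal_leI] by simp
    next
      case False
      have "emeasure \<mu> (carleson_tube r \<zeta>) \<le> emeasure \<mu> (ball 0 1)"
        by (intro emeasure_mono borel_measure_on_ball_sets(2)[OF \<mu>]) (auto simp: carleson_tube_def)
      also have "\<dots> = ennreal m" by (rule m)
      also have "m * 1 \<le> C * r powr e"
        using C m False e by (intro mult_mono ge_one_powr_ge_zero) auto
      hence "ennreal m \<le> ennreal (C * r powr e)" by (intro ennreal_leI) simp
      finally show ?thesis .
    qed
  qed
qed

text \<open>
  The tube must be centred at a boundary point, so \<open>w\<close> is replaced by its projection \<open>\<omega>\<close> to the sphere.
  This costs at most \<open>1 - |w|\<close> on top of the constant 8.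
\<close>

lemma approach_region_shadow:
  fixes w :: "complex ^ 'n"
  assumes w: "norm w < 1" and \<omega>: "norm \<omega> = 1" "w = norm w *\<^sub>R \<omega>"
  shows "{z \<in> ball 0 1. w \<in> approach_region z} \<subseteq> carleson_tube (10 * (1 - (norm w)\<^sup>2)) \<omega>"
proof clarify
  fix z :: "complex ^ 'n" assume z: "z \<in> ball 0 1" and "w \<in> approach_region z"
  hence r: "cmod (1 - hermitian_inner z w) \<le> 8 * (1 - (norm w)\<^sup>2)" by (simp add: approach_region_def)
  have s: "0 < 1 - (norm w)\<^sup>2" using w by (rule one_minus_norm_square_pos)
  have "hermitian_inner z w = of_real (norm w) * hermitian_inner z \<omega>"
    by (subst \<omega>(2)) (simp only: hermitian_inner_simps)
  hence "1 - hermitian_inner z \<omega> = (1 - hermitian_inner z w) - of_real (1 - norm w) * hermitian_inner z \<omega>"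
    by (simp add: algebra_simps)
  hence "cmod (1 - hermitian_inner z \<omega>) \<le> cmod (1 - hermitian_inner z w) + cmod (of_real (1 - norm w) * hermitian_inner z \<omega>)"
    by (metis norm_triangle_ineq4)
  also have "cmod (of_real (1 - norm w) * hermitian_inner z \<omega>) \<le> (1 - norm w) * 1"
    unfolding norm_mult norm_of_real using w z \<omega>(1) cmod_hermitian_inner_le[of z \<omega>]
    by (intro mult_mono) auto
  also have "(1 - norm w) * 1 \<le> (1 - norm w) * (1 + norm w)" using w by (intro mult_left_mono) auto
  also have "\<dots> = 1 - (norm w)\<^sup>2" by (simp add: power2_eq_square algebra_simps)
  finally show "z \<in> carleson_tube (10 * (1 - (norm w)\<^sup>2)) \<omega>"
    using r s z by (simp add: carleson_tube_def)
qed

text \<open>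
  The constants come from three places: the pointwise estimate, the tube condition for all radii (which
  also bounds the total mass, hence the contribution of \<open>f(0)\<close>), and the normalization of the volume.
\<close>

proposition carleson_embedding:
  fixes p \<alpha> :: real and \<mu> :: "(complex ^ 'n) measure"
  assumes \<alpha>: "\<alpha> > - (real CARD('n) + 1)" and p: "0 < p" "p \<le> 1" and \<mu>: "borel_measure_on_ball \<mu>"
    and b: "\<And>\<zeta> r. norm \<zeta> = 1 \<Longrightarrow> 0 < r \<Longrightarrow> r < 1 \<Longrightarrow>
      emeasure \<mu> (carleson_tube r \<zeta>) \<le> ennreal (C0 * r powr (real CARD('n) + 1 + \<alpha>))"
  obtains C where "C > 0" "\<And>f. holomorphic_vec_on f (ball 0 1) \<Longrightarrow>
    (\<integral>\<^sup>+ w. ennreal (cmod (f w) powr p) \<partial>\<mu>) \<le> ennreal C * ennreal_powr (bergman_norm p \<alpha> f) p"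
proof -
  define N where "N = bergman_order p \<alpha>"
  define e where "e = real CARD('n) + 1 + \<alpha>"
  have e: "e > 0" using \<alpha> by (simp add: e_def)
  note S = borel_measure_on_ball_sets[OF \<mu>]
  obtain Cm where Cm: "Cm > 0" "emeasure \<mu> (ball 0 1) \<le> ennreal Cm"
    "\<And>\<zeta> r. norm \<zeta> = 1 \<Longrightarrow> 0 < r \<Longrightarrow> emeasure \<mu> (carleson_tube r \<zeta>) \<le> ennreal (Cm * r powr e)"
    by (rule tube_bound_all_radii[OF \<mu> e]) (use b that in \<open>auto simp: e_def\<close>)
  obtain Cp where Cp: "Cp > 0" and pw: "\<And>(f :: complex ^ 'n \<Rightarrow> complex) z. holomorphic_vec_on f (ball 0 1) \<Longrightarrow> norm z < 1 \<Longrightarrow>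
      ennreal (cmod (f z) powr p) \<le> ennreal Cp * (ennreal (cmod (f 0) powr p) +
        (\<integral>\<^sup>+ w. indicator (approach_region z) w *
          ennreal ((1 - (norm w)\<^sup>2) powr (p * real N - real (CARD('n) + 1)) * cmod ((radial_deriv ^^ N) f w) powr p) \<partial>lborel))"
    by (rule pointwise_area_estimate[OF p, where 'n = 'n and N = N]) (rule that)
  obtain c where c: "c > 0" and dv: "\<And>(g :: complex ^ 'n \<Rightarrow> complex) s. holomorphic_vec_on g (ball 0 1) \<Longrightarrow>
    (\<integral>\<^sup>+ z. ennreal ((1 - (norm z)\<^sup>2) powr s * cmod (g z) powr p) \<partial>dv_measure \<alpha>)
      = ennreal c * (\<integral>\<^sup>+ z. indicator (ball 0 1) z * ennreal ((1 - (norm z)\<^sup>2) powr (s + \<alpha>) * cmod (g z) powr p) \<partial>lborel)"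
    by (rule weighted_integral_dv_measure[where 'n = 'n and \<alpha> = \<alpha> and p = p]) (rule that)
  interpret finite_measure \<mu>
    using Cm(2) by (intro finite_measureI) (auto simp: S(1) top_unique)
  interpret pair_sigma_finite \<mu> "lborel :: (complex ^ 'n) measure" ..
  define K where "K = Cm * 10 powr e"
  have K: "K > 0" using Cm by (simp add: K_def)
  show ?thesis
  proof (rule that[of "Cp * Cm + Cp * K / c"])
    show "Cp * Cm + Cp * K / c > 0" using Cp Cm K c by (simp add: add_pos_pos)
    fix f :: "complex ^ 'n \<Rightarrow> complex" assume f: "holomorphic_vec_on f (ball 0 1)"
    define g where "g = (radial_deriv ^^ N) f"
    have g: "holomorphic_vec_on g (ball 0 1)"
      unfolding g_def by (rule holomorphic_vec_on_radial_deriv_iterate[OF f open_ball])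
    define H where "H w = indicator (ball 0 1) w * ennreal ((1 - (norm w)\<^sup>2) powr (p * real N - real (CARD('n) + 1)) * cmod (g w) powr p)" for w
    have [measurable]: "H \<in> borel_measurable borel" unfolding H_def by (rule measurable_on_ball[OF g])
    define \<Gamma> where "\<Gamma> = {x. cmod (1 - hermitian_inner (fst x) (snd x)) \<le> 8 * (1 - (norm (snd x :: complex ^ 'n))\<^sup>2)}"
    have "closed \<Gamma>" unfolding \<Gamma>_def by (intro closed_Collect_le continuous_intros)
    hence \<Gamma>_borel: "\<Gamma> \<in> sets (borel \<Otimes>\<^sub>M borel)" unfolding borel_prod by (rule borel_closed)
    have id_meas: "(\<lambda>x. x) \<in> \<mu> \<rightarrow>\<^sub>M borel"
      using \<mu> by (subst measurable_cong_sets[of \<mu> "restrict_space borel (ball 0 1)", OF _ refl])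
        (auto simp: borel_measure_on_ball_def intro!: measurable_restrict_space1)
    have [measurable]: "(\<lambda>x. (fst x, snd x)) \<in> \<mu> \<Otimes>\<^sub>M lborel \<rightarrow>\<^sub>M borel \<Otimes>\<^sub>M borel"
      using measurable_compose[OF measurable_fst id_meas] by measurable
    have "(indicator \<Gamma> :: _ \<Rightarrow> ennreal) \<in> borel_measurable (borel \<Otimes>\<^sub>M borel)" using \<Gamma>_borel by simp
    hence ind_meas: "(\<lambda>x. indicator \<Gamma> (fst x, snd x) :: ennreal) \<in> borel_measurable (\<mu> \<Otimes>\<^sub>M lborel)"
      by (rule measurable_compose[rotated]) measurable
    have [measurable]: "(\<lambda>(z, w). indicator \<Gamma> (z, w) * H w) \<in> borel_measurable (\<mu> \<Otimes>\<^sub>M lborel)"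
      unfolding case_prod_unfold by (intro borel_measurable_times_ennreal ind_meas) measurable
    define J where "J = (\<integral>\<^sup>+ w. indicator (ball 0 1) w * ennreal ((1 - (norm w)\<^sup>2) powr (p * real N + \<alpha>) * cmod (g w) powr p) \<partial>lborel)"
    define I where "I = (\<integral>\<^sup>+ z. ennreal ((1 - (norm z)\<^sup>2) powr (p * real N) * cmod (g z) powr p) \<partial>dv_measure \<alpha>)"
    have IJ: "I = ennreal c * J" unfolding I_def J_def by (rule dv[OF g])
    have JI: "J = ennreal (1 / c) * I" unfolding IJ using c by (simp add: mult.assoc[symmetric] ennreal_mult[symmetric])
    \<comment> \<open>Tonelli's theorem; this is where the tube condition enters.\<close>
    have double: "(\<integral>\<^sup>+ z. (\<integral>\<^sup>+ w. indicator \<Gamma> (z, w) * H w \<partial>lborel) \<partial>\<mu>) \<le> ennreal K * J"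
    proof -
      have "(\<integral>\<^sup>+ z. (\<integral>\<^sup>+ w. indicator \<Gamma> (z, w) * H w \<partial>lborel) \<partial>\<mu>) = (\<integral>\<^sup>+ w. (\<integral>\<^sup>+ z. indicator \<Gamma> (z, w) * H w \<partial>\<mu>) \<partial>lborel)"
        by (rule Fubini'[symmetric]) measurable
      also have "\<dots> \<le> (\<integral>\<^sup>+ w. ennreal K * (indicator (ball 0 1) w * ennreal ((1 - (norm w)\<^sup>2) powr (p * real N + \<alpha>) * cmod (g w) powr p)) \<partial>lborel)"
      proof (rule nn_integral_mono)
        fix w :: "complex ^ 'n"
        show "(\<integral>\<^sup>+ z. indicator \<Gamma> (z, w) * H w \<partial>\<mu>) \<le> ennreal K * (indicator (ball 0 1) w * ennreal ((1 - (norm w)\<^sup>2) powr (p * real N + \<alpha>) * cmod (g w) powr p))"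
        proof (cases "norm w < 1")
          case True
          define s where "s = 1 - (norm w)\<^sup>2"
          have s: "s > 0" unfolding s_def using True by (rule one_minus_norm_square_pos)
          obtain \<omega> where \<omega>: "norm \<omega> = 1" "w = norm w *\<^sub>R \<omega>" using polar_form by metis
          have T: "carleson_tube (10 * s) \<omega> \<in> sets \<mu>" by (intro S(2)) (auto simp: carleson_tube_def)
          have "(\<integral>\<^sup>+ z. indicator \<Gamma> (z, w) * H w \<partial>\<mu>) \<le> (\<integral>\<^sup>+ z. H w * indicator (carleson_tube (10 * s) \<omega>) z \<partial>\<mu>)"
          proof (rule nn_integral_mono)
            fix z assume "z \<in> space \<mu>"
            thus "indicator \<Gamma> (z, w) * H w \<le> H w * indicator (carleson_tube (10 * s) \<omega>) z"
              using approach_region_shadow[OF True \<omega>] True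
              by (auto simp: indicator_def \<Gamma>_def S(1) approach_region_def s_def)
          qed
          also have "\<dots> = H w * emeasure \<mu> (carleson_tube (10 * s) \<omega>)" by (rule nn_integral_cmult_indicator[OF T])
          also have "\<dots> \<le> H w * ennreal (Cm * (10 * s) powr e)" by (intro mult_left_mono Cm(3) \<omega>) (use s in auto)
          also have "\<dots> = ennreal (s powr (p * real N - real (CARD('n) + 1)) * cmod (g w) powr p * (Cm * (10 * s) powr e))"
            using True Cm(1) by (simp add: H_def s_def ennreal_mult)
          also have "s powr (p * real N - real (CARD('n) + 1)) * cmod (g w) powr p * (Cm * (10 * s) powr e)
            = K * (s powr (p * real N + \<alpha>) * cmod (g w) powr p)"
          proof -
            have 1: "(10 * s) powr e = 10 powr e * s powr e" by (rule powr_mult)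
            have 2: "s powr (p * real N - real (CARD('n) + 1)) * s powr e = s powr (p * real N + \<alpha>)"
              unfolding powr_add[symmetric] by (simp add: e_def)
            show ?thesis unfolding K_def 1 2[symmetric] by (simp only: mult_ac)
          qed
          also have "ennreal (K * (s powr (p * real N + \<alpha>) * cmod (g w) powr p)) = ennreal K * ennreal (s powr (p * real N + \<alpha>) * cmod (g w) powr p)"
            using K by (simp add: ennreal_mult)
          finally show ?thesis using True by (simp add: s_def)
        next
          case False
          hence "H w = 0" by (simp add: H_def)
          thus ?thesis by simp
        qed
      qed
      also have "\<dots> = ennreal K * J" unfolding J_def
        by (rule nn_integral_cmult) (use measurable_on_ball[OF g] in simp)
      finally show ?thesis .
    qed
    define B where "B = ennreal_powr (bergman_norm p \<alpha> f) p"
    have B: "ennreal (cmod (f 0) powr p) \<le> B" "I \<le> B"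
      using ennreal_powr_norm_ge[OF p(1), of "cmod (f 0)" I]
      by (auto simp: B_def bergman_norm_def Let_def I_def g_def N_def)
    have "(\<integral>\<^sup>+ z. ennreal (cmod (f z) powr p) \<partial>\<mu>)
      \<le> (\<integral>\<^sup>+ z. ennreal Cp * (ennreal (cmod (f 0) powr p) + (\<integral>\<^sup>+ w. indicator \<Gamma> (z, w) * H w \<partial>lborel)) \<partial>\<mu>)"
    proof (rule nn_integral_mono)
      fix z assume "z \<in> space \<mu>"
      hence z: "norm z < 1" by (simp add: S(1))
      have "(\<integral>\<^sup>+ w. indicator (approach_region z) w *
          ennreal ((1 - (norm w)\<^sup>2) powr (p * real N - real (CARD('n) + 1)) * cmod ((radial_deriv ^^ N) f w) powr p) \<partial>lborel)
        = (\<integral>\<^sup>+ w. indicator \<Gamma> (z, w) * H w \<partial>lborel)"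
        by (intro nn_integral_cong) (auto simp: indicator_def \<Gamma>_def H_def g_def approach_region_def)
      thus "ennreal (cmod (f z) powr p) \<le> ennreal Cp * (ennreal (cmod (f 0) powr p) + (\<integral>\<^sup>+ w. indicator \<Gamma> (z, w) * H w \<partial>lborel))"
        using pw[OF f z] by simp
    qed
    also have "\<dots> = ennreal Cp * (ennreal (cmod (f 0) powr p) * emeasure \<mu> (ball 0 1) + (\<integral>\<^sup>+ z. (\<integral>\<^sup>+ w. indicator \<Gamma> (z, w) * H w \<partial>lborel) \<partial>\<mu>))"
    proof -
      have [measurable]: "(\<lambda>z. \<integral>\<^sup>+ w. indicator \<Gamma> (z, w) * H w \<partial>lborel) \<in> borel_measurable \<mu>"
        by (rule lborel.borel_measurable_nn_integral) measurable
      show ?thesis by (subst nn_integral_cmult, measurable) (subst nn_integral_add, auto simp: S(1))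
    qed
    also have "\<dots> \<le> ennreal Cp * (B * ennreal Cm + ennreal K * (ennreal (1 / c) * B))"
      using B Cm(2) double unfolding JI
      by (intro mult_left_mono add_mono mult_mono order_trans[OF double[unfolded JI]]) auto
    also have "\<dots> = ennreal (Cp * Cm + Cp * K / c) * B"
    proof -
      have "ennreal (Cp * Cm + Cp * K / c) = ennreal Cp * ennreal Cm + ennreal Cp * ennreal K * ennreal (1 / c)"
        using Cp Cm(1) K c by (simp add: ennreal_mult[symmetric])
      thus ?thesis by (simp add: distrib_left distrib_right mult_ac)
    qed
    finally show "(\<integral>\<^sup>+ w. ennreal (cmod (f w) powr p) \<partial>\<mu>) \<le> ennreal (Cp * Cm + Cp * K / c) * ennreal_powr (bergman_norm p \<alpha> f) p"
      by (simp add: B_def)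
  qed
qed

section \<open>Necessity of the tube condition\<close>

lemma hermitian_inner_ne_1:
  fixes z a :: "complex ^ 'n"
  assumes "norm z < 1" "norm a \<le> 1"
  shows "hermitian_inner z a \<noteq> 1" "cmod (1 - hermitian_inner z a) \<le> 2"
proof -
  have "cmod (hermitian_inner z a) \<le> norm z * norm a" by (rule cmod_hermitian_inner_le)
  also have "\<dots> \<le> norm z * 1" using assms by (intro mult_left_mono) auto
  finally have *: "cmod (hermitian_inner z a) < 1" using assms by simp
  thus "hermitian_inner z a \<noteq> 1" by auto
  show "cmod (1 - hermitian_inner z a) \<le> 2"
    using * norm_triangle_ineq4[of 1 "hermitian_inner z a"] by simp
qed

text \<open>
  The radial derivative acts on functions of \<open>y = 1 / (1 - \<langle>z, a\<rangle>)\<close> as \<open>(y^2 - y) d/dy\<close>. Its iterates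
  on \<open>y^s\<close> are polynomials in \<open>y\<close> that do not depend on \<open>a\<close>, which makes the estimates uniform in \<open>a\<close>.
\<close>

primrec kernel_poly :: "nat \<Rightarrow> nat \<Rightarrow> complex poly" where
  "kernel_poly s 0 = monom 1 s"
| "kernel_poly s (Suc k) = [:0, -1, 1:] * pderiv (kernel_poly s k)"

lemma degree_kernel_poly: "degree (kernel_poly s k) \<le> s + k"
proof (induction k)
  case 0
  show ?case by (simp add: degree_monom_le)
next
  case (Suc k)
  show ?case
  proof (cases "degree (kernel_poly s k) = 0")
    case True
    hence "pderiv (kernel_poly s k) = 0" by (simp add: pderiv_eq_0_iff)
    thus ?thesis by simp
  next
    case False
    have "degree (kernel_poly s (Suc k)) \<le> degree [:0, -1, 1 :: complex:] + degree (pderiv (kernel_poly s k))"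
      unfolding kernel_poly.simps by (rule degree_mult_le)
    also have "\<dots> = 2 + (degree (kernel_poly s k) - 1)" by (simp add: degree_pderiv)
    also have "\<dots> \<le> s + Suc k" using False Suc by simp
    finally show ?thesis .
  qed
qed

lemma has_field_derivative_poly_kernel:
  fixes u :: complex
  assumes "u \<noteq> 1"
  shows "((\<lambda>u. poly q (1 / (1 - u))) has_field_derivative poly (pderiv q) (1 / (1 - u)) * (1 / (1 - u))\<^sup>2) (at u)"
proof -
  have "((\<lambda>u :: complex. 1 / (1 - u)) has_field_derivative (1 / (1 - u))\<^sup>2) (at u)"
    using assms by (auto intro!: derivative_eq_intros simp: power2_eq_square)
  from DERIV_chain'[OF this poly_DERIV] show ?thesis by (simp add: mult.commute)
qed

lemma radial_deriv_iterate_kernel: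
  fixes a :: "complex ^ 'n"
  assumes a: "norm a \<le> 1"
  shows "holomorphic_vec_on (\<lambda>z. poly q (1 / (1 - hermitian_inner z a))) (ball 0 1)"
    and "norm z < 1 \<Longrightarrow> (radial_deriv ^^ k) (\<lambda>z. poly (kernel_poly s 0) (1 / (1 - hermitian_inner z a))) z
      = poly (kernel_poly s k) (1 / (1 - hermitian_inner z a))"
proof -
  have D: "((\<lambda>u. poly q (1 / (1 - u))) has_field_derivative
      poly (pderiv q) (1 / (1 - hermitian_inner z a)) * (1 / (1 - hermitian_inner z a))\<^sup>2) (at (hermitian_inner z a))"
    if "norm z < 1" for z and q :: "complex poly"
    by (rule has_field_derivative_poly_kernel[OF hermitian_inner_ne_1(1)[OF that a]])
  have hol: "holomorphic_vec_on (\<lambda>z. poly q (1 / (1 - hermitian_inner z a))) (ball 0 1)" for q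
    by (rule holomorphic_vec_on_compose_hermitian_inner[where F' = "\<lambda>u. poly (pderiv q) (1 / (1 - u)) * (1 / (1 - u))\<^sup>2"])
      (use D in auto)
  thus "holomorphic_vec_on (\<lambda>z. poly q (1 / (1 - hermitian_inner z a))) (ball 0 1)" .
  show "(radial_deriv ^^ k) (\<lambda>z. poly (kernel_poly s 0) (1 / (1 - hermitian_inner z a))) z
      = poly (kernel_poly s k) (1 / (1 - hermitian_inner z a))" if "norm z < 1"
    using that
  proof (induction k arbitrary: z)
    case (Suc k)
    let ?u = "hermitian_inner z a"
    have "(radial_deriv ^^ Suc k) (\<lambda>z. poly (kernel_poly s 0) (1 / (1 - hermitian_inner z a))) z
      = radial_deriv (\<lambda>z. poly (kernel_poly s k) (1 / (1 - hermitian_inner z a))) z"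
      unfolding funpow.simps comp_apply
      by (rule radial_deriv_cong[OF open_ball, of _ 0 1]) (use Suc hol in auto)
    also have "\<dots> = ?u * (poly (pderiv (kernel_poly s k)) (1 / (1 - ?u)) * (1 / (1 - ?u))\<^sup>2)"
      by (rule radial_deriv_compose_hermitian_inner[OF D[OF Suc.prems]])
    also have "\<dots> = (?u * (1 / (1 - ?u))\<^sup>2) * poly (pderiv (kernel_poly s k)) (1 / (1 - ?u))" by simp
    also have "?u * (1 / (1 - ?u))\<^sup>2 = (1 / (1 - ?u))\<^sup>2 - 1 / (1 - ?u)"
    proof -
      define v where "v = 1 - ?u"
      have v: "v \<noteq> 0" using hermitian_inner_ne_1(1)[OF Suc.prems a] by (simp add: v_def)
      have "v * (1 / v)\<^sup>2 = 1 / v" using v by (simp add: power2_eq_square)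
      moreover have "?u = 1 - v" by (simp add: v_def)
      ultimately show ?thesis by (simp add: left_diff_distrib)
    qed
    also have "\<dots> * poly (pderiv (kernel_poly s k)) (1 / (1 - ?u)) = poly (kernel_poly s (Suc k)) (1 / (1 - ?u))"
      by (simp add: power2_eq_square algebra_simps)
    finally show ?case .
  qed simp
qed

lemma poly_norm_bound:
  fixes q :: "complex poly"
  assumes "degree q \<le> d"
  obtains B where "B > 0" "\<And>y. cmod y \<ge> 1 / 2 \<Longrightarrow> cmod (poly q y) \<le> B * cmod y ^ d"
proof -
  define B where "B = 2 ^ d * (\<Sum>i\<le>degree q. cmod (coeff q i)) + 1"
  have sum0: "(\<Sum>i\<le>degree q. cmod (coeff q i)) \<ge> 0" by (intro sum_nonneg) auto
  show ?thesis
  proof (rule that[of B])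
    show "B > 0" unfolding B_def using sum0 by (intro add_nonneg_pos mult_nonneg_nonneg) auto
    fix y :: complex assume y: "cmod y \<ge> 1 / 2"
    have pw: "cmod y ^ i \<le> 2 ^ d * cmod y ^ d" if "i \<le> d" for i
    proof -
      have "cmod y ^ i \<le> 2 ^ i * cmod y ^ i" by (simp add: mult_right_le_one_le mult_le_cancel_right1)
      also have "\<dots> = (2 * cmod y) ^ i" by (simp add: power_mult_distrib)
      also have "\<dots> \<le> (2 * cmod y) ^ d" using y that by (intro power_increasing) auto
      finally show ?thesis by (simp add: power_mult_distrib)
    qed
    have "poly q y = (\<Sum>i\<le>degree q. coeff q i * y ^ i)" by (rule poly_altdef)
    hence "cmod (poly q y) \<le> (\<Sum>i\<le>degree q. cmod (coeff q i) * cmod y ^ i)"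
      by (simp add: sum_norm_le norm_mult norm_power)
    also have "\<dots> \<le> (\<Sum>i\<le>degree q. cmod (coeff q i) * (2 ^ d * cmod y ^ d))"
      using pw assms by (intro sum_mono mult_left_mono) auto
    also have "\<dots> = 2 ^ d * (\<Sum>i\<le>degree q. cmod (coeff q i)) * cmod y ^ d"
      by (simp add: sum_distrib_left sum_distrib_right mult_ac)
    also have "\<dots> \<le> B * cmod y ^ d" unfolding B_def by (intro mult_right_mono) auto
    finally show "cmod (poly q y) \<le> B * cmod y ^ d" .
  qed
qed

lemma bergman_order:
  assumes "p > 0"
  shows "p * real (bergman_order p \<alpha>) + \<alpha> > -1"
proof -
  obtain k :: nat where "(- 1 - \<alpha>) / p < real k" using reals_Archimedean2 by blast
  hence "p * real k + \<alpha> > -1" using assms by (simp add: field_simps)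
  thus ?thesis unfolding bergman_order_def by (rule LeastI)
qed

lemma space_sets_dv_measure:
  "space (dv_measure \<alpha> :: (complex ^ 'n) measure) = ball 0 1"
  "sets (dv_measure \<alpha> :: (complex ^ 'n) measure) = sets (restrict_space borel (ball 0 1))"
  by (auto simp: dv_measure_def Let_def weighted_volume_measure space_scale_measure)

lemma in_bergman_spaceI:
  fixes f :: "complex ^ 'n \<Rightarrow> complex"
  assumes f: "holomorphic_vec_on f (ball 0 1)" and k: "p * real k + \<alpha> > -1"
    and fin: "(\<integral>\<^sup>+ z. ennreal ((1 - (norm z)\<^sup>2) powr (p * real k) * cmod ((radial_deriv ^^ k) f z) powr p) \<partial>dv_measure \<alpha>) < \<infinity>"
  shows "f \<in> bergman_space p \<alpha>"
proof -
  let ?g = "\<lambda>z. complex_of_real ((1 - (norm z)\<^sup>2) ^ k) * (radial_deriv ^^ k) f z"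
  have "continuous_on (ball 0 1) ?g"
    using holomorphic_vec_on_imp_continuous_on[OF holomorphic_vec_on_radial_deriv_iterate[OF f open_ball]]
    by (intro continuous_intros) auto
  hence "?g \<in> borel_measurable (restrict_space borel (ball 0 1))" by (rule borel_measurable_continuous_on_restrict)
  hence "?g \<in> borel_measurable (dv_measure \<alpha>)"
    by (subst measurable_cong_sets[OF space_sets_dv_measure(2) refl])
  moreover have "(\<integral>\<^sup>+ z. ennreal (cmod (?g z) powr p) \<partial>dv_measure \<alpha>)
    = (\<integral>\<^sup>+ z. ennreal ((1 - (norm z)\<^sup>2) powr (p * real k) * cmod ((radial_deriv ^^ k) f z) powr p) \<partial>dv_measure \<alpha>)"
  proof (rule nn_integral_cong)
    fix z :: "complex ^ 'n" assume "z \<in> space (dv_measure \<alpha>)"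
    hence s: "1 - (norm z)\<^sup>2 > 0" by (intro one_minus_norm_square_pos) (simp add: space_sets_dv_measure)
    have "cmod (?g z) = (1 - (norm z)\<^sup>2) ^ k * cmod ((radial_deriv ^^ k) f z)"
      unfolding norm_mult norm_of_real using s by simp
    hence "cmod (?g z) powr p = ((1 - (norm z)\<^sup>2) ^ k) powr p * cmod ((radial_deriv ^^ k) f z) powr p" by (simp only: powr_mult)
    also have "((1 - (norm z)\<^sup>2) ^ k) powr p = (1 - (norm z)\<^sup>2) powr (p * real k)"
      using s by (simp add: powr_realpow[symmetric] powr_powr mult.commute)
    finally show "ennreal (cmod (?g z) powr p) = ennreal ((1 - (norm z)\<^sup>2) powr (p * real k) * cmod ((radial_deriv ^^ k) f z) powr p)" by simp
  qed
  ultimately show ?thesis using f k fin unfolding bergman_space_def in_Lp_def by auto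
qed

text \<open>
  The exponent \<open>s\<close> is chosen with \<open>p s > n + 1 + \<alpha>\<close>, which is the convergence condition of
  \<open>forelli_rudin_upper\<close> and also makes the power of \<open>r\<close> in the norm dominate \<open>|f(0)| = 1\<close>.
\<close>

proposition carleson_necessary:
  fixes p \<alpha> :: real and \<mu> :: "(complex ^ 'n) measure"
  assumes \<alpha>: "\<alpha> > - (real CARD('n) + 1)" and p: "0 < p" "p \<le> 1" and \<mu>: "borel_measure_on_ball \<mu>"
    and C0: "C0 > 0"
    and a: "\<And>f. f \<in> bergman_space p \<alpha> \<Longrightarrow>
      (\<integral>\<^sup>+ w. ennreal (cmod (f w) powr p) \<partial>\<mu>) \<le> ennreal C0 * ennreal_powr (bergman_norm p \<alpha> f) p"
  obtains C where "C > 0" "\<And>\<zeta> r. norm \<zeta> = 1 \<Longrightarrow> 0 < r \<Longrightarrow> r < 1 \<Longrightarrow>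
      emeasure \<mu> (carleson_tube r \<zeta>) \<le> ennreal (C * r powr (real CARD('n) + 1 + \<alpha>))"
proof -
  define e where "e = real CARD('n) + 1 + \<alpha>"
  define N where "N = bergman_order p \<alpha>"
  define t where "t = p * real N + \<alpha>"
  have t: "t > -1" unfolding t_def N_def by (rule bergman_order[OF p(1)])
  obtain s :: nat where "e / p < real s" using reals_Archimedean2 by blast
  hence s: "p * real s > e" using p by (simp add: field_simps)
  define q where "q = p * real (s + N)"
  have q: "q > real CARD('n) + 1 + t" using s by (simp add: q_def t_def e_def algebra_simps)
  define \<kappa> where "\<kappa> = p * real s - e"
  have \<kappa>: "\<kappa> > 0" using s by (simp add: \<kappa>_def)
  obtain Cf where Cf: "Cf > 0" and FR: "\<And>(\<zeta> :: complex ^ 'n) r. norm \<zeta> = 1 \<Longrightarrow> 0 < r \<Longrightarrow> r < 1 \<Longrightarrow>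
      (\<integral>\<^sup>+ z. ennreal (cmod (1 - hermitian_inner z ((1 - r) *\<^sub>R \<zeta>)) powr (- q)) \<partial>weighted_volume t)
        \<le> ennreal (Cf * r powr (real CARD('n) + 1 + t - q))"
    by (rule forelli_rudin_upper[OF t q]) (rule that)
  obtain c where c: "c > 0" and dv: "\<And>(g :: complex ^ 'n \<Rightarrow> complex) s. holomorphic_vec_on g (ball 0 1) \<Longrightarrow>
    (\<integral>\<^sup>+ z. ennreal ((1 - (norm z)\<^sup>2) powr s * cmod (g z) powr p) \<partial>dv_measure \<alpha>)
      = ennreal c * (\<integral>\<^sup>+ z. indicator (ball 0 1) z * ennreal ((1 - (norm z)\<^sup>2) powr (s + \<alpha>) * cmod (g z) powr p) \<partial>lborel)"
    by (rule weighted_integral_dv_measure[where 'n = 'n and \<alpha> = \<alpha> and p = p]) (rule that)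
  obtain B where B: "B > 0" "\<And>y. cmod y \<ge> 1 / 2 \<Longrightarrow> cmod (poly (kernel_poly s N) y) \<le> B * cmod y ^ (s + N)"
    using poly_norm_bound[OF degree_kernel_poly] by metis
  define K where "K = c * B powr p * Cf"
  have K: "K > 0" using c B Cf by (simp add: K_def)
  show ?thesis
  proof (rule that[of "2 powr (p * real s) * C0 * (1 + K)"])
    show "2 powr (p * real s) * C0 * (1 + K) > 0" using C0 K by simp
    fix \<zeta> :: "complex ^ 'n" and r :: real
    assume \<zeta>: "norm \<zeta> = 1" and r: "0 < r" "r < 1"
    \<comment> \<open>The poles \<open>\<langle>z, a\<rangle> = 1\<close> of the test function lie outside the closed ball; the closest to it is \<open>\<zeta> / (1 - r)\<close>.\<close>
    define a where "a = (1 - r) *\<^sub>R \<zeta>"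
    have na: "norm a \<le> 1" using \<zeta> r by (simp add: a_def)
    define f where "f z = poly (kernel_poly s 0) (1 / (1 - hermitian_inner z a))" for z
    have f_hol: "holomorphic_vec_on f (ball 0 1)"
      unfolding f_def[abs_def] by (rule radial_deriv_iterate_kernel(1)[OF na])
    define g where "g = (radial_deriv ^^ N) f"
    have g_hol: "holomorphic_vec_on g (ball 0 1)"
      unfolding g_def by (rule holomorphic_vec_on_radial_deriv_iterate[OF f_hol open_ball])
    have g_bound: "cmod (g z) powr p \<le> B powr p * cmod (1 - hermitian_inner z a) powr (- q)" if z: "norm z < 1" for z
    proof -
      have ne: "hermitian_inner z a \<noteq> 1" and le2: "cmod (1 - hermitian_inner z a) \<le> 2"
        using hermitian_inner_ne_1[OF z na] by auto
      define x where "x = cmod (1 - hermitian_inner z a)"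
      have x: "0 < x" "x \<le> 2" using ne le2 by (auto simp: x_def)
      have ny: "cmod (1 / (1 - hermitian_inner z a)) = 1 / x" by (simp add: x_def norm_divide)
      have "g z = poly (kernel_poly s N) (1 / (1 - hermitian_inner z a))"
        unfolding g_def f_def[abs_def] by (rule radial_deriv_iterate_kernel(2)[OF na z])
      hence "cmod (g z) \<le> B * (1 / x) ^ (s + N)"
        using B(2)[of "1 / (1 - hermitian_inner z a)"] x unfolding ny by (simp add: field_simps)
      hence "cmod (g z) powr p \<le> (B * (1 / x) ^ (s + N)) powr p" using p by (intro powr_mono2) auto
      also have "\<dots> = B powr p * ((1 / x) ^ (s + N)) powr p" by (rule powr_mult)
      also have "((1 / x) ^ (s + N)) powr p = ((1 / x) powr real (s + N)) powr p"
        using x by (subst powr_realpow) auto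
      also have "\<dots> = x powr (- q)"
        using x by (simp only: powr_powr q_def) (simp add: powr_divide powr_minus_divide mult.commute)
      finally show ?thesis by (simp add: x_def)
    qed
    define I where "I = (\<integral>\<^sup>+ z. ennreal ((1 - (norm z)\<^sup>2) powr (p * real N) * cmod (g z) powr p) \<partial>dv_measure \<alpha>)"
    have I_le: "I \<le> ennreal (K * r powr (- \<kappa>))"
    proof -
      have "I = ennreal c * (\<integral>\<^sup>+ z. indicator (ball 0 1) z * ennreal ((1 - (norm z)\<^sup>2) powr t * cmod (g z) powr p) \<partial>lborel)"
        unfolding I_def t_def by (rule dv[OF g_hol])
      also have "(\<integral>\<^sup>+ z. indicator (ball 0 1) z * ennreal ((1 - (norm z)\<^sup>2) powr t * cmod (g z) powr p) \<partial>lborel)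
        = (\<integral>\<^sup>+ z. ennreal (cmod (g z) powr p) \<partial>weighted_volume t)"
      proof -
        have "(\<lambda>z. indicator (ball 0 1) z * ennreal ((1 - (norm z)\<^sup>2) powr 0 * cmod (g z) powr p))
          = (\<lambda>z. indicator (ball 0 1) z * ennreal (cmod (g z) powr p))"
        proof
          fix z :: "complex ^ 'n"
          show "indicator (ball 0 1) z * ennreal ((1 - (norm z)\<^sup>2) powr 0 * cmod (g z) powr p)
            = indicator (ball 0 1) z * ennreal (cmod (g z) powr p)"
            using one_minus_norm_square_pos[of z] by (cases "z \<in> ball 0 1") auto
        qed
        with measurable_on_ball[OF g_hol, of 0 p]
        have m0: "(\<lambda>z. indicator (ball 0 1) z * ennreal (cmod (g z) powr p)) \<in> borel_measurable borel" by simp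
        show ?thesis unfolding nn_integral_weighted_volume[OF m0] by (simp add: ennreal_mult)
      qed
      also have "\<dots> \<le> (\<integral>\<^sup>+ z. ennreal (B powr p) * ennreal (cmod (1 - hermitian_inner z a) powr (- q)) \<partial>weighted_volume t)"
        using g_bound B
        by (intro nn_integral_mono) (auto simp: weighted_volume_measure ennreal_mult[symmetric] intro!: ennreal_leI)
      also have "\<dots> = ennreal (B powr p) * (\<integral>\<^sup>+ z. ennreal (cmod (1 - hermitian_inner z a) powr (- q)) \<partial>weighted_volume t)"
      proof (rule nn_integral_cmult)
        have "(\<lambda>z. ennreal (cmod (1 - hermitian_inner z a) powr (- q))) \<in> borel_measurable (restrict_space borel (ball 0 1))"
          by (intro measurable_restrict_space1) measurable
        thus "(\<lambda>z. ennreal (cmod (1 - hermitian_inner z a) powr (- q))) \<in> borel_measurable (weighted_volume t)"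
          by (subst measurable_cong_sets[OF weighted_volume_measure(1) refl])
      qed
      also have "\<dots> \<le> ennreal (B powr p) * ennreal (Cf * r powr (real CARD('n) + 1 + t - q))"
        unfolding a_def by (intro mult_left_mono FR \<zeta> r) simp
      also have "real CARD('n) + 1 + t - q = - \<kappa>" by (simp add: \<kappa>_def t_def q_def e_def algebra_simps)
      finally have "I \<le> ennreal c * (ennreal (B powr p) * ennreal (Cf * r powr (- \<kappa>)))" by (simp add: mult_left_mono)
      also have "\<dots> = ennreal (K * r powr (- \<kappa>))"
        using c Cf by (simp add: K_def ennreal_mult mult.assoc)
      finally show ?thesis .
    qed
    have f0: "f 0 = 1" by (simp add: f_def hermitian_inner_simps poly_monom)
    have in_space: "f \<in> bergman_space p \<alpha>"
      by (rule in_bergman_spaceI[OF f_hol, of p N])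
        (use t order_le_less_trans[OF I_le] in \<open>auto simp: t_def I_def g_def\<close>)
    obtain i where i: "I = ennreal i" "i \<ge> 0" using I_le by (cases I) (auto simp: top_unique)
    have i_le: "i \<le> K * r powr (- \<kappa>)" using I_le i K by (simp add: ennreal_le_iff)
    have "ennreal_powr (bergman_norm p \<alpha> f) p \<le> ennreal (1 + i)"
      using ennreal_powr_norm_le[OF p, of "cmod (f 0)" i] i
      by (simp add: bergman_norm_def Let_def I_def g_def N_def f0)
    also have "1 + i \<le> (1 + K) * r powr (- \<kappa>)"
    proof -
      have "1 \<le> r powr (- \<kappa>)" using r \<kappa> powr_mono'[of "- \<kappa>" 0 r] by simp
      thus ?thesis using i_le by (simp add: algebra_simps)
    qed
    hence "ennreal (1 + i) \<le> ennreal ((1 + K) * r powr (- \<kappa>))" by (rule ennreal_leI)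
    finally have norm_le: "ennreal_powr (bergman_norm p \<alpha> f) p \<le> ennreal ((1 + K) * r powr (- \<kappa>))" .
    let ?Q = "carleson_tube r \<zeta>"
    have Q: "?Q \<in> sets \<mu>" by (intro borel_measure_on_ball_sets(2)[OF \<mu>]) (auto simp: carleson_tube_def)
    define L where "L = (2 * r) powr (- (p * real s))"
    have L: "L > 0" using r by (simp add: L_def)
    have "ennreal L * emeasure \<mu> ?Q = (\<integral>\<^sup>+ z. ennreal L * indicator ?Q z \<partial>\<mu>)"
      by (rule nn_integral_cmult_indicator[OF Q, symmetric])
    also have "\<dots> \<le> (\<integral>\<^sup>+ z. ennreal (cmod (f z) powr p) \<partial>\<mu>)"
    proof (rule nn_integral_mono)
      fix z
      show "ennreal L * indicator ?Q z \<le> ennreal (cmod (f z) powr p)"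
      proof (cases "z \<in> ?Q")
        case True
        hence z: "norm z < 1" and d: "cmod (1 - hermitian_inner z \<zeta>) < r" by (auto simp: carleson_tube_def)
        define x where "x = cmod (1 - hermitian_inner z a)"
        have x0: "x > 0" using hermitian_inner_ne_1(1)[OF z na] by (simp add: x_def)
        have h1: "cmod (hermitian_inner z \<zeta>) \<le> 1" using cmod_hermitian_inner_le[of z \<zeta>] z \<zeta> by simp
        have "1 - hermitian_inner z a = (1 - hermitian_inner z \<zeta>) + of_real r * hermitian_inner z \<zeta>"
          unfolding a_def hermitian_inner_simps by (simp add: algebra_simps)
        hence "x \<le> cmod (1 - hermitian_inner z \<zeta>) + cmod (of_real r * hermitian_inner z \<zeta>)"
          unfolding x_def by (metis norm_triangle_ineq)
        also have "cmod (of_real r * hermitian_inner z \<zeta>) \<le> r * 1"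
          unfolding norm_mult norm_of_real using r h1 by (intro mult_mono) auto
        finally have x: "x \<le> 2 * r" using d by simp
        have "L \<le> x powr (- (p * real s))"
          unfolding L_def using x x0 p by (intro powr_mono2') auto
        also have "\<dots> = cmod (f z) powr p"
        proof -
          have "cmod (f z) = (1 / x) ^ s" by (simp add: f_def poly_monom norm_power norm_divide x_def)
          also have "\<dots> = x powr (- real s)" using x0 by (simp add: powr_minus_divide powr_realpow power_divide)
          finally show ?thesis by (simp add: powr_powr mult.commute)
        qed
        finally show ?thesis using True by (simp add: ennreal_leI)
      qed simp
    qed
    also have "\<dots> \<le> ennreal C0 * ennreal_powr (bergman_norm p \<alpha> f) p" by (rule assms(6)[OF in_space])
    also have "\<dots> \<le> ennreal C0 * ennreal ((1 + K) * r powr (- \<kappa>))" by (intro mult_left_mono norm_le) simp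
    also have "\<dots> = ennreal (C0 * ((1 + K) * r powr (- \<kappa>)))" using C0 K by (simp add: ennreal_mult)
    also have "C0 * ((1 + K) * r powr (- \<kappa>)) = L * (2 powr (p * real s) * C0 * (1 + K) * r powr e)"
    proof -
      have "L * 2 powr (p * real s) * r powr e = r powr (- \<kappa>)"
        using r by (simp add: L_def powr_mult \<kappa>_def powr_minus field_simps powr_diff)
      hence "C0 * (1 + K) * (L * 2 powr (p * real s) * r powr e) = C0 * (1 + K) * r powr (- \<kappa>)" by simp
      thus ?thesis by (simp only: mult_ac)
    qed
    also have "ennreal (L * (2 powr (p * real s) * C0 * (1 + K) * r powr e)) = ennreal L * ennreal (2 powr (p * real s) * C0 * (1 + K) * r powr e)"
      using L C0 K by (simp add: ennreal_mult)
    finally show "emeasure \<mu> ?Q \<le> ennreal (2 powr (p * real s) * C0 * (1 + K) * r powr (real CARD('n) + 1 + \<alpha>))"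
      using L by (subst (asm) ennreal_mult_le_mult_iff) (auto simp: e_def)
  qed
qed

section \<open>The characterization\<close>

theorem theorem46:
  fixes p \<alpha> :: real and \<mu> :: "(complex ^ 'n) measure"
  assumes "\<alpha> > - (real CARD('n) + 1)"
    and "0 < p" and "p \<le> 1"
    and "borel_measure_on_ball \<mu>"
  shows "(\<exists>C>0. \<forall>f \<in> bergman_space p \<alpha>.
            (\<integral>\<^sup>+ w. ennreal (cmod (f w) powr p) \<partial>\<mu>)
              \<le> ennreal C * ennreal_powr (bergman_norm p \<alpha> f) p)
     \<longleftrightarrow> (\<exists>C>0. \<forall>\<zeta> \<in> sphere 0 1. \<forall>r \<in> {0<..<1}.
            emeasure \<mu> (carleson_tube r \<zeta>) \<le> ennreal (C * r powr (real CARD('n) + 1 + \<alpha>)))"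
proof
  assume "\<exists>C>0. \<forall>f \<in> bergman_space p \<alpha>.
            (\<integral>\<^sup>+ w. ennreal (cmod (f w) powr p) \<partial>\<mu>)
              \<le> ennreal C * ennreal_powr (bergman_norm p \<alpha> f) p"
  then obtain C0 where C0: "C0 > 0" "\<And>f. f \<in> bergman_space p \<alpha> \<Longrightarrow>
      (\<integral>\<^sup>+ w. ennreal (cmod (f w) powr p) \<partial>\<mu>) \<le> ennreal C0 * ennreal_powr (bergman_norm p \<alpha> f) p" by auto
  obtain C where "C > 0" "\<And>\<zeta> r. norm \<zeta> = 1 \<Longrightarrow> 0 < r \<Longrightarrow> r < 1 \<Longrightarrow>
      emeasure \<mu> (carleson_tube r \<zeta>) \<le> ennreal (C * r powr (real CARD('n) + 1 + \<alpha>))"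
    by (rule carleson_necessary[OF assms C0]) (assumption, rule that)
  thus "\<exists>C>0. \<forall>\<zeta> \<in> sphere 0 1. \<forall>r \<in> {0<..<1}.
            emeasure \<mu> (carleson_tube r \<zeta>) \<le> ennreal (C * r powr (real CARD('n) + 1 + \<alpha>))" by auto
next
  assume "\<exists>C>0. \<forall>\<zeta> \<in> sphere 0 1. \<forall>r \<in> {0<..<1}.
            emeasure \<mu> (carleson_tube r \<zeta>) \<le> ennreal (C * r powr (real CARD('n) + 1 + \<alpha>))"
  then obtain C0 where "\<forall>\<zeta> \<in> sphere 0 1. \<forall>r \<in> {0<..<1}.
            emeasure \<mu> (carleson_tube r \<zeta>) \<le> ennreal (C0 * r powr (real CARD('n) + 1 + \<alpha>))" by blast
  hence C0: "\<And>\<zeta> r. norm \<zeta> = 1 \<Longrightarrow> 0 < r \<Longrightarrow> r < 1 \<Longrightarrow>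
      emeasure \<mu> (carleson_tube r \<zeta>) \<le> ennreal (C0 * r powr (real CARD('n) + 1 + \<alpha>))" by auto
  obtain C where "C > 0" "\<And>f. holomorphic_vec_on f (ball 0 1) \<Longrightarrow>
    (\<integral>\<^sup>+ w. ennreal (cmod (f w) powr p) \<partial>\<mu>) \<le> ennreal C * ennreal_powr (bergman_norm p \<alpha> f) p"
    by (rule carleson_embedding[OF assms C0]) (assumption+, rule that)
  thus "\<exists>C>0. \<forall>f \<in> bergman_space p \<alpha>.
            (\<integral>\<^sup>+ w. ennreal (cmod (f w) powr p) \<partial>\<mu>)
              \<le> ennreal C * ennreal_powr (bergman_norm p \<alpha> f) p"
    by (auto simp: bergman_space_def)
qed

end
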